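(* Let $p,m,q\ge0$, $n=p+m+q$, $G=GL_n(\mathbb C)$, and let $\gamma$ be a $(p,m,q)$-preclan with $v_\gamma=e$. Under the identification $Q\backslash G\cong Gr_q(\mathbb C^n)$, $Qg\mapsto$ the span of the last $q$ rows of $g$, one has $$\overline{Q\backslash Q\dot\gamma\bar B}\cdot u_0=\Pi_{f_\gamma}.$$
   Context: **Groups.** $Q=\begin{bmatrix}GL_{p+m}&*\\0&GL_q\end{bmatrix}\subset G$. $\bar B=\begin{bmatrix}B_p&0\\0&B_{m+q}\end{bmatrix}$, $B_k$ the upper triangular matrices in $GL_k$. $u_0\in GL_n$ is the permutation matrix of $p(p-1)\cdots1(p+1)\cdots n$ (block diagonal: the antidiagonal $p\times p$ permutation matrix and the identity of size $m+q$). $Q\backslash Q\dot\gamma\bar B$ denotes the image of $Q\dot\gamma\bar B$ in $Q\backslash G$, and $\cdot u_0$ is right multiplication. **Preclans.** A $(p,m,q)$-preclan is a partial matching on nodes $1,\dots,n$ (disjoint pairs $(i,j)$, $i<j$; left-end $i$, right-end $j$), each unmatched node being colored $+$, colored $-$, or uncolored, with (number of $+$'s)+(number of matchings)$=p$, (number of $-$'s)+(number of matchings)$=q$, and $m$ uncolored (unmatched) nodes. $v_\gamma\in S_n$: label the left-ends and $+$'s from left to right by $1,\dots,p$, then the other nodes from left to right by $p+1,\dots,n$, and read the labels from left to right; so $v_\gamma=e$ (identity) iff the first $p$ nodes are all $+$'s or left-ends. **$\dot\gamma$.** $\sigma_\gamma\in S_n$: assign $1,\dots,p$ to the $+$'s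 and left-ends from left to right, then $p+1,\dots,p+m$ to the uncolored nodes, then $p+m+1,\dots,n$ to the $-$'s and right-ends; $\sigma_\gamma(i)$ is the label of node $i$. $\dot\gamma\in GL_n$ has $i$-th column $\mathbf e_{\sigma_\gamma(i)}+\mathbf e_{\sigma_\gamma(j)}$ if $i$ is the left-end of a matching $(i,j)$, and $\mathbf e_{\sigma_\gamma(i)}$ otherwise. **$f_\gamma$** (for $v_\gamma=e$). $f_\gamma:\mathbb Z\to\mathbb Z$ satisfies $f_\gamma(i+n)=f_\gamma(i)+n$ and: for $1\le i\le p$, if node $i$ is $+$ then $f_\gamma(p+1-i)=p+1-i+\#\{\text{matchings }(a,b)\text{ with }a<i<b\}$, and if $(i,j)$ is a matching then $f_\gamma(p+1-i)=j$; for $1\le i\le m$, $f_\gamma(p+i)$ is the position of the $i$-th uncolored node; with $q_1$ the number of matchings and $q_2=q-q_1$ the number of $-$'s, $f_\gamma(p+m+i)=n+i$ for $1\le i\le q_1$ and $f_\gamma(p+m+q_1+i)=n+(\text{position of the }i\text{-th }-)$ for $1\le i\le q_2$. **Positroid varieties.** $\operatorname{Bound}(k,n)$ is the set of bijections $f:\mathbb Z\to\mathbb Z$ with $f(i+n)=f(i)+n$, $i\le f(i)\le i+n$, $\sum_{i=1}^n(f(i)-i)=kn$; one has $f_\gamma\in\operatorname{Bound}(q,n)$. For $V\in Gr_k(\mathbb C^n)$ (a $k$-dimensional subspace), choose a full rank $k\times n$ matrix with row span $V$ and columns $\mathbf v_1,\dots,\mathbf v_n$, extended by $\mathbf v_{i+n}=\mathbf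 v_i$; set $f_V(i)=\min\{j>i:\mathbf v_i\in\operatorname{span}(\mathbf v_{i+1},\dots,\mathbf v_j)\}$, with $f_V(i)=i$ if $\mathbf v_i=0$. Then $f_V\in\operatorname{Bound}(k,n)$, and for $f\in\operatorname{Bound}(k,n)$ the positroid variety is $\Pi_f=\overline{\{V\in Gr_k(\mathbb C^n):f_V=f\}}$. *)

theory Defs
  imports
    "HOL-Analysis.Abstract_Topology"
    "Jordan_Normal_Form.VS_Connect"
begin

text \<open>Below, \<open>closure_of\<close> is the closure in a topological space.\<close>

no_notation Congruence.eq_closure_of (\<open>closure'_of\<index>\<close>)


section \<open>Preclans\<close>

datatype node_color = Plus_node | Minus_node | Uncolored_node

text \<open>
  The nodes are $1,\dots,n$. The value of \<open>color\<close> is only meaningful on unmatched nodes, where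
  \<open>Uncolored_node\<close> stands for the absence of a colour; all definitions below consult it
  only there.
\<close>

record preclan =
  matching :: "(nat \<times> nat) set"
  color :: "nat \<Rightarrow> node_color"

definition left_ends :: "preclan \<Rightarrow> nat set" where
  "left_ends \<gamma> = fst ` matching \<gamma>"

definition right_ends :: "preclan \<Rightarrow> nat set" where
  "right_ends \<gamma> = snd ` matching \<gamma>"

definition nodes_of_color :: "nat \<Rightarrow> preclan \<Rightarrow> node_color \<Rightarrow> nat set" where
  "nodes_of_color n \<gamma> c = {i \<in> {1..n} - (left_ends \<gamma> \<union> right_ends \<gamma>). color \<gamma> i = c}"

definition is_preclan :: "nat \<Rightarrow> nat \<Rightarrow> nat \<Rightarrow> preclan \<Rightarrow> bool" where
  "is_preclan p m q \<gamma> \<longleftrightarrow>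
     (let n = p + m + q in
      (\<forall>(i, j) \<in> matching \<gamma>. 1 \<le> i \<and> i < j \<and> j \<le> n) \<and>
      (\<forall>(i, j) \<in> matching \<gamma>. \<forall>(i', j') \<in> matching \<gamma>.
          (i, j) \<noteq> (i', j') \<longrightarrow> {i, j} \<inter> {i', j'} = {}) \<and>
      card (nodes_of_color n \<gamma> Plus_node) + card (matching \<gamma>) = p \<and>
      card (nodes_of_color n \<gamma> Minus_node) + card (matching \<gamma>) = q \<and>
      card (nodes_of_color n \<gamma> Uncolored_node) = m)"

text \<open>The right-end of the matching with left-end \<open>i\<close>.\<close>

definition mate :: "preclan \<Rightarrow> nat \<Rightarrow> nat" where
  "mate \<gamma> i = (THE j. (i, j) \<in> matching \<gamma>)"

text \<open>Position of \<open>i\<close> when the elements of \<open>S\<close> are numbered $1,2,\dots$ from left to right,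
  and conversely the \<open>k\<close>-th element of \<open>S\<close>.\<close>

definition label_in :: "nat set \<Rightarrow> nat \<Rightarrow> nat" where
  "label_in S i = card {a \<in> S. a \<le> i}"

definition nth_elem :: "nat set \<Rightarrow> nat \<Rightarrow> nat" where
  "nth_elem S k = sorted_list_of_set S ! (k - 1)"

definition plus_or_left :: "nat \<Rightarrow> preclan \<Rightarrow> nat set" where
  "plus_or_left n \<gamma> = nodes_of_color n \<gamma> Plus_node \<union> left_ends \<gamma>"

text \<open>Permutations of $1,\dots,n$ are functions that are the identity elsewhere.\<close>

definition v_perm :: "nat \<Rightarrow> nat \<Rightarrow> nat \<Rightarrow> preclan \<Rightarrow> nat \<Rightarrow> nat" where
  "v_perm p m q \<gamma> i =
     (let n = p + m + q; S = plus_or_left n \<gamma> in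
      if i \<notin> {1..n} then i
      else if i \<in> S then label_in S i
      else p + label_in ({1..n} - S) i)"

definition sigma_perm :: "nat \<Rightarrow> nat \<Rightarrow> nat \<Rightarrow> preclan \<Rightarrow> nat \<Rightarrow> nat" where
  "sigma_perm p m q \<gamma> i =
     (let n = p + m + q; S = plus_or_left n \<gamma>; U = nodes_of_color n \<gamma> Uncolored_node;
          T = nodes_of_color n \<gamma> Minus_node \<union> right_ends \<gamma> in
      if i \<notin> {1..n} then i
      else if i \<in> S then label_in S i
      else if i \<in> U then p + label_in U i
      else p + m + label_in T i)"

text \<open>Matrix indices are $0$-based: $\mathbf e_k$ is \<open>unit_vec n (k - 1)\<close>.\<close>

definition gamma_dot :: "nat \<Rightarrow> nat \<Rightarrow> nat \<Rightarrow> preclan \<Rightarrow> complex mat" where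
  "gamma_dot p m q \<gamma> =
     (let n = p + m + q; \<sigma> = sigma_perm p m q \<gamma> in
      mat_of_cols n
        (map (\<lambda>i. if i \<in> left_ends \<gamma>
                  then unit_vec n (\<sigma> i - 1) + unit_vec n (\<sigma> (mate \<gamma> i) - 1)
                  else unit_vec n (\<sigma> i - 1))
          [1..<n + 1]))"

text \<open>The values $f_\gamma(1),\dots,f_\gamma(n)$, for $v_\gamma = e$ (so that each of the first
  \<open>p\<close> nodes is a left-end or a $+$).\<close>

definition f_window :: "nat \<Rightarrow> nat \<Rightarrow> nat \<Rightarrow> preclan \<Rightarrow> nat \<Rightarrow> nat" where
  "f_window p m q \<gamma> x =
     (let n = p + m + q; q1 = card (matching \<gamma>) in
      if x \<le> p then
        (let i = p + 1 - x in
         if i \<in> left_ends \<gamma> then mate \<gamma> i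
         else p + 1 - i + card {(a, b) \<in> matching \<gamma>. a < i \<and> i < b})
      else if x \<le> p + m then nth_elem (nodes_of_color n \<gamma> Uncolored_node) (x - p)
      else if x \<le> p + m + q1 then n + (x - (p + m))
      else n + nth_elem (nodes_of_color n \<gamma> Minus_node) (x - (p + m + q1)))"

text \<open>For \<open>n = 0\<close> the defining conditions are void; the identity is the only element of
  $\operatorname{Bound}(0,0)$.\<close>

definition f_gamma :: "nat \<Rightarrow> nat \<Rightarrow> nat \<Rightarrow> preclan \<Rightarrow> int \<Rightarrow> int" where
  "f_gamma p m q \<gamma> x =
     (let n = int (p + m + q) in
      if n = 0 then x
      else int (f_window p m q \<gamma> (nat ((x - 1) mod n + 1))) + n * ((x - 1) div n))"


section \<open>The groups\<close>

definition GL :: "nat \<Rightarrow> complex mat monoid" where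
  "GL n = units_of (ring_mat TYPE(complex) n ())"

definition Q_grp :: "nat \<Rightarrow> nat \<Rightarrow> nat \<Rightarrow> complex mat set" where
  "Q_grp p m q = {four_block_mat A X (0\<^sub>m q (p + m)) D | A X D.
     A \<in> carrier (GL (p + m)) \<and> X \<in> carrier_mat (p + m) q \<and> D \<in> carrier (GL q)}"

definition B_grp :: "nat \<Rightarrow> complex mat set" where
  "B_grp k = {b \<in> carrier (GL k). upper_triangular b}"

definition Bbar_grp :: "nat \<Rightarrow> nat \<Rightarrow> nat \<Rightarrow> complex mat set" where
  "Bbar_grp p m q = {four_block_mat b (0\<^sub>m p (m + q)) (0\<^sub>m (m + q) p) b' | b b'.
     b \<in> B_grp p \<and> b' \<in> B_grp (m + q)}"

definition u0 :: "nat \<Rightarrow> nat \<Rightarrow> nat \<Rightarrow> complex mat" where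
  "u0 p m q = four_block_mat
     (mat p p (\<lambda>(i, j). if i + j + 1 = p then 1 else 0)) (0\<^sub>m p (m + q))
     (0\<^sub>m (m + q) p) (1\<^sub>m (m + q))"


section \<open>Zariski topology\<close>

inductive_set poly_funs :: "nat \<Rightarrow> nat \<Rightarrow> (complex mat \<Rightarrow> complex) set" for r c :: nat where
  const: "(\<lambda>A. a) \<in> poly_funs r c"
| entry: "i < r \<Longrightarrow> j < c \<Longrightarrow> (\<lambda>A. A $$ (i, j)) \<in> poly_funs r c"
| add: "f \<in> poly_funs r c \<Longrightarrow> g \<in> poly_funs r c \<Longrightarrow> (\<lambda>A. f A + g A) \<in> poly_funs r c"
| mult: "f \<in> poly_funs r c \<Longrightarrow> g \<in> poly_funs r c \<Longrightarrow> (\<lambda>A. f A * g A) \<in> poly_funs r c"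

definition zariski_mat :: "nat \<Rightarrow> nat \<Rightarrow> complex mat topology" where
  "zariski_mat r c =
     topology_generated_by {{A \<in> carrier_mat r c. f A \<noteq> 0} | f. f \<in> poly_funs r c}"

lemma openin_zariski_mat:
  "openin (zariski_mat r c) U \<longleftrightarrow>
     (\<exists>F \<subseteq> poly_funs r c. U = {A \<in> carrier_mat r c. \<exists>f \<in> F. f A \<noteq> 0})"
proof
  assume "openin (zariski_mat r c) U"
  then have "generate_topology_on
      {{A \<in> carrier_mat r c. f A \<noteq> 0} | f. f \<in> poly_funs r c} U"
    unfolding zariski_mat_def openin_topology_generated_by_iff .
  then show "\<exists>F \<subseteq> poly_funs r c. U = {A \<in> carrier_mat r c. \<exists>f \<in> F. f A \<noteq> 0}"
  proof induction
    case Empty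
    show ?case by (rule exI[of _ "{}"]) auto
  next
    case (Int a b)
    then obtain F G where F: "F \<subseteq> poly_funs r c" "a = {A \<in> carrier_mat r c. \<exists>f \<in> F. f A \<noteq> 0}"
      and G: "G \<subseteq> poly_funs r c" "b = {A \<in> carrier_mat r c. \<exists>f \<in> G. f A \<noteq> 0}"
      by auto
    have "{\<lambda>A. f A * g A | f g. f \<in> F \<and> g \<in> G} \<subseteq> poly_funs r c"
      using F G by (auto intro!: poly_funs.mult)
    moreover have "a \<inter> b = {A \<in> carrier_mat r c.
        \<exists>h \<in> {\<lambda>A. f A * g A | f g. f \<in> F \<and> g \<in> G}. h A \<noteq> 0}" (is "_ = ?R")
    proof
      show "a \<inter> b \<subseteq> ?R"
      proof
        fix A assume "A \<in> a \<inter> b"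
        then obtain f g where "A \<in> carrier_mat r c" "f \<in> F" "g \<in> G" "f A * g A \<noteq> 0"
          using F G by auto
        then show "A \<in> ?R"
          by (intro CollectI conjI bexI[of _ "\<lambda>A. f A * g A"]) auto
      qed
      show "?R \<subseteq> a \<inter> b" unfolding F(2) G(2) by auto
    qed
    ultimately show ?case by blast
  next
    case (UN K)
    then have "\<forall>k\<in>K. \<exists>F. F \<subseteq> poly_funs r c \<and> k = {A \<in> carrier_mat r c. \<exists>f \<in> F. f A \<noteq> 0}"
      by blast
    from bchoice[OF this] obtain F where F: "\<forall>k\<in>K. F k \<subseteq> poly_funs r c \<and>
        k = {A \<in> carrier_mat r c. \<exists>f \<in> F k. f A \<noteq> 0}"
      by blast
    have "\<Union>K = {A \<in> carrier_mat r c. \<exists>f \<in> \<Union>(F ` K). f A \<noteq> 0}"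
    proof (intro Set.set_eqI iffI)
      fix A assume "A \<in> \<Union>K"
      then obtain k where k: "k \<in> K" "A \<in> k" by auto
      moreover have "k = {A \<in> carrier_mat r c. \<exists>f \<in> F k. f A \<noteq> 0}" using F k by blast
      ultimately have "A \<in> carrier_mat r c" "\<exists>f \<in> F k. f A \<noteq> 0" by auto
      then show "A \<in> {A \<in> carrier_mat r c. \<exists>f \<in> \<Union>(F ` K). f A \<noteq> 0}" using k(1) by auto
    next
      fix A assume "A \<in> {A \<in> carrier_mat r c. \<exists>f \<in> \<Union>(F ` K). f A \<noteq> 0}"
      then obtain k where k: "k \<in> K" "A \<in> {A \<in> carrier_mat r c. \<exists>f \<in> F k. f A \<noteq> 0}" by auto
      moreover have "k = {A \<in> carrier_mat r c. \<exists>f \<in> F k. f A \<noteq> 0}" using F k(1) by blast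
      ultimately show "A \<in> \<Union>K" by blast
    qed
    moreover have "\<Union>(F ` K) \<subseteq> poly_funs r c" using F by blast
    ultimately show ?case by (intro exI[of _ "\<Union>(F ` K)"] conjI)
  next
    case (Basis s)
    then obtain f where "f \<in> poly_funs r c" "s = {A \<in> carrier_mat r c. f A \<noteq> 0}"
      by auto
    then show ?case by (intro exI[of _ "{f}"]) auto
  qed
next
  assume "\<exists>F \<subseteq> poly_funs r c. U = {A \<in> carrier_mat r c. \<exists>f \<in> F. f A \<noteq> 0}"
  then obtain F where F: "F \<subseteq> poly_funs r c" "U = {A \<in> carrier_mat r c. \<exists>f \<in> F. f A \<noteq> 0}"
    by auto
  have "U = (\<Union>f \<in> F. {A \<in> carrier_mat r c. f A \<noteq> 0})"
    using F by auto
  moreover have "openin (zariski_mat r c) {A \<in> carrier_mat r c. f A \<noteq> 0}" if "f \<in> F" for f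
    unfolding zariski_mat_def using F that by (intro topology_generated_by_Basis) auto
  ultimately show "openin (zariski_mat r c) U" by (auto intro!: openin_Union)
qed

definition quotient_topology :: "'a topology \<Rightarrow> ('a \<Rightarrow> 'b) \<Rightarrow> 'b topology" where
  "quotient_topology T h =
     topology (\<lambda>U. U \<subseteq> h ` topspace T \<and> openin T {x \<in> topspace T. h x \<in> U})"

lemma openin_quotient_topology:
  "openin (quotient_topology T h) U \<longleftrightarrow>
     U \<subseteq> h ` topspace T \<and> openin T {x \<in> topspace T. h x \<in> U}"
proof -
  have "istopology (\<lambda>U. U \<subseteq> h ` topspace T \<and> openin T {x \<in> topspace T. h x \<in> U})"
    unfolding istopology_def
  proof (intro conjI allI impI)
    fix S U
    assume "S \<subseteq> h ` topspace T \<and> openin T {x \<in> topspace T. h x \<in> S}"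
      and "U \<subseteq> h ` topspace T \<and> openin T {x \<in> topspace T. h x \<in> U}"
    moreover have "{x \<in> topspace T. h x \<in> S \<inter> U} =
        {x \<in> topspace T. h x \<in> S} \<inter> {x \<in> topspace T. h x \<in> U}"
      by auto
    ultimately show "S \<inter> U \<subseteq> h ` topspace T" "openin T {x \<in> topspace T. h x \<in> S \<inter> U}"
      by auto
  next
    fix K
    assume K: "\<forall>U\<in>K. U \<subseteq> h ` topspace T \<and> openin T {x \<in> topspace T. h x \<in> U}"
    then show "\<Union>K \<subseteq> h ` topspace T" by auto
    have "{x \<in> topspace T. h x \<in> \<Union>K} = (\<Union>U\<in>K. {x \<in> topspace T. h x \<in> U})"
      by auto
    with K show "openin T {x \<in> topspace T. h x \<in> \<Union>K}" by auto
  qed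
  then show ?thesis by (simp add: quotient_topology_def)
qed


section \<open>The Grassmannian and the quotient $Q\backslash G$\<close>

abbreviation vspan :: "nat \<Rightarrow> complex vec set \<Rightarrow> complex vec set" where
  "vspan k \<equiv> LinearCombinations.module.span class_ring (module_vec TYPE(complex) k)"

definition Gr :: "nat \<Rightarrow> nat \<Rightarrow> complex vec set set" where
  "Gr k n = {V. VectorSpace.subspace class_ring V (module_vec TYPE(complex) n) \<and>
     vectorspace.dim class_ring (module_vec TYPE(complex) n\<lparr>carrier := V\<rparr>) = k}"

definition row_span :: "nat \<Rightarrow> complex mat \<Rightarrow> complex vec set" where
  "row_span n A = vspan n (set (rows A))"

definition full_rank_mats :: "nat \<Rightarrow> nat \<Rightarrow> complex mat set" where
  "full_rank_mats k n = {A \<in> carrier_mat k n. row_span n A \<in> Gr k n}"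

text \<open>The variety $Gr_k(\mathbb C^n)$ is the quotient of the open set of full rank
  \<open>k \<times> n\<close> matrices by the left action of $GL_k$, which is a locally trivial bundle, so its
  Zariski topology is the quotient topology.\<close>

definition Gr_topology :: "nat \<Rightarrow> nat \<Rightarrow> complex vec set topology" where
  "Gr_topology k n =
     quotient_topology (subtopology (zariski_mat k n) (full_rank_mats k n)) (row_span n)"

definition coset_topology :: "nat \<Rightarrow> nat \<Rightarrow> nat \<Rightarrow> complex mat set topology" where
  "coset_topology p m q =
     (let n = p + m + q in
      quotient_topology (subtopology (zariski_mat n n) (carrier (GL n)))
        (\<lambda>g. Q_grp p m q #>\<^bsub>GL n\<^esub> g))"

definition last_rows_span :: "nat \<Rightarrow> nat \<Rightarrow> complex mat \<Rightarrow> complex vec set" where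
  "last_rows_span n q g = vspan n (set (drop (n - q) (rows g)))"

text \<open>The identification $Q\backslash G \cong Gr_q(\mathbb C^n)$; \<open>last_rows_span n q\<close> is
  constant on each coset.\<close>

definition coset_to_Gr :: "nat \<Rightarrow> nat \<Rightarrow> complex mat set \<Rightarrow> complex vec set" where
  "coset_to_Gr n q C = the_elem (last_rows_span n q ` C)"


section \<open>Positroid varieties\<close>

text \<open>The periodic extension $\mathbf v_i$, $i \in \mathbb Z$, of the columns
  $\mathbf v_1,\dots,\mathbf v_n$ of \<open>A\<close>.\<close>

definition per_col :: "nat \<Rightarrow> complex mat \<Rightarrow> int \<Rightarrow> complex vec" where
  "per_col n A i = col A (nat ((i - 1) mod int n))"

definition f_mat :: "nat \<Rightarrow> nat \<Rightarrow> complex mat \<Rightarrow> int \<Rightarrow> int" where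
  "f_mat k n A i =
     (if per_col n A i = 0\<^sub>v k then i
      else (LEAST j. j > i \<and> per_col n A i \<in> vspan k (per_col n A ` {i + 1..j})))"

text \<open>The result does not depend on the chosen matrix, since two choices differ by left
  multiplication by an element of $GL_k$.\<close>

definition f_subspace :: "nat \<Rightarrow> nat \<Rightarrow> complex vec set \<Rightarrow> int \<Rightarrow> int" where
  "f_subspace k n V = f_mat k n (SOME A. A \<in> full_rank_mats k n \<and> row_span n A = V)"

text \<open>Meant for \<open>f\<close> in $\operatorname{Bound}(k,n)$; for other \<open>f\<close> the set is empty.\<close>

definition positroid_variety :: "nat \<Rightarrow> nat \<Rightarrow> (int \<Rightarrow> int) \<Rightarrow> complex vec set set" where
  "positroid_variety k n f = Gr_topology k n closure_of {V \<in> Gr k n. f_subspace k n V = f}"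

end

theory Submission
  imports Defs "Jordan_Normal_Form.DL_Rank" "HOL-Computational_Algebra.Polynomial"
begin

text \<open>
  Write a point of the Grassmannian as the row space of a \<open>q \<times> n\<close> matrix. Since $v_\gamma = e$,
  the last \<open>q\<close> rows of $\dot\gamma$ form the matrix \<open>base_mat\<close>: the columns of right-ends and
  minus nodes are the unit vectors, each left-end repeats the unit vector of its right-end, and
  the other columns vanish. The double coset therefore becomes one orbit: all row spaces of
  \<open>g * base_mat * b * u0\<close>, where \<open>g\<close> is invertible and \<open>b\<close> performs upper triangular column
  operations among the first \<open>p\<close> columns and among the last \<open>m + q\<close> columns. The theorem says that
  this orbit and the open positroid cell $\{V : f_V = f_\gamma\}$ have the same closure, and this
  follows from two facts.

  The cell lies in the orbit (\<open>row_span_in_orbit\<close>). After \<open>u0\<close> has reversed the first \<open>p\<close>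
  columns, the values $f_V(1),\dots,f_V(p+m)$ say that triangular column operations can reduce a \<open>+\<close>
  column or an uncolored column to \<open>0\<close>, and the columns of the two ends of a matching to the same
  vector. These operations turn the matrix into \<open>g * base_mat\<close>.

  The cell is dense in the orbit (\<open>generic_general_position\<close>, \<open>f_mat_general_position\<close>). The
  matrices \<open>b\<close> range over a linear space, in which two nonempty Zariski open sets meet, because a
  nonzero polynomial on a line has finitely many zeros. Each value of $f_\gamma$ is forced by
  finitely many conditions ``these columns, together with these unit vectors, form a basis of
  $\mathbb C^q$''. Such a condition is open, and it holds at a suitable \<open>0/1\<close> matrix \<open>b\<close> that
  moves unit vectors to the right, so all of them hold simultaneously for generic \<open>b\<close>.

  It remains to compare the two topologies: taking the last \<open>q\<close> rows is an open continuous
  surjection from $GL_n$ to the full rank matrices, so the identification of the two quotients is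
  a homeomorphism (\<open>homeomorphic_map_coset_Gr\<close>) and commutes with closures.
\<close>

section \<open>Spans, row spaces and full rank\<close>

text \<open>The coefficients are indexed by \<open>J\<close> rather than by vectors, so that equal columns of a matrix
  need no special treatment.\<close>

lemma vspan_image_iff:
  assumes finJ: "finite J" and w: "\<And>k. k \<in> J \<Longrightarrow> w k \<in> carrier_vec n"
  shows "u \<in> vspan n (w ` J) \<longleftrightarrow>
    u \<in> carrier_vec n \<and> (\<exists>c. \<forall>r<n. u $ r = (\<Sum>k\<in>J. c k * w k $ r))"
proof
  interpret vec_space "TYPE(complex)" n .
  have W: "w ` J \<subseteq> carrier_vec n" using w by auto
  {
    assume u: "u \<in> span (w ` J)"
    from in_spanE[OF u] obtain a A where u: "u = lincomb a A" and A: "finite A" "A \<subseteq> w ` J"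
      by blast
    from A(2) obtain K where K: "K \<subseteq> J" "inj_on w K" "A = w ` K"
      by (auto simp: subset_image_inj)
    have "u $ r = (\<Sum>k\<in>J. (if k \<in> K then a (w k) else 0) * w k $ r)" if "r < n" for r
    proof -
      have "u $ r = (\<Sum>x\<in>A. a x * x $ r)"
        unfolding u by (intro lincomb_index that order_trans[OF A(2) W])
      also have "\<dots> = (\<Sum>k\<in>K. a (w k) * w k $ r)"
        unfolding K(3) using K(2) by (simp add: sum.reindex)
      also have "\<dots> = (\<Sum>k\<in>J. (if k \<in> K then a (w k) else 0) * w k $ r)"
        by (rule sum.mono_neutral_cong_left[OF finJ K(1)]) auto
      finally show ?thesis .
    qed
    moreover have "u \<in> carrier_vec n"
      unfolding u by (intro carrier_vecI lincomb_dim A(1) order_trans[OF A(2) W])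
    ultimately show "u \<in> carrier_vec n \<and> (\<exists>c. \<forall>r<n. u $ r = (\<Sum>k\<in>J. c k * w k $ r))"
      by (intro conjI exI[of _ "\<lambda>k. if k \<in> K then a (w k) else 0"]) auto
  next
    assume "u \<in> carrier_vec n \<and> (\<exists>c. \<forall>r<n. u $ r = (\<Sum>k\<in>J. c k * w k $ r))"
    then obtain c where u: "u \<in> carrier_vec n"
      and c: "\<And>r. r < n \<Longrightarrow> u $ r = (\<Sum>k\<in>J. c k * w k $ r)" by auto
    have "vec n (\<lambda>r. \<Sum>k\<in>K. c k * w k $ r) \<in> span (w ` J)" if "K \<subseteq> J" for K
    proof -
      from that finJ have "finite K" by (rule finite_subset)
      from this that show ?thesis
      proof (induction K)
        case empty
        have "vec n (\<lambda>r. 0) = (0\<^sub>v n :: complex vec)" by auto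
        then show ?case using span_is_monotone[of "{}" "w ` J"] span_empty by simp
      next
        case (insert k K)
        have "c k \<cdot>\<^sub>v w k \<in> span (w ` J)"
          using insert.prems W by (intro smult_in_span) (auto intro!: span_mem)
        then have "c k \<cdot>\<^sub>v w k + vec n (\<lambda>r. \<Sum>k\<in>K. c k * w k $ r) \<in> span (w ` J)"
          using insert W by (intro span_add1) auto
        also have "c k \<cdot>\<^sub>v w k + vec n (\<lambda>r. \<Sum>k\<in>K. c k * w k $ r)
            = vec n (\<lambda>r. \<Sum>k\<in>insert k K. c k * w k $ r)"
          using insert w[of k] by (intro eq_vecI) auto
        finally show ?case .
      qed
    qed
    from this[of J] have "vec n (\<lambda>r. \<Sum>k\<in>J. c k * w k $ r) \<in> span (w ` J)" by simp
    also have "vec n (\<lambda>r. \<Sum>k\<in>J. c k * w k $ r) = u" using u c by (intro eq_vecI) auto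
    finally show "u \<in> span (w ` J)" .
  }
qed

lemma vspan_carrier: "S \<subseteq> carrier_vec n \<Longrightarrow> vspan n S \<subseteq> carrier_vec n"
proof -
  interpret vec_space "TYPE(complex)" n .
  show "S \<subseteq> carrier_vec n \<Longrightarrow> span S \<subseteq> carrier_vec n" using span_closed by auto
qed

lemma vspan_mono: "S \<subseteq> S' \<Longrightarrow> vspan n S \<subseteq> vspan n S'"
proof -
  interpret vec_space "TYPE(complex)" n .
  show "S \<subseteq> S' \<Longrightarrow> span S \<subseteq> span S'" by (rule span_is_monotone)
qed

lemma vspan_superset: "S \<subseteq> carrier_vec n \<Longrightarrow> S \<subseteq> vspan n S"
proof -
  interpret vec_space "TYPE(complex)" n .
  show "S \<subseteq> carrier_vec n \<Longrightarrow> S \<subseteq> span S" by (rule in_own_span)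
qed

lemma vspan_empty: "vspan n {} = {0\<^sub>v n}"
proof -
  interpret vec_space "TYPE(complex)" n .
  show "span {} = {0\<^sub>v n}" using span_empty by simp
qed

lemma set_rows: "A \<in> carrier_mat k n \<Longrightarrow> set (rows A) = row A ` {..<k}"
  by (auto simp: rows_def)

lemma distinct_rows:
  fixes A :: "complex mat"
  assumes A: "A \<in> carrier_mat k n"
    and ind: "\<And>c r. (\<forall>j<n. (\<Sum>r<k. c r * A $$ (r, j)) = 0) \<Longrightarrow> r < k \<Longrightarrow> c r = 0"
  shows "distinct (rows A)"
proof (rule ccontr)
  assume "\<not> distinct (rows A)"
  then obtain i j where ij: "i < k" "j < k" "i \<noteq> j" "row A i = row A j"
    using A by (auto simp: distinct_conv_nth)
  let ?c = "\<lambda>r. (if r = i then 1 else 0) - (if r = j then 1 else 0 :: complex)"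
  have "(\<Sum>r<k. ?c r * A $$ (r, l)) = 0" if "l < n" for l
  proof -
    have "(\<Sum>r<k. ?c r * A $$ (r, l))
      = (\<Sum>r<k. if r = i then A $$ (r,l) else 0) - (\<Sum>r<k. if r = j then A $$ (r,l) else 0)"
      unfolding sum_subtractf[symmetric] by (intro sum.cong) auto
    also have "\<dots> = A $$ (i,l) - A $$ (j,l)" using ij by simp
    also have "A $$ (i,l) = row A i $ l" using A ij(1) that by simp
    also have "A $$ (j,l) = row A j $ l" using A ij(2) that by simp
    finally show ?thesis using ij(4) by simp
  qed
  with ind[of ?c i] ij show False by auto
qed

lemma transpose_mult_vec_eq_0_iff:
  fixes A :: "complex mat"
  assumes A: "A \<in> carrier_mat k n" and v: "v \<in> carrier_vec k"
  shows "A\<^sup>T *\<^sub>v v = 0\<^sub>v n \<longleftrightarrow> (\<forall>j<n. (\<Sum>r<k. v $ r * A $$ (r, j)) = 0)"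
proof -
  have "(A\<^sup>T *\<^sub>v v) $ j = (\<Sum>r<k. v $ r * A $$ (r, j))" if "j < n" for j
    using that v A by (auto simp: scalar_prod_def atLeast0LessThan mult.commute intro!: sum.cong)
  then show ?thesis using A by (auto simp: vec_eq_iff)
qed

text \<open>Full rank as independence of the rows, expressed by sums of entries: the form in which rank
  conditions on explicit matrices are verified, free of dimensions.\<close>

lemma full_rank_mats_iff:
  "A \<in> full_rank_mats k n \<longleftrightarrow> A \<in> carrier_mat k n \<and>
    (\<forall>c. (\<forall>j<n. (\<Sum>r<k. c r * A $$ (r, j)) = 0) \<longrightarrow> (\<forall>r<k. c r = 0))"
proof (cases "A \<in> carrier_mat k n")
  case A: True
  interpret vec_space "TYPE(complex)" n .
  have At: "A\<^sup>T \<in> carrier_mat n k" using A by simp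
  have rows: "set (rows A) \<subseteq> carrier_vec n" using A by (auto simp: rows_def)
  have "subspace class_ring (span (set (rows A))) V"
    using rows span_is_subspace by auto
  then have fr: "A \<in> full_rank_mats k n \<longleftrightarrow> rank A\<^sup>T = k"
    using A by (simp add: full_rank_mats_def row_span_def Gr_def rank_def)
  note mulv = transpose_mult_vec_eq_0_iff[OF A]
  have rank_le: "rank A\<^sup>T \<le> card (set (cols A\<^sup>T))"
  proof -
    obtain S where S: "maximal S (\<lambda>T. T \<subseteq> set (cols A\<^sup>T) \<and> lin_indpt T)"
      using maximal_exists[of "(\<lambda>T. T \<subseteq> set (cols A\<^sup>T) \<and> lin_indpt T)" "card (set (cols A\<^sup>T))" "{}"]
      by (meson List.finite_set card_mono empty_iff empty_subsetI finite_lin_indpt2 rev_finite_subset)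
    then have "card S \<le> card (set (cols A\<^sup>T))" by (simp add: card_mono maximal_def)
    then show ?thesis using rank_card_indpt[OF At S] by simp
  qed
  show ?thesis
  proof (intro iffI conjI A allI impI)
    fix c r assume fA: "A \<in> full_rank_mats k n" and r: "r < k"
      and c: "\<forall>j<n. (\<Sum>r<k. c r * A $$ (r, j)) = 0"
    have rk: "rank A\<^sup>T = k" using fA fr by simp
    have dist: "distinct (cols A\<^sup>T)"
      using rank_le rk A card_length[of "cols A\<^sup>T"] by (intro card_distinct) auto
    have li: "lin_indpt (set (cols A\<^sup>T))" by (rule full_rank_lin_indpt[OF At rk dist])
    have "A\<^sup>T *\<^sub>v vec k c = 0\<^sub>v n"
      by (subst mulv) (use c in auto)
    with li have "vec k c = 0\<^sub>v k"
      using lin_depI[OF At, of "vec k c"] dist by auto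
    then have "vec k c $ r = 0\<^sub>v k $ r" by simp
    then show "c r = 0" using r by simp
  next
    assume "A \<in> carrier_mat k n \<and>
      (\<forall>c. (\<forall>j<n. (\<Sum>r<k. c r * A $$ (r, j)) = 0) \<longrightarrow> (\<forall>r<k. c r = 0))"
    then have ind: "\<And>c r. (\<forall>j<n. (\<Sum>r<k. c r * A $$ (r, j)) = 0) \<Longrightarrow> r < k \<Longrightarrow> c r = 0" by blast
    have dist: "distinct (cols A\<^sup>T)" 
    proof -
      have "distinct (rows A)" by (rule distinct_rows[OF A]) (rule ind)
      then show ?thesis using A by simp
    qed
    have "lin_indpt (set (cols A\<^sup>T))"
    proof (rule notI, rule lin_depE[OF At])
      fix v assume v: "v \<in> carrier_vec k" "v \<noteq> 0\<^sub>v k" "A\<^sup>T *\<^sub>v v = 0\<^sub>v n"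
      have "v $ r = 0" if "r < k" for r
        using v(3) that unfolding mulv[OF v(1)] by (rule ind)
      with v show False by (auto simp: vec_eq_iff)
    qed (use dist in auto)
    from lin_indpt_full_rank[OF At dist this] show "A \<in> full_rank_mats k n" using fr by simp
  qed
qed (auto simp: full_rank_mats_def)

lemma det_nonzero_obtain_inverse:
  fixes g :: "complex mat"
  assumes g: "g \<in> carrier_mat k k" "det g \<noteq> 0"
  obtains h where "h \<in> carrier_mat k k" "h * g = 1\<^sub>m k" "g * h = 1\<^sub>m k" "det h \<noteq> 0"
proof -
  from det_non_zero_imp_unit[OF g, of "()"] obtain h
    where h: "h \<in> carrier_mat k k" "h * g = 1\<^sub>m k" "g * h = 1\<^sub>m k"
    by (auto simp: Units_def ring_mat_def)
  from arg_cong[OF h(2), of det] have "det h \<noteq> 0" using det_mult[OF h(1) g(1)] by auto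
  with h show thesis by (rule that)
qed

lemma row_span_mult:
  assumes g: "g \<in> carrier_mat k k" "det g \<noteq> 0" and A: "A \<in> carrier_mat k n"
  shows "row_span n (g * A) = row_span n A"
proof -
  interpret vec_space "TYPE(complex)" n .
  obtain h where "h \<in> carrier_mat k k" "h * g = 1\<^sub>m k" "g * h = 1\<^sub>m k"
    using det_nonzero_obtain_inverse[OF g] .
  then have "invertible_mat g"
    using g(1) unfolding invertible_mat_def inverts_mat_def by (auto intro!: exI[of _ h])
  from row_space_is_preserved[OF this g(1) A] show ?thesis
    by (simp add: row_space_def row_span_def)
qed

lemma row_span_eq_imp_mult:
  assumes A: "A \<in> carrier_mat k n" and A': "A' \<in> carrier_mat k' n"
    and eq: "row_span n A' \<subseteq> row_span n A"
  obtains g where "g \<in> carrier_mat k' k" "A' = g * A"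
proof -
  have "\<forall>i<k'. \<exists>c. \<forall>j<n. A' $$ (i, j) = (\<Sum>r<k. c r * A $$ (r, j))"
  proof (intro allI impI)
    fix i assume i: "i < k'"
    have "row A' i \<in> row_span n A'"
      unfolding row_span_def using i A' by (intro subsetD[OF vspan_superset]) (auto simp: rows_def)
    then have "row A' i \<in> vspan n (row A ` {..<k})"
      using eq set_rows[OF A] unfolding row_span_def by auto
    then obtain c where "\<forall>j<n. row A' i $ j = (\<Sum>r<k. c r * row A r $ j)"
      using A by (subst (asm) vspan_image_iff) auto
    then show "\<exists>c. \<forall>j<n. A' $$ (i, j) = (\<Sum>r<k. c r * A $$ (r, j))"
      using A A' i by (intro exI[of _ c]) auto
  qed
  then obtain c where c: "\<And>i j. i < k' \<Longrightarrow> j < n \<Longrightarrow> A' $$ (i, j) = (\<Sum>r<k. c i r * A $$ (r, j))"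
    by metis
  show thesis
  proof (rule that[of "mat k' k (\<lambda>(i, r). c i r)"])
    show "A' = mat k' k (\<lambda>(i, r). c i r) * A"
      using A A' c by (intro eq_matI) (auto simp: scalar_prod_def atLeast0LessThan)
  qed simp
qed

lemma det_nonzero_iff_full_rank:
  assumes A: "A \<in> carrier_mat k k"
  shows "det A \<noteq> 0 \<longleftrightarrow> A \<in> full_rank_mats k k"
proof -
  note mulv = transpose_mult_vec_eq_0_iff[OF A]
  have d: "det A = 0 \<longleftrightarrow> (\<exists>v. v \<in> carrier_vec k \<and> v \<noteq> 0\<^sub>v k \<and> A\<^sup>T *\<^sub>v v = 0\<^sub>v k)"
    using det_0_iff_vec_prod_zero[of "A\<^sup>T" k] A det_transpose[OF A] by simp
  show ?thesis
  proof
    assume "det A \<noteq> 0"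
    then have ker: "v = 0\<^sub>v k" if "v \<in> carrier_vec k" "A\<^sup>T *\<^sub>v v = 0\<^sub>v k" for v
      using d that by blast
    have "c r = 0" if c: "\<forall>j<k. (\<Sum>r<k. c r * A $$ (r, j)) = 0" and r: "r < k" for c r
    proof -
      have "A\<^sup>T *\<^sub>v vec k c = 0\<^sub>v k" 
        unfolding mulv[OF vec_carrier] using c by simp
      then have "vec k c = 0\<^sub>v k" by (rule ker[OF vec_carrier])
      from arg_cong[OF this, of "\<lambda>v. v $ r"] show "c r = 0" using r by simp
    qed
    then show "A \<in> full_rank_mats k k" using A unfolding full_rank_mats_iff by blast
  next
    assume "A \<in> full_rank_mats k k"
    then have ind: "c r = 0" if "\<forall>j<k. (\<Sum>r<k. c r * A $$ (r, j)) = 0" "r < k" for c r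
      using that unfolding full_rank_mats_iff by blast
    show "det A \<noteq> 0"
    proof
      assume "det A = 0"
      then obtain v where v: "v \<in> carrier_vec k" "v \<noteq> 0\<^sub>v k" "A\<^sup>T *\<^sub>v v = 0\<^sub>v k" using d by auto
      have "v $ r = 0" if "r < k" for r
        using v(3) that unfolding mulv[OF v(1)] by (rule ind)
      with v show False by (auto simp: vec_eq_iff)
    qed
  qed
qed

lemma GL_carrier: "carrier (GL n) = {g \<in> carrier_mat n n. det g \<noteq> 0}"
proof
  show "carrier (GL n) \<subseteq> {g \<in> carrier_mat n n. det g \<noteq> 0}"
    unfolding GL_def units_of_def
    using unit_imp_det_non_zero by (auto simp: Units_def ring_mat_def)
  show "{g \<in> carrier_mat n n. det g \<noteq> 0} \<subseteq> carrier (GL n)"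
    unfolding GL_def units_of_def using det_non_zero_imp_unit by auto
qed

lemma GL_mult: "x \<otimes>\<^bsub>GL n\<^esub> y = x * y"
  by (simp add: GL_def units_of_def ring_mat_def)

section \<open>The bounded affine permutation of a matrix\<close>

lemma vspan_mult_mat_vec:
  assumes g: "g \<in> carrier_mat k' k" and S: "finite J" "\<And>j. j \<in> J \<Longrightarrow> w j \<in> carrier_vec k"
    and u: "u \<in> vspan k (w ` J)"
  shows "g *\<^sub>v u \<in> vspan k' ((\<lambda>j. g *\<^sub>v w j) ` J)"
proof -
  from u have uc: "u \<in> carrier_vec k" using vspan_image_iff[where w = w, OF S] by auto
  from u obtain c where c: "\<And>r. r < k \<Longrightarrow> u $ r = (\<Sum>j\<in>J. c j * w j $ r)"
    using vspan_image_iff[where w = w, OF S] by blast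
  have "(g *\<^sub>v u) $ i = (\<Sum>j\<in>J. c j * (g *\<^sub>v w j) $ i)" if i: "i < k'" for i
  proof -
    have "(g *\<^sub>v u) $ i = (\<Sum>r<k. g $$ (i, r) * (\<Sum>j\<in>J. c j * w j $ r))"
      using g i uc c by (auto simp: scalar_prod_def atLeast0LessThan intro!: sum.cong)
    also have "\<dots> = (\<Sum>j\<in>J. \<Sum>r<k. g $$ (i, r) * (c j * w j $ r))"
      unfolding sum_distrib_left by (rule sum.swap)
    also have "\<dots> = (\<Sum>j\<in>J. c j * (g *\<^sub>v w j) $ i)"
    proof (rule sum.cong[OF refl])
      fix j assume "j \<in> J"
      then have "w j \<in> carrier_vec k" using S by auto
      then show "(\<Sum>r<k. g $$ (i, r) * (c j * w j $ r)) = c j * (g *\<^sub>v w j) $ i"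
        using g i by (auto simp: scalar_prod_def atLeast0LessThan sum_distrib_left ac_simps
            intro!: sum.cong)
    qed
    finally show ?thesis .
  qed
  moreover have "g *\<^sub>v u \<in> carrier_vec k'" using g uc by (rule mult_mat_vec_carrier)
  moreover have "g *\<^sub>v w j \<in> carrier_vec k'" if "j \<in> J" for j
    using g S(2)[OF that] by (rule mult_mat_vec_carrier)
  ultimately show ?thesis using S(1) by (subst vspan_image_iff) (blast+)
qed

lemma per_col_carrier: "A \<in> carrier_mat k n \<Longrightarrow> per_col n A i \<in> carrier_vec k"
  by (auto simp: per_col_def)

lemma per_col_mult:
  assumes "n > 0" "g \<in> carrier_mat k' k" "A \<in> carrier_mat k n"
  shows "per_col n (g * A) i = g *\<^sub>v per_col n A i"
proof -
  have "nat ((i - 1) mod int n) < n" using assms(1) by (simp add: nat_less_iff)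
  then show ?thesis using assms unfolding per_col_def by (intro eq_vecI) auto
qed

text \<open>Two matrices with the same row space are obtained from each other by left multiplication, which
  preserves linear relations among columns in both directions.\<close>

lemma f_mat_cong_row_span:
  assumes n: "n > 0" and A: "A \<in> carrier_mat k n" "A' \<in> carrier_mat k n"
    and eq: "row_span n A = row_span n A'"
  shows "f_mat k n A = f_mat k n A'"
proof -
  have rel: "per_col n B i \<in> vspan k (per_col n B ` {i + 1..j})"
    if "per_col n C i \<in> vspan k (per_col n C ` {i + 1..j})"
      and B: "B \<in> carrier_mat k n" and C: "C \<in> carrier_mat k n"
      and BC: "row_span n B \<subseteq> row_span n C" for B C i j
  proof -
    obtain g where g: "g \<in> carrier_mat k k" "B = g * C"
      using row_span_eq_imp_mult[OF C B BC] .
    have "g *\<^sub>v per_col n C i \<in> vspan k ((\<lambda>j. g *\<^sub>v per_col n C j) ` {i + 1..j})"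
      by (rule vspan_mult_mat_vec[OF g(1) _ _ that(1)]) (use C per_col_carrier in auto)
    then show ?thesis unfolding g(2) per_col_mult[OF n g(1) C, abs_def] .
  qed
  have mem: "per_col n A i \<in> vspan k (per_col n A ` {i + 1..j})
      \<longleftrightarrow> per_col n A' i \<in> vspan k (per_col n A' ` {i + 1..j})" for i j
    using rel[of A i j A'] rel[of A' i j A] A eq by auto
  have zero: "per_col n A i = 0\<^sub>v k \<longleftrightarrow> per_col n A' i = 0\<^sub>v k" for i
    using mem[of i i] by (simp add: vspan_empty)
  show ?thesis unfolding f_mat_def mem zero by simp
qed

lemma per_col_periodic: "per_col n A (i + int n) = per_col n A i"
proof -
  have "i + int n - 1 = (i - 1) + int n" by simp
  then have "(i + int n - 1) mod int n = (i - 1) mod int n" by (simp only: mod_add_self2)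
  then show ?thesis unfolding per_col_def by simp
qed

lemma per_col_shift_image: "per_col n A ` {a + int n..b + int n} = per_col n A ` {a..b}"
proof -
  have "{a + int n..b + int n} = (\<lambda>x. x + int n) ` {a..b}" by simp
  then show ?thesis by (simp only: image_image per_col_periodic)
qed

text \<open>The spans of \<open>{x + 1..y}\<close> increase with \<open>y\<close>, so the minimum is detected by comparing \<open>y\<close> with
  \<open>y - 1\<close>. It is attained because column \<open>x + n\<close> equals column \<open>x\<close>. For a zero column
  the interval is empty, which explains the weak inequality.\<close>

lemma f_mat_eq_iff:
  assumes n: "n > 0" and A: "A \<in> carrier_mat k n"
  shows "f_mat k n A x = y \<longleftrightarrow> x \<le> y \<and> per_col n A x \<in> vspan k (per_col n A ` {x + 1..y}) \<and>
    (x < y \<longrightarrow> per_col n A x \<notin> vspan k (per_col n A ` {x + 1..y - 1}))"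
proof -
  define mem where "mem y \<longleftrightarrow> per_col n A x \<in> vspan k (per_col n A ` {x + 1..y})" for y
  have mono: "mem y'" if "mem y" "y \<le> y'" for y y'
  proof -
    have "per_col n A ` {x + 1..y} \<subseteq> per_col n A ` {x + 1..y'}" using that by auto
    from vspan_mono[OF this] that(1) show ?thesis unfolding mem_def by auto
  qed
  define R where "R y \<longleftrightarrow> x \<le> y \<and> mem y \<and> (x < y \<longrightarrow> \<not> mem (y - 1))" for y
  have uniq: "y = y'" if "R y" "R y'" for y y'
  proof (rule ccontr)
    assume "y \<noteq> y'"
    then consider "y < y'" | "y' < y" by linarith
    then show False using that mono[of y "y' - 1"] mono[of y' "y - 1"] unfolding R_def
      by cases auto
  qed
  have "R (f_mat k n A x)"
  proof (cases "per_col n A x = 0\<^sub>v k")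
    case True
    then show ?thesis unfolding R_def mem_def f_mat_def by (simp add: vspan_empty)
  next
    case False
    have "per_col n A x \<in> per_col n A ` {x + 1..x + int n}"
      by (rule image_eqI[of _ _ "x + int n"]) (use n per_col_periodic in auto)
    also have "\<dots> \<subseteq> vspan k (per_col n A ` {x + 1..x + int n})"
      by (rule vspan_superset) (use per_col_carrier[OF A] in auto)
    finally have "mem (x + int n)" unfolding mem_def .
    define d where "d = (LEAST d. mem (x + int d))"
    have d: "mem (x + int d)" unfolding d_def by (rule LeastI) fact
    have d0: "d \<noteq> 0" using d False by (auto simp: mem_def vspan_empty)
    have dmin: "\<not> mem (x + int d - 1)"
    proof
      assume "mem (x + int d - 1)"
      then have "mem (x + int (d - 1))" using d0 by (simp add: of_nat_diff algebra_simps)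
      then have "d \<le> d - 1" unfolding d_def by (rule Least_le)
      then show False using d0 by simp
    qed
    have "f_mat k n A x = (LEAST j. j > x \<and> mem j)"
      using False unfolding f_mat_def mem_def by simp
    also have "\<dots> = x + int d"
    proof (rule Least_equality)
      fix j assume "x < j \<and> mem j"
      then show "x + int d \<le> j" using mono[of j "x + int d - 1"] dmin by linarith
    qed (use d d0 in auto)
    finally show ?thesis using d dmin d0 unfolding R_def by simp
  qed
  then have "f_mat k n A x = y \<longleftrightarrow> R y" using uniq by blast
  then show ?thesis unfolding R_def mem_def .
qed

lemma f_mat_periodic:
  assumes n: "n > 0" and A: "A \<in> carrier_mat k n"
  shows "f_mat k n A (x + int n) = f_mat k n A x + int n"
proof -
  define y where "y = f_mat k n A x"
  have "x + int n + 1 = (x + 1) + int n" "y + int n - 1 = (y - 1) + int n" by auto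
  then have "f_mat k n A (x + int n) = y + int n \<longleftrightarrow> f_mat k n A x = y"
    unfolding f_mat_eq_iff[OF n A] by (simp only: per_col_shift_image per_col_periodic) simp
  then show ?thesis by (simp add: y_def)
qed

lemma f_mat_0: "A \<in> carrier_mat 0 n \<Longrightarrow> f_mat 0 n A = (\<lambda>x. x)"
  unfolding f_mat_def per_col_def by (auto simp: fun_eq_iff)

lemma f_subspace_row_span:
  assumes n: "n > 0 \<or> k = 0" and A: "A \<in> full_rank_mats k n"
  shows "f_subspace k n (row_span n A) = f_mat k n A"
proof -
  let ?A = "SOME B. B \<in> full_rank_mats k n \<and> row_span n B = row_span n A"
  have "?A \<in> full_rank_mats k n \<and> row_span n ?A = row_span n A"
    by (rule someI[of _ A]) (use A in auto)
  then have c: "?A \<in> carrier_mat k n" "A \<in> carrier_mat k n" "row_span n ?A = row_span n A"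
    using A by (simp_all add: full_rank_mats_def)
  show ?thesis
  proof (cases "n > 0")
    case True
    show ?thesis unfolding f_subspace_def by (rule f_mat_cong_row_span[OF True c])
  next
    case False
    then have "k = 0" using n by simp
    then show ?thesis using c(1,2) unfolding f_subspace_def by (simp add: f_mat_0)
  qed
qed

section \<open>Polynomial functions and Zariski open sets\<close>

lemma poly_funs_sum:
  "(\<And>x. x \<in> S \<Longrightarrow> f x \<in> poly_funs r c) \<Longrightarrow> (\<lambda>A. \<Sum>x\<in>S. f x A) \<in> poly_funs r c"
  by (induction S rule: infinite_finite_induct) (auto intro: poly_funs.intros)

lemma poly_funs_prod:
  "(\<And>x. x \<in> S \<Longrightarrow> f x \<in> poly_funs r c) \<Longrightarrow> (\<lambda>A. \<Prod>x\<in>S. f x A) \<in> poly_funs r c"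
  by (induction S rule: infinite_finite_induct) (auto intro: poly_funs.intros)

lemma poly_funs_compose:
  assumes "F \<in> poly_funs r c"
    and "\<And>i j. i < r \<Longrightarrow> j < c \<Longrightarrow> (\<lambda>B. L B $$ (i, j)) \<in> poly_funs r' c'"
  shows "(\<lambda>B. F (L B)) \<in> poly_funs r' c'"
  using assms by (induction F rule: poly_funs.induct) (auto intro: poly_funs.intros)

lemma poly_funs_det:
  assumes "\<And>i j. i < k \<Longrightarrow> j < k \<Longrightarrow> (\<lambda>A. l A i j) \<in> poly_funs r c"
  shows "(\<lambda>A. det (mat k k (\<lambda>(i, j). l A i j))) \<in> poly_funs r c"
proof -
  have "(\<lambda>A. \<Sum>\<pi> | \<pi> permutes {0..<k}. signof \<pi> * (\<Prod>i=0..<k. l A i (\<pi> i))) \<in> poly_funs r c"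
  proof (intro poly_funs_sum poly_funs.mult poly_funs.const poly_funs_prod assms)
    fix \<pi> :: "nat \<Rightarrow> nat" and i assume "\<pi> \<in> {\<pi>. \<pi> permutes {0..<k}}" "i \<in> {0..<k}"
    then show "i < k" "\<pi> i < k" using permutes_in_image[of \<pi> "{0..<k}" i] by auto
  qed
  also have "(\<lambda>A. \<Sum>\<pi> | \<pi> permutes {0..<k}. signof \<pi> * (\<Prod>i=0..<k. l A i (\<pi> i)))
      = (\<lambda>A. det (mat k k (\<lambda>(i, j). l A i j)))"
    unfolding det_def by (auto intro!: sum.cong prod.cong ext simp: permutes_in_image)
  finally show ?thesis .
qed

text \<open>The affine line through \<open>A\<close> and \<open>B\<close>, with \<open>A\<close> at \<open>t = 0\<close> and \<open>B\<close> at \<open>t = 1\<close>.\<close>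

definition line_mat :: "complex mat \<Rightarrow> complex mat \<Rightarrow> complex \<Rightarrow> complex mat" where
  "line_mat A B t = mat (dim_row A) (dim_col A) (\<lambda>ij. (1 - t) * A $$ ij + t * B $$ ij)"

lemma line_mat_01:
  assumes "A \<in> carrier_mat r c" "B \<in> carrier_mat r c"
  shows "line_mat A B 0 = A" "line_mat A B 1 = B"
  using assms unfolding line_mat_def by (auto intro!: eq_matI)

lemma poly_funs_line:
  assumes "h \<in> poly_funs r c" and A: "A \<in> carrier_mat r c"
  shows "\<exists>P. \<forall>t. h (line_mat A B t) = poly P t"
  using assms(1)
proof induction
  case (const a)
  show ?case by (rule exI[of _ "[:a:]"]) simp
next
  case (entry i j)
  show ?case
    by (rule exI[of _ "[:A $$ (i,j), B $$ (i,j) - A $$ (i,j):]"])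
      (use entry A in \<open>auto simp: line_mat_def algebra_simps\<close>)
next
  case (add f g)
  then obtain P P' where "\<forall>t. f (line_mat A B t) = poly P t" "\<forall>t. g (line_mat A B t) = poly P' t"
    by blast
  then show ?case by (intro exI[of _ "P + P'"]) simp
next
  case (mult f g)
  then obtain P P' where "\<forall>t. f (line_mat A B t) = poly P t" "\<forall>t. g (line_mat A B t) = poly P' t"
    by blast
  then show ?case by (intro exI[of _ "P * P'"]) simp
qed

text \<open>Irreducibility of an affine subspace: along the line from \<open>A\<close> to \<open>B\<close> both functions are nonzero
  polynomials in the parameter, so some point of the line is a zero of neither.\<close>

lemma poly_funs_common_nonzero:
  assumes f: "f \<in> poly_funs r c" and g: "g \<in> poly_funs r c"
    and S: "S \<subseteq> carrier_mat r c" "\<And>A B t. A \<in> S \<Longrightarrow> B \<in> S \<Longrightarrow> line_mat A B t \<in> S"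
    and A: "A \<in> S" "f A \<noteq> 0" and B: "B \<in> S" "g B \<noteq> 0"
  shows "\<exists>C\<in>S. f C * g C \<noteq> 0"
proof -
  have carr: "A \<in> carrier_mat r c" "B \<in> carrier_mat r c" using A B S by auto
  obtain P where P: "\<And>t. f (line_mat A B t) = poly P t" using poly_funs_line[OF f carr(1)] by blast
  obtain P' where P': "\<And>t. g (line_mat A B t) = poly P' t" using poly_funs_line[OF g carr(1)] by blast
  have "poly P 0 \<noteq> 0" using P[of 0] A line_mat_01[OF carr] by simp
  moreover have "poly P' 1 \<noteq> 0" using P'[of 1] B line_mat_01[OF carr] by simp
  ultimately have "P * P' \<noteq> 0" by auto
  then have "finite {t. poly (P * P') t = 0}" by (rule poly_roots_finite)
  then obtain t where "poly (P * P') t \<noteq> 0"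
    using infinite_UNIV_char_0 ex_new_if_finite[of "{t. poly (P * P') t = 0}"] by auto
  then show ?thesis using P P' S(2)[OF A(1) B(1)] by (intro bexI[of _ "line_mat A B t"]) auto
qed

lemma topspace_zariski_mat: "topspace (zariski_mat r c) = carrier_mat r c"
proof
  show "topspace (zariski_mat r c) \<subseteq> carrier_mat r c"
    unfolding topspace_def openin_zariski_mat by auto
  have "openin (zariski_mat r c) (carrier_mat r c)"
    unfolding openin_zariski_mat by (rule exI[of _ "{\<lambda>A. 1}"]) (auto intro: poly_funs.const)
  then show "carrier_mat r c \<subseteq> topspace (zariski_mat r c)" by (rule openin_subset)
qed

lemma openin_zariski_sub:
  assumes "S \<subseteq> carrier_mat r c"
  shows "openin (subtopology (zariski_mat r c) S) U \<longleftrightarrow>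
    (\<exists>F \<subseteq> poly_funs r c. U = {A \<in> S. \<exists>f \<in> F. f A \<noteq> 0})"
proof
  assume "openin (subtopology (zariski_mat r c) S) U"
  then obtain F where F: "F \<subseteq> poly_funs r c" "U = {A \<in> carrier_mat r c. \<exists>f \<in> F. f A \<noteq> 0} \<inter> S"
    unfolding openin_subtopology openin_zariski_mat by blast
  show "\<exists>F \<subseteq> poly_funs r c. U = {A \<in> S. \<exists>f \<in> F. f A \<noteq> 0}"
    by (rule exI[of _ F]) (use F assms in auto)
next
  assume "\<exists>F \<subseteq> poly_funs r c. U = {A \<in> S. \<exists>f \<in> F. f A \<noteq> 0}"
  then obtain F where F: "F \<subseteq> poly_funs r c" "U = {A \<in> S. \<exists>f \<in> F. f A \<noteq> 0}" by blast
  show "openin (subtopology (zariski_mat r c) S) U"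
    unfolding openin_subtopology openin_zariski_mat
    by (intro exI[of _ "{A \<in> carrier_mat r c. \<exists>f \<in> F. f A \<noteq> 0}"] conjI exI[of _ F])
      (use F assms in auto)
qed

lemma quotient_map_quotient_topology: "quotient_map T (quotient_topology T h) h"
proof -
  have "openin (quotient_topology T h) (h ` topspace T)"
    unfolding openin_quotient_topology
    by (auto intro: back_subst[of "openin T", OF openin_topspace])
  then have "topspace (quotient_topology T h) = h ` topspace T"
    by (intro antisym openin_subset) (auto simp: topspace_def openin_quotient_topology)
  then show ?thesis unfolding quotient_map_def by (auto simp: openin_quotient_topology)
qed

section \<open>Cosets of $Q$ and the Grassmannian\<close>

text \<open>Right multiplication by \<open>u0\<close> moves the column with index \<open>flip p c\<close> to index \<open>c\<close>.\<close>

definition flip :: "nat \<Rightarrow> nat \<Rightarrow> nat" where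
  "flip p c = (if c < p then p - 1 - c else c)"

lemma flip_flip [simp]: "flip p (flip p c) = c"
  by (auto simp: flip_def)

lemma flip_less [simp]: "p \<le> n \<Longrightarrow> flip p c < n \<longleftrightarrow> c < n"
  by (auto simp: flip_def)

text \<open>The last \<open>q\<close> rows of \<open>g * u0 p m q\<close>.\<close>

definition bottom_mat :: "nat \<Rightarrow> nat \<Rightarrow> nat \<Rightarrow> complex mat \<Rightarrow> complex mat" where
  "bottom_mat p m q g = mat q (p + m + q) (\<lambda>(r, c). g $$ (p + m + r, flip p c))"

lemma bottom_mat_carrier [simp]: "bottom_mat p m q g \<in> carrier_mat q (p + m + q)"
  by (simp add: bottom_mat_def)

lemma u0_carrier: "u0 p m q \<in> carrier_mat (p + m + q) (p + m + q)"
  by (auto simp: u0_def Let_def)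

lemma u0_index:
  "k < p + m + q \<Longrightarrow> c < p + m + q \<Longrightarrow> u0 p m q $$ (k, c) = (if k = flip p c then 1 else 0)"
  by (auto simp: u0_def Let_def flip_def)

lemma mult_u0_index:
  assumes g: "g \<in> carrier_mat k (p + m + q)" and "i < k" "c < p + m + q"
  shows "(g * u0 p m q) $$ (i, c) = g $$ (i, flip p c)"
proof -
  have "(g * u0 p m q) $$ (i, c) = (\<Sum>l<p+m+q. g $$ (i, l) * u0 p m q $$ (l, c))"
    using assms u0_carrier[of p m q] by (auto simp: scalar_prod_def atLeast0LessThan)
  also have "\<dots> = (\<Sum>l<p+m+q. if l = flip p c then g $$ (i, l) else 0)"
    using assms by (intro sum.cong) (auto simp: u0_index)
  also have "\<dots> = g $$ (i, flip p c)" using assms by simp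
  finally show ?thesis .
qed

lemma last_rows_span_mult_u0:
  assumes n: "n = p + m + q" and g: "g \<in> carrier_mat n n"
  shows "last_rows_span n q (g * u0 p m q) = row_span n (bottom_mat p m q g)"
proof -
  have gu: "g * u0 p m q \<in> carrier_mat n n" using g u0_carrier n by auto
  have "drop (n - q) (rows (g * u0 p m q)) = rows (bottom_mat p m q g)"
  proof (rule nth_equalityI)
    show "length (drop (n - q) (rows (g * u0 p m q))) = length (rows (bottom_mat p m q g))"
      using gu g n by (simp add: bottom_mat_def)
    fix r assume "r < length (drop (n - q) (rows (g * u0 p m q)))"
    then have r: "r < q" using gu g n by simp
    have "row (g * u0 p m q) (p + m + r) = row (bottom_mat p m q g) r"
      using r gu n mult_u0_index[of g n p m q] g
      by (intro eq_vecI) (auto simp: bottom_mat_def)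
    then show "drop (n - q) (rows (g * u0 p m q)) ! r = rows (bottom_mat p m q g) ! r"
      using r gu g n by (simp add: bottom_mat_def)
  qed
  then show ?thesis by (simp add: last_rows_span_def row_span_def)
qed

text \<open>The determinant of a block triangular matrix is the product of those of its diagonal blocks, so
  the blocks of an invertible matrix of this shape are invertible.\<close>

lemma Q_grp_iff:
  "x \<in> Q_grp p m q \<longleftrightarrow> x \<in> carrier (GL (p + m + q)) \<and>
    (\<forall>i<p + m + q. \<forall>j<p + m. p + m \<le> i \<longrightarrow> x $$ (i, j) = 0)"
proof
  assume "x \<in> Q_grp p m q"
  then obtain A X D where x: "x = four_block_mat A X (0\<^sub>m q (p + m)) D"
    and A: "A \<in> carrier (GL (p + m))" and X: "X \<in> carrier_mat (p + m) q" and D: "D \<in> carrier (GL q)"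
    unfolding Q_grp_def by blast
  have "det x = det A * det D" unfolding x
    using A X D by (intro det_four_block_mat_lower_left_zero) (auto simp: GL_carrier)
  then show "x \<in> carrier (GL (p + m + q)) \<and>
      (\<forall>i<p + m + q. \<forall>j<p + m. p + m \<le> i \<longrightarrow> x $$ (i, j) = 0)"
    using A X D by (auto simp: GL_carrier x)
next
  assume x: "x \<in> carrier (GL (p + m + q)) \<and>
    (\<forall>i<p + m + q. \<forall>j<p + m. p + m \<le> i \<longrightarrow> x $$ (i, j) = 0)"
  define A where "A = mat (p + m) (p + m) (\<lambda>ij. x $$ ij)"
  define X where "X = mat (p + m) q (\<lambda>(i, j). x $$ (i, p + m + j))"
  define D where "D = mat q q (\<lambda>(i, j). x $$ (p + m + i, p + m + j))"
  have xe: "x = four_block_mat A X (0\<^sub>m q (p + m)) D"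
    using x by (intro eq_matI) (auto simp: A_def X_def D_def GL_carrier)
  have "det (four_block_mat A X (0\<^sub>m q (p + m)) D) = det A * det D"
    by (intro det_four_block_mat_lower_left_zero) (auto simp: A_def X_def D_def)
  then have "det x = det A * det D" using xe by simp
  then have "det A \<noteq> 0" "det D \<noteq> 0" using x by (auto simp: GL_carrier)
  then have "A \<in> carrier (GL (p + m))" "D \<in> carrier (GL q)" by (auto simp: GL_carrier A_def D_def)
  moreover have "X \<in> carrier_mat (p + m) q" by (simp add: X_def)
  ultimately show "x \<in> Q_grp p m q" unfolding Q_grp_def using xe by blast
qed

text \<open>Left multiplication by an element of \<open>Q\<close> recombines the last \<open>q\<close> rows among themselves. Conversely,
  if \<open>g'\<close> and \<open>g\<close> have the same span of last rows, then the last rows of \<open>g' * g\<inverse>\<close> vanish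
  in the first \<open>p + m\<close> columns. A coset is thus a fibre of the row space.\<close>

lemma Q_coset_eq:
  assumes n: "n = p + m + q" and g: "g \<in> carrier (GL n)"
  shows "Q_grp p m q #>\<^bsub>GL n\<^esub> g =
    {g' \<in> carrier (GL n). row_span n (bottom_mat p m q g') = row_span n (bottom_mat p m q g)}"
    (is "_ = ?R")
proof (intro Set.set_eqI iffI)
  fix g' assume "g' \<in> Q_grp p m q #>\<^bsub>GL n\<^esub> g"
  then obtain x where x: "x \<in> Q_grp p m q" and g': "g' = x * g"
    unfolding r_coset_def GL_mult by blast
  have xc: "x \<in> carrier_mat n n" "det x \<noteq> 0"
    and x0: "\<And>i j. i < n \<Longrightarrow> j < p + m \<Longrightarrow> p + m \<le> i \<Longrightarrow> x $$ (i, j) = 0"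
    using x n unfolding Q_grp_iff GL_carrier by auto
  have gc: "g \<in> carrier_mat n n" "det g \<noteq> 0" using g by (auto simp: GL_carrier)
  have g'c: "g' \<in> carrier (GL n)" using xc gc unfolding g' GL_carrier by (auto simp: det_mult)
  define D where "D = mat q q (\<lambda>(i, j). x $$ (p + m + i, p + m + j))"
  have "bottom_mat p m q g' = D * bottom_mat p m q g"
  proof (rule eq_matI)
    fix r c assume "r < dim_row (D * bottom_mat p m q g)" "c < dim_col (D * bottom_mat p m q g)"
    then have r: "r < q" and c: "c < n" by (auto simp: D_def bottom_mat_def n)
    have "bottom_mat p m q g' $$ (r, c) = (x * g) $$ (p + m + r, flip p c)"
      using r c n by (simp add: bottom_mat_def g')
    also have "\<dots> = (\<Sum>k<n. x $$ (p + m + r, k) * g $$ (k, flip p c))"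
      using xc gc r c n by (auto simp: scalar_prod_def atLeast0LessThan)
    also have "\<dots> = (\<Sum>k\<in>(\<lambda>s. p + m + s) ` {..<q}. x $$ (p + m + r, k) * g $$ (k, flip p c))"
    proof (rule sum.mono_neutral_right)
      show "\<forall>k\<in>{..<n} - (\<lambda>s. p + m + s) ` {..<q}. x $$ (p + m + r, k) * g $$ (k, flip p c) = 0"
      proof
        fix k assume k: "k \<in> {..<n} - (\<lambda>s. p + m + s) ` {..<q}"
        have "k < p + m"
        proof (rule ccontr)
          assume "\<not> k < p + m"
          then have "k = p + m + (k - (p + m))" "k - (p + m) < q" using k n by auto
          then show False using k by blast
        qed
        then show "x $$ (p + m + r, k) * g $$ (k, flip p c) = 0" using x0 r n by simp
      qed
    qed (use n in auto)
    also have "\<dots> = (\<Sum>s<q. D $$ (r, s) * bottom_mat p m q g $$ (s, c))"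
      using r c n by (simp add: sum.reindex D_def bottom_mat_def)
    also have "\<dots> = (D * bottom_mat p m q g) $$ (r, c)"
      using r c n by (simp add: scalar_prod_def atLeast0LessThan D_def bottom_mat_def)
    finally show "bottom_mat p m q g' $$ (r, c) = (D * bottom_mat p m q g) $$ (r, c)" .
  qed (auto simp: D_def bottom_mat_def)
  moreover have "det D \<noteq> 0"
  proof -
    obtain A X D' where xe: "x = four_block_mat A X (0\<^sub>m q (p + m)) D'"
      and A: "A \<in> carrier (GL (p + m))" "X \<in> carrier_mat (p + m) q" and D: "D' \<in> carrier (GL q)"
      using x unfolding Q_grp_def by blast
    have "D = D'" using A D by (auto simp: D_def xe GL_carrier)
    then show ?thesis using D by (simp add: GL_carrier)
  qed
  moreover have "D \<in> carrier_mat q q" by (simp add: D_def)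
  ultimately have "row_span n (bottom_mat p m q g') = row_span n (bottom_mat p m q g)"
    using row_span_mult[of D q "bottom_mat p m q g" n] n by simp
  then show "g' \<in> ?R" using g'c by simp
next
  fix g' assume g': "g' \<in> ?R"
  have gc: "g \<in> carrier_mat n n" "det g \<noteq> 0" using g by (auto simp: GL_carrier)
  have g'c: "g' \<in> carrier_mat n n" "det g' \<noteq> 0" using g' by (auto simp: GL_carrier)
  obtain h where h: "h \<in> carrier_mat n n" "h * g = 1\<^sub>m n" "g * h = 1\<^sub>m n" "det h \<noteq> 0"
    using det_nonzero_obtain_inverse[OF gc] .
  obtain D where D: "D \<in> carrier_mat q q" "bottom_mat p m q g' = D * bottom_mat p m q g"
    using row_span_eq_imp_mult[of "bottom_mat p m q g" q n "bottom_mat p m q g'" q] g' n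
    by (auto simp del: set_rows)
  have rows: "g' $$ (p + m + r, c) = (\<Sum>s<q. D $$ (r, s) * g $$ (p + m + s, c))"
    if "r < q" "c < n" for r c
  proof -
    have "bottom_mat p m q g' $$ (r, flip p c) = (D * bottom_mat p m q g) $$ (r, flip p c)"
      using D by simp
    then show ?thesis using that n D(1)
      by (simp add: bottom_mat_def scalar_prod_def atLeast0LessThan)
  qed
  define x where "x = g' * h"
  have xg: "x * g = g'" using g'c gc h unfolding x_def by (simp add: assoc_mult_mat[of _ n n _ n _ n])
  have "x $$ (i, j) = 0" if "i < n" "j < p + m" "p + m \<le> i" for i j
  proof -
    define r where "r = i - (p + m)"
    have r: "r < q" "i = p + m + r" using that n by (auto simp: r_def)
    have jn: "j < n" using that n by simp
    have "x $$ (i, j) = (\<Sum>c<n. g' $$ (p + m + r, c) * h $$ (c, j))"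
      using g'c h that jn unfolding x_def r(2)[symmetric] by (simp add: scalar_prod_def atLeast0LessThan)
    also have "\<dots> = (\<Sum>c<n. \<Sum>s<q. D $$ (r, s) * (g $$ (p + m + s, c) * h $$ (c, j)))"
      using rows[OF r(1)] by (auto simp: sum_distrib_right mult.assoc intro!: sum.cong)
    also have "\<dots> = (\<Sum>s<q. D $$ (r, s) * (\<Sum>c<n. g $$ (p + m + s, c) * h $$ (c, j)))"
      unfolding sum_distrib_left by (rule sum.swap)
    also have "\<dots> = 0"
    proof (rule sum.neutral, rule ballI)
      fix s assume "s \<in> {..<q}"
      then have s: "p + m + s < n" using n by simp
      then have "(\<Sum>c<n. g $$ (p + m + s, c) * h $$ (c, j)) = (g * h) $$ (p + m + s, j)"
        using gc(1) h(1) jn by (simp add: scalar_prod_def atLeast0LessThan)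
      also have "\<dots> = 0" unfolding h(3) using s jn that by simp
      finally show "D $$ (r, s) * (\<Sum>c<n. g $$ (p + m + s, c) * h $$ (c, j)) = 0" by simp
    qed
    finally show ?thesis .
  qed
  moreover have "x \<in> carrier (GL n)" using g'c h by (auto simp: GL_carrier x_def det_mult)
  ultimately have "x \<in> Q_grp p m q" unfolding Q_grp_iff using n by simp
  then show "g' \<in> Q_grp p m q #>\<^bsub>GL n\<^esub> g" unfolding r_coset_def GL_mult using xg by blast
qed

lemma full_rank_mats_lin_indpt_rows:
  assumes A: "A \<in> full_rank_mats k n"
  shows "distinct (rows A)" "module.lin_indpt class_ring (module_vec TYPE(complex) n) (set (rows A))"
proof -
  interpret vec_space "TYPE(complex)" n .
  have Ac: "A \<in> carrier_mat k n" using A by (simp add: full_rank_mats_def)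
  have ind: "c r = 0" if "\<forall>j<n. (\<Sum>r<k. c r * A $$ (r, j)) = 0" "r < k" for c r
    using A that unfolding full_rank_mats_iff by blast
  show dist: "distinct (rows A)" by (rule distinct_rows[OF Ac]) (rule ind)
  have At: "A\<^sup>T \<in> carrier_mat n k" using Ac by simp
  have "rank A\<^sup>T = k"
    using A Ac by (simp add: full_rank_mats_def row_span_def Gr_def rank_def)
  from full_rank_lin_indpt[OF At this] dist Ac show "lin_indpt (set (rows A))" by simp
qed

text \<open>Steinitz exchange of the rows of \<open>A\<close> into the basis of unit vectors. The exchange lemma only
  bounds the number of added vectors from above, hence the padding with zero rows; the rows
  still span, which makes the square matrix invertible.\<close>

lemma full_rank_mats_completion:
  assumes A: "A \<in> full_rank_mats q (l + q)"
  obtains g where "g \<in> carrier_mat (l + q) (l + q)" "det g \<noteq> 0"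
    "\<And>r c. r < q \<Longrightarrow> c < l + q \<Longrightarrow> g $$ (l + r, c) = A $$ (r, c)"
proof -
  let ?n = "l + q"
  interpret vec_space "TYPE(complex)" ?n .
  have Ac: "A \<in> carrier_mat q ?n" using A by (simp add: full_rank_mats_def)
  have rA: "set (rows A) \<subseteq> carrier_vec ?n" using Ac by (auto simp: rows_def)
  have cardA: "card (set (rows A)) = q"
    using full_rank_mats_lin_indpt_rows(1)[OF A] Ac by (simp add: distinct_card)
  have cardU: "card (set (unit_vecs ?n :: complex vec list)) = ?n"
    using unit_vecs_distinct distinct_card[of "unit_vecs ?n :: complex vec list"] by simp
  obtain C where C: "finite C" "C \<subseteq> carrier_vec ?n"
      "int (card C) \<le> int (card (set (unit_vecs ?n :: complex vec list))) - int (card (set (rows A)))"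
      "span (set (rows A) \<union> C) = span (set (unit_vecs ?n))"
    using replacement[of "set (rows A)" "set (unit_vecs ?n)"]
      full_rank_mats_lin_indpt_rows(2)[OF A] rA unit_vecs_carrier[of ?n]
    by (auto simp: span_unit_vecs_is_carrier)
  have cardC: "card C \<le> l" using C(3) unfolding cardA cardU by simp
  obtain cs where cs: "set cs = C" "distinct cs" using finite_distinct_list[OF C(1)] by blast
  have len: "length cs \<le> l" using cardC cs distinct_card[of cs] by simp
  \<comment> \<open>A short list \<open>cs\<close> is padded so that the rows of \<open>A\<close> come last.\<close>
  define rs where "rs = cs @ replicate (l - length cs) (0\<^sub>v ?n) @ rows A"
  have lenrs: "length rs = ?n" using len Ac by (simp add: rs_def)
  have rsc: "set rs \<subseteq> carrier_vec ?n" using cs C rA by (auto simp: rs_def)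
  define g where "g = mat_of_rows ?n rs"
  have g: "g \<in> carrier_mat ?n ?n" using lenrs unfolding g_def by auto
  have "rows g = rs" unfolding g_def by (rule rows_mat_of_rows[OF rsc])
  have "carrier_vec ?n = span (set (rows A) \<union> C)"
    using C(4) span_unit_vecs_is_carrier by simp
  also have "\<dots> \<subseteq> span (set rs)" using cs by (intro span_is_monotone) (auto simp: rs_def)
  finally have "carrier_vec ?n \<subseteq> row_span ?n g" unfolding row_span_def \<open>rows g = rs\<close> .
  moreover have "row_span ?n (1\<^sub>m ?n) \<subseteq> carrier_vec ?n"
    unfolding row_span_def by (intro vspan_carrier) (auto simp: rows_def)
  ultimately obtain h where h: "h \<in> carrier_mat ?n ?n" "1\<^sub>m ?n = h * g"
    using row_span_eq_imp_mult[OF g one_carrier_mat order_trans] by blast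
  from arg_cong[OF h(2), of det] have "det g \<noteq> 0" using det_mult[OF h(1) g] by auto
  moreover have "g $$ (l + r, c) = A $$ (r, c)" if "r < q" "c < ?n" for r c
  proof -
    have "g $$ (l + r, c) = rs ! (l + r) $ c"
      using that lenrs unfolding g_def by (simp add: mat_of_rows_def)
    moreover have "\<not> l + r - length cs < l - length cs" "l + r - length cs - (l - length cs) = r"
      using len by simp_all
    then have "rs ! (l + r) = row A r"
      using that len Ac by (simp add: rs_def nth_append)
    ultimately show ?thesis using that Ac by simp
  qed
  ultimately show thesis using that g by blast
qed

lemma bottom_mat_full_rank:
  assumes n: "n = p + m + q" and g: "g \<in> carrier (GL n)"
  shows "bottom_mat p m q g \<in> full_rank_mats q n"
proof -
  have gf: "g \<in> full_rank_mats n n" using g det_nonzero_iff_full_rank[of g n] by (simp add: GL_carrier)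
  have "c r = 0" if c: "\<forall>j<n. (\<Sum>r<q. c r * bottom_mat p m q g $$ (r, j)) = 0" and r: "r < q" for c r
  proof -
    define d where "d i = (if i < p + m then 0 else c (i - (p + m)))" for i
    have "(\<Sum>i<n. d i * g $$ (i, j)) = 0" if j: "j < n" for j
    proof -
      have "(\<Sum>i<n. d i * g $$ (i, j)) = (\<Sum>i\<in>(\<lambda>s. p + m + s) ` {..<q}. d i * g $$ (i, j))"
      proof (rule sum.mono_neutral_right)
        show "\<forall>i\<in>{..<n} - (\<lambda>s. p + m + s) ` {..<q}. d i * g $$ (i, j) = 0"
        proof
          fix i assume i: "i \<in> {..<n} - (\<lambda>s. p + m + s) ` {..<q}"
          have "i < p + m"
          proof (rule ccontr)
            assume "\<not> i < p + m"
            then have "i = p + m + (i - (p + m))" "i - (p + m) < q" using i n by auto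
            then show False using i by blast
          qed
          then show "d i * g $$ (i, j) = 0" by (simp add: d_def)
        qed
      qed (use n in auto)
      also have "\<dots> = (\<Sum>s<q. c s * bottom_mat p m q g $$ (s, flip p j))"
        using j n by (simp add: sum.reindex d_def bottom_mat_def)
      also have "\<dots> = 0" using c[rule_format, of "flip p j"] j n by simp
      finally show ?thesis .
    qed
    then have "\<forall>i<n. d i = 0" using gf unfolding full_rank_mats_iff by blast
    then have "d (p + m + r) = 0" using r n by simp
    then show "c r = 0" by (simp add: d_def)
  qed
  then show ?thesis unfolding full_rank_mats_iff using n by simp
qed

lemma bottom_mat_surj:
  assumes n: "n = p + m + q" and A: "A \<in> full_rank_mats q n"
  obtains g where "g \<in> carrier (GL n)" "bottom_mat p m q g = A"
proof -
  have Ac: "A \<in> carrier_mat q n" using A by (simp add: full_rank_mats_def)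
  define A' where "A' = mat q n (\<lambda>(r, c). A $$ (r, flip p c))"
  have "c r = 0" if c: "\<forall>j<n. (\<Sum>r<q. c r * A' $$ (r, j)) = 0" and r: "r < q" for c r
  proof -
    have "(\<Sum>r<q. c r * A $$ (r, j)) = 0" if j: "j < n" for j
    proof -
      have "(\<Sum>r<q. c r * A $$ (r, j)) = (\<Sum>r<q. c r * A' $$ (r, flip p j))"
        using j n by (simp add: A'_def)
      then show ?thesis using c[rule_format, of "flip p j"] j n by simp
    qed
    then show ?thesis using A r unfolding full_rank_mats_iff by blast
  qed
  then have "A' \<in> full_rank_mats q (p + m + q)"
    unfolding full_rank_mats_iff n[symmetric] by (auto simp: A'_def)
  then obtain g where g: "g \<in> carrier_mat n n" "det g \<noteq> 0"
      "\<And>r c. r < q \<Longrightarrow> c < n \<Longrightarrow> g $$ (p + m + r, c) = A' $$ (r, c)"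
    using full_rank_mats_completion[of A' q "p + m"] n by metis
  have "bottom_mat p m q g = A"
    using g(3) Ac n by (intro eq_matI) (auto simp: bottom_mat_def A'_def)
  then show thesis using that g by (simp add: GL_carrier)
qed

text \<open>The map is open: keeping the upper rows of a given lift \<open>g0\<close> of \<open>A0\<close> is a polynomial section
  through \<open>g0\<close>, defined where the determinant does not vanish.\<close>

lemma quotient_map_bottom_mat:
  assumes n: "n = p + m + q"
  shows "quotient_map (subtopology (zariski_mat n n) (carrier (GL n)))
    (subtopology (zariski_mat q n) (full_rank_mats q n)) (bottom_mat p m q)" (is "quotient_map ?X ?Y _")
proof (rule continuous_open_imp_quotient_map)
  have subX: "carrier (GL n) \<subseteq> carrier_mat n n" by (auto simp: GL_carrier)
  have subY: "full_rank_mats q n \<subseteq> carrier_mat q n" by (auto simp: full_rank_mats_def)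
  have tX: "topspace ?X = carrier (GL n)" using subX by (auto simp: topspace_zariski_mat)
  have tY: "topspace ?Y = full_rank_mats q n" using subY by (auto simp: topspace_zariski_mat)
  show "continuous_map ?X ?Y (bottom_mat p m q)"
    unfolding continuous_map_def tX tY
  proof (intro conjI allI impI)
    show "bottom_mat p m q \<in> carrier (GL n) \<rightarrow> full_rank_mats q n"
      using bottom_mat_full_rank[OF n] by blast
    fix U assume "openin ?Y U"
    then obtain F where F: "F \<subseteq> poly_funs q n" "U = {A \<in> full_rank_mats q n. \<exists>f\<in>F. f A \<noteq> 0}"
      unfolding openin_zariski_sub[OF subY] by blast
    have "(\<lambda>g. f (bottom_mat p m q g)) \<in> poly_funs n n" if "f \<in> F" for f
    proof (rule poly_funs_compose)
      show "f \<in> poly_funs q n" using that F by blast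
      fix i j assume "i < q" "j < n"
      then show "(\<lambda>g. bottom_mat p m q g $$ (i, j)) \<in> poly_funs n n"
        using n by (auto simp: bottom_mat_def intro!: poly_funs.entry)
    qed
    then have "(\<lambda>f g. f (bottom_mat p m q g)) ` F \<subseteq> poly_funs n n" by blast
    moreover have "{g \<in> carrier (GL n). bottom_mat p m q g \<in> U} =
        {g \<in> carrier (GL n). \<exists>f\<in>(\<lambda>f g. f (bottom_mat p m q g)) ` F. f g \<noteq> 0}"
      using F bottom_mat_full_rank[OF n] by auto
    ultimately show "openin ?X {g \<in> carrier (GL n). bottom_mat p m q g \<in> U}"
      unfolding openin_zariski_sub[OF subX] by blast
  qed
  show "open_map ?X ?Y (bottom_mat p m q)"
    unfolding open_map_def
  proof (intro allI impI)
    fix U assume "openin ?X U"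
    then obtain F where F: "F \<subseteq> poly_funs n n" "U = {g \<in> carrier (GL n). \<exists>f\<in>F. f g \<noteq> 0}"
      unfolding openin_zariski_sub[OF subX] by blast
    show "openin ?Y (bottom_mat p m q ` U)"
    proof (subst openin_subopen, intro ballI)
      fix A0 assume "A0 \<in> bottom_mat p m q ` U"
      then obtain g0 f where g0: "g0 \<in> carrier (GL n)" "A0 = bottom_mat p m q g0"
        and f: "f \<in> F" "f g0 \<noteq> 0" unfolding F(2) by blast
      have g0c: "g0 \<in> carrier_mat n n" "det g0 \<noteq> 0" using g0 by (auto simp: GL_carrier)
      \<comment> \<open>the section through \<open>g0\<close>\<close>
      define s where "s A = mat n n (\<lambda>(i, c). if i < p + m then g0 $$ (i, c)
          else A $$ (i - (p + m), flip p c))" for A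
      have s0: "s A0 = g0"
        using g0c n by (intro eq_matI) (auto simp: s_def g0(2) bottom_mat_def)
      have ent: "(\<lambda>A. if i < p + m then g0 $$ (i, c) else A $$ (i - (p + m), flip p c))
          \<in> poly_funs q n" if "i < n" "c < n" for i c
        using that n by (cases "i < p + m") (auto intro!: poly_funs.const poly_funs.entry)
      have sd: "(\<lambda>A. det (s A)) \<in> poly_funs q n"
        unfolding s_def by (intro poly_funs_det ent)
      have sf: "(\<lambda>A. f (s A)) \<in> poly_funs q n"
        by (rule poly_funs_compose[of f n n]) (use f F ent in \<open>auto simp: s_def\<close>)
      define T where "T = {A \<in> full_rank_mats q n. f (s A) * det (s A) \<noteq> 0}"
      have "openin ?Y T" unfolding openin_zariski_sub[OF subY] T_def
        by (rule exI[of _ "{\<lambda>A. f (s A) * det (s A)}"]) (use poly_funs.mult[OF sf sd] in auto)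
      moreover have "A0 \<in> T"
        using bottom_mat_full_rank[OF n g0(1)] f g0c by (simp add: T_def s0 g0(2)[symmetric])
      moreover have "T \<subseteq> bottom_mat p m q ` U"
      proof
        fix A assume A: "A \<in> T"
        then have Ac: "A \<in> carrier_mat q n" using subY by (auto simp: T_def)
        have "bottom_mat p m q (s A) = A"
          using Ac n by (intro eq_matI) (auto simp: bottom_mat_def s_def)
        moreover have "s A \<in> U"
          using A f(1) unfolding T_def F(2) by (auto simp: GL_carrier s_def)
        ultimately show "A \<in> bottom_mat p m q ` U" by force
      qed
      ultimately show "\<exists>T. openin ?Y T \<and> A0 \<in> T \<and> T \<subseteq> bottom_mat p m q ` U" by blast
    qed
  qed
  show "bottom_mat p m q ` topspace ?X = topspace ?Y"
    unfolding tX tY using bottom_mat_full_rank[OF n] bottom_mat_surj[OF n] by (metis (no_types, lifting) equalityI image_subset_iff image_iff subsetI)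
qed

lemma coset_to_Gr_coset:
  assumes n: "n = p + m + q" and g: "g \<in> carrier (GL n)"
  shows "coset_to_Gr n q ((Q_grp p m q #>\<^bsub>GL n\<^esub> g) #>\<^bsub>GL n\<^esub> u0 p m q) =
    row_span n (bottom_mat p m q g)"
proof -
  let ?C = "Q_grp p m q #>\<^bsub>GL n\<^esub> g"
  have "last_rows_span n q ` (?C #>\<^bsub>GL n\<^esub> u0 p m q) = (\<lambda>g'. row_span n (bottom_mat p m q g')) ` ?C"
  proof -
    have "?C #>\<^bsub>GL n\<^esub> u0 p m q = (\<lambda>g'. g' * u0 p m q) ` ?C" by (auto simp: r_coset_def GL_mult)
    moreover have "last_rows_span n q (g' * u0 p m q) = row_span n (bottom_mat p m q g')"
      if "g' \<in> ?C" for g'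
      using that last_rows_span_mult_u0[OF n, of g'] unfolding Q_coset_eq[OF n g]
      by (auto simp: GL_carrier)
    ultimately show ?thesis by (simp add: image_image)
  qed
  also have "\<dots> = {row_span n (bottom_mat p m q g)}" unfolding Q_coset_eq[OF n g] using g by auto
  finally show ?thesis by (simp add: coset_to_Gr_def)
qed

text \<open>Source and target are quotients of $GL_n$, the target through the full rank matrices, and by
  \<open>Q_coset_eq\<close> the two quotient maps have the same fibres.\<close>

lemma homeomorphic_map_coset_Gr:
  assumes n: "n = p + m + q"
  shows "homeomorphic_map (coset_topology p m q) (Gr_topology q n)
    (\<lambda>C. coset_to_Gr n q (C #>\<^bsub>GL n\<^esub> u0 p m q))" (is "homeomorphic_map ?S ?T ?h")
  unfolding homeomorphic_map_def
proof
  let ?X = "subtopology (zariski_mat n n) (carrier (GL n))"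
  let ?\<pi> = "\<lambda>g. Q_grp p m q #>\<^bsub>GL n\<^esub> g"
  have tX: "topspace ?X = carrier (GL n)" by (auto simp: topspace_zariski_mat GL_carrier)
  have \<pi>: "quotient_map ?X ?S ?\<pi>"
    unfolding coset_topology_def Let_def n[symmetric] by (rule quotient_map_quotient_topology)
  have "quotient_map ?X ?T (row_span n \<circ> bottom_mat p m q)"
    unfolding Gr_topology_def
    by (rule quotient_map_compose[OF quotient_map_bottom_mat[OF n] quotient_map_quotient_topology])
  then have comp: "quotient_map ?X ?T (?h \<circ> ?\<pi>)"
    by (rule quotient_map_eq) (simp add: tX coset_to_Gr_coset[OF n])
  have "continuous_map ?S ?T ?h"
    by (rule continuous_compose_quotient_map[OF \<pi> quotient_imp_continuous_map[OF comp]])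
  then show "quotient_map ?S ?T ?h"
    by (rule quotient_map_from_composition[OF quotient_imp_continuous_map[OF \<pi>] _ comp])
  have "topspace ?S = ?\<pi> ` carrier (GL n)" using \<pi> tX by (simp add: quotient_map_def)
  moreover have "?\<pi> g = ?\<pi> g'" if "g \<in> carrier (GL n)" "g' \<in> carrier (GL n)" "?h (?\<pi> g) = ?h (?\<pi> g')"
    for g g'
  proof -
    have "row_span n (bottom_mat p m q g) = row_span n (bottom_mat p m q g')"
      using that(3) unfolding coset_to_Gr_coset[OF n that(1)] coset_to_Gr_coset[OF n that(2)] .
    then show ?thesis unfolding Q_coset_eq[OF n that(1)] Q_coset_eq[OF n that(2)] by simp
  qed
  ultimately show "inj_on ?h (topspace ?S)" by (auto simp: inj_on_def)
qed

section \<open>Bases consisting of columns and unit vectors\<close>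

text \<open>The vector \<open>u\<close> is a linear combination of the columns \<open>w k\<close> with \<open>k \<in> J\<close>; only the first \<open>q\<close>
  coordinates count.\<close>

definition col_comb :: "nat \<Rightarrow> (nat \<Rightarrow> nat \<Rightarrow> complex) \<Rightarrow> nat set \<Rightarrow> (nat \<Rightarrow> complex) \<Rightarrow> bool" where
  "col_comb q w J u \<longleftrightarrow> (\<exists>a. \<forall>r<q. u r = (\<Sum>k\<in>J. a k * w k r))"

definition unit_fun :: "nat \<Rightarrow> nat \<Rightarrow> complex" where
  "unit_fun c r = (if r = c then 1 else 0)"

lemma sum_delta_mult:
  fixes f :: "nat \<Rightarrow> complex"
  assumes "finite J"
  shows "(\<Sum>l\<in>J. (if l = k then 1 else 0) * f l) = (if k \<in> J then f k else 0)"
proof -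
  have "(\<Sum>l\<in>J. (if l = k then 1 else 0) * f l) = (\<Sum>l\<in>J. if l = k then f l else 0)"
    by (rule sum.cong) auto
  then show ?thesis using assms by simp
qed

lemma col_comb_generator: "finite J \<Longrightarrow> k \<in> J \<Longrightarrow> col_comb q w J (w k)"
  unfolding col_comb_def by (rule exI[of _ "\<lambda>l. if l = k then 1 else 0"]) (simp add: sum_delta_mult)

lemma col_comb_mono:
  assumes "col_comb q w J u" "J \<subseteq> J'" "finite J'"
  shows "col_comb q w J' u"
proof -
  obtain a where a: "\<And>r. r < q \<Longrightarrow> u r = (\<Sum>k\<in>J. a k * w k r)" using assms(1) unfolding col_comb_def by blast
  have "(\<Sum>k\<in>J. a k * w k r) = (\<Sum>k\<in>J'. (if k \<in> J then a k else 0) * w k r)" for r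
    by (rule sum.mono_neutral_cong_left[OF assms(3,2)]) auto
  then show ?thesis using a unfolding col_comb_def by (intro exI[of _ "\<lambda>k. if k \<in> J then a k else 0"]) simp
qed

lemma col_comb_sum:
  assumes "\<And>i. i \<in> I \<Longrightarrow> \<beta> i \<noteq> 0 \<Longrightarrow> col_comb q w J (v i)" and u: "\<And>r. r < q \<Longrightarrow> u r = (\<Sum>i\<in>I. \<beta> i * v i r)"
  shows "col_comb q w J u"
proof -
  have "\<forall>i. \<exists>a. i \<in> I \<and> \<beta> i \<noteq> 0 \<longrightarrow> (\<forall>r<q. v i r = (\<Sum>k\<in>J. a k * w k r))"
    using assms(1) unfolding col_comb_def by blast
  from choice[OF this] obtain a
    where a: "\<And>i r. i \<in> I \<Longrightarrow> \<beta> i \<noteq> 0 \<Longrightarrow> r < q \<Longrightarrow> v i r = (\<Sum>k\<in>J. a i k * w k r)"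
    by blast
  have "u r = (\<Sum>k\<in>J. (\<Sum>i\<in>I. \<beta> i * a i k) * w k r)" if "r < q" for r
  proof -
    have "u r = (\<Sum>i\<in>I. \<Sum>k\<in>J. \<beta> i * (a i k * w k r))"
      unfolding u[OF that] sum_distrib_left[symmetric] using a that by (intro sum.cong) auto
    also have "\<dots> = (\<Sum>k\<in>J. \<Sum>i\<in>I. \<beta> i * (a i k * w k r))" by (rule sum.swap)
    finally show ?thesis by (simp add: sum_distrib_right mult.assoc)
  qed
  then show ?thesis unfolding col_comb_def by (intro exI[of _ "\<lambda>k. \<Sum>i\<in>I. \<beta> i * a i k"]) simp
qed

lemma col_comb_units:
  assumes "\<And>c. c < q \<Longrightarrow> u c \<noteq> 0 \<Longrightarrow> col_comb q w J (unit_fun c)"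
  shows "col_comb q w J u"
proof (rule col_comb_sum[of "{..<q}" u _ _ _ unit_fun])
  fix r assume "r < q"
  then show "u r = (\<Sum>i<q. u i * unit_fun i r)"
    using sum_delta_mult[of "{..<q}" r u] by (simp add: unit_fun_def mult.commute eq_commute[of r])
qed (use assms in auto)

lemma col_comb_functional:
  assumes "col_comb q w J u" "\<And>k. k \<in> J \<Longrightarrow> (\<Sum>r<q. \<phi> r * w k r) = 0"
  shows "(\<Sum>r<q. \<phi> r * u r) = 0"
proof -
  obtain a where a: "\<And>r. r < q \<Longrightarrow> u r = (\<Sum>k\<in>J. a k * w k r)" using assms(1) unfolding col_comb_def by blast
  have "(\<Sum>r<q. \<phi> r * u r) = (\<Sum>r<q. \<Sum>k\<in>J. a k * (\<phi> r * w k r))"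
    using a by (intro sum.cong) (auto simp: sum_distrib_left ac_simps)
  also have "\<dots> = (\<Sum>k\<in>J. \<Sum>r<q. a k * (\<phi> r * w k r))" by (rule sum.swap)
  also have "\<dots> = 0" using assms(2) by (simp add: sum_distrib_left[symmetric])
  finally show ?thesis .
qed

definition replace_units :: "nat \<Rightarrow> nat set \<Rightarrow> (nat \<Rightarrow> nat) \<Rightarrow> (nat \<Rightarrow> nat \<Rightarrow> complex) \<Rightarrow> complex mat" where
  "replace_units q C \<kappa> w = mat q q (\<lambda>(r, c). if c \<in> C then w (\<kappa> c) r else unit_fun c r)"

text \<open>The columns with index in \<open>K\<close> form a basis of $\mathbb C^q$ together with the unit vectors whose
  index lies outside \<open>C\<close>. The determinant witnessing this is a polynomial in the columns.\<close>

definition completes_units :: "nat \<Rightarrow> nat set \<Rightarrow> nat set \<Rightarrow> (nat \<Rightarrow> nat \<Rightarrow> complex) \<Rightarrow> bool" where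
  "completes_units q C K w \<longleftrightarrow> C \<subseteq> {..<q} \<and> (\<exists>\<kappa>. \<kappa> ` C = K \<and> det (replace_units q C \<kappa> w) \<noteq> 0)"

text \<open>Expand \<open>u\<close> in the basis. Neither \<open>u\<close> nor the columns in \<open>K\<close> have components outside \<open>D\<close>, hence the
  unit vectors outside \<open>D\<close> do not occur in the expansion.\<close>

lemma completes_units_comb:
  assumes G: "completes_units q C K w" and J: "K \<subseteq> J" "finite J"
    and K0: "\<And>k r. k \<in> K \<Longrightarrow> r < q \<Longrightarrow> r \<notin> D \<Longrightarrow> w k r = 0"
    and u0: "\<And>r. r < q \<Longrightarrow> r \<notin> D \<Longrightarrow> u r = 0"
    and D: "\<And>c. c < q \<Longrightarrow> c \<in> D \<Longrightarrow> c \<notin> C \<Longrightarrow> col_comb q w J (unit_fun c)" and CD: "C \<subseteq> D"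
  shows "col_comb q w J u"
proof -
  obtain \<kappa> where \<kappa>: "\<kappa> ` C = K" "det (replace_units q C \<kappa> w) \<noteq> 0" and C: "C \<subseteq> {..<q}"
    using G unfolding completes_units_def by blast
  let ?X = "replace_units q C \<kappa> w"
  have X: "?X \<in> carrier_mat q q" by (simp add: replace_units_def)
  obtain Y where Y: "Y \<in> carrier_mat q q" "?X * Y = 1\<^sub>m q"
    using det_nonzero_obtain_inverse[OF X \<kappa>(2)] by blast
  define \<alpha> where "\<alpha> = Y *\<^sub>v vec q u"
  have \<alpha>: "\<alpha> \<in> carrier_vec q" unfolding \<alpha>_def using Y by (intro mult_mat_vec_carrier) auto
  have "?X *\<^sub>v \<alpha> = vec q u"
    unfolding \<alpha>_def using X Y by (simp flip: assoc_mult_mat_vec[OF X Y(1)])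
  then have eq: "u r = (\<Sum>c<q. \<alpha> $ c * (if c \<in> C then w (\<kappa> c) r else unit_fun c r))" if "r < q" for r
  proof -
    have "u r = (?X *\<^sub>v \<alpha>) $ r" using that \<open>?X *\<^sub>v \<alpha> = vec q u\<close> by simp
    also have "\<dots> = (\<Sum>c<q. \<alpha> $ c * (if c \<in> C then w (\<kappa> c) r else unit_fun c r))"
      using that \<alpha> by (auto simp: replace_units_def scalar_prod_def atLeast0LessThan mult.commute intro!: sum.cong)
    finally show ?thesis .
  qed
  have \<alpha>0: "\<alpha> $ r = 0" if r: "r < q" "r \<notin> D" for r
  proof -
    have "(\<Sum>c<q. \<alpha> $ c * (if c \<in> C then w (\<kappa> c) r else unit_fun c r)) = (\<Sum>c<q. if c = r then \<alpha> $ c else 0)"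
      by (rule sum.cong) (use r K0 \<kappa> CD in \<open>auto simp: unit_fun_def\<close>)
    then show ?thesis using eq[OF r(1)] u0[OF r] r by simp
  qed
  show ?thesis
  proof (rule col_comb_sum[OF _ eq])
    fix c assume c: "c \<in> {..<q}" "\<alpha> $ c \<noteq> 0"
    then have "c \<in> D" using \<alpha>0 by auto
    then show "col_comb q w J (\<lambda>r. if c \<in> C then w (\<kappa> c) r else unit_fun c r)"
      using c D col_comb_generator[of J "\<kappa> c"] J \<kappa> by (cases "c \<in> C") auto
  qed
qed

text \<open>The functional dual to the basis vector \<open>w x\<close> vanishes on the other columns in \<open>K\<close> and on all
  vectors supported outside \<open>C\<close>, but not on \<open>w x\<close>.\<close>

lemma completes_units_not_comb:
  assumes G: "completes_units q C K w" and x: "x \<in> K"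
    and J: "\<And>k. k \<in> J \<Longrightarrow> (k \<in> K \<and> k \<noteq> x) \<or> (\<forall>c\<in>C. w k c = 0)"
  shows "\<not> col_comb q w J (w x)"
proof
  assume cmb: "col_comb q w J (w x)"
  obtain \<kappa> where \<kappa>: "\<kappa> ` C = K" "det (replace_units q C \<kappa> w) \<noteq> 0" and C: "C \<subseteq> {..<q}"
    using G unfolding completes_units_def by blast
  let ?X = "replace_units q C \<kappa> w"
  have X: "?X \<in> carrier_mat q q" by (simp add: replace_units_def)
  obtain Y where Y: "Y \<in> carrier_mat q q" "Y * ?X = 1\<^sub>m q"
    using det_nonzero_obtain_inverse[OF X \<kappa>(2)] by blast
  \<comment> \<open>Row \<open>c0\<close> of the inverse is the functional dual to \<open>w x\<close>.\<close>
  obtain c0 where c0: "c0 \<in> C" "\<kappa> c0 = x" using x \<kappa> by blast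
  have c0q: "c0 < q" using c0 C by auto
  define \<phi> where "\<phi> r = Y $$ (c0, r)" for r
  have \<phi>: "(\<Sum>r<q. \<phi> r * (if c \<in> C then w (\<kappa> c) r else unit_fun c r)) = (if c = c0 then 1 else 0)" if "c < q" for c
  proof -
    have "(\<Sum>r<q. \<phi> r * (if c \<in> C then w (\<kappa> c) r else unit_fun c r)) = (Y * ?X) $$ (c0, c)"
      using Y(1) c0q that by (simp add: scalar_prod_def atLeast0LessThan \<phi>_def replace_units_def)
    then show ?thesis using Y c0q that by simp
  qed
  have \<phi>C: "\<phi> c = 0" if "c < q" "c \<notin> C" for c
  proof -
    have "c \<noteq> c0" using that c0 by auto
    then show ?thesis
      using \<phi>[OF that(1)] that sum_delta_mult[of "{..<q}" c \<phi>] by (simp add: unit_fun_def mult.commute)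
  qed
  have \<phi>\<kappa>: "(\<Sum>r<q. \<phi> r * w (\<kappa> c) r) = (if c = c0 then 1 else 0)" if "c \<in> C" for c
    using \<phi>[of c] that C by auto
  have "(\<Sum>r<q. \<phi> r * w x r) = 0"
  proof (rule col_comb_functional[OF cmb])
    fix k assume "k \<in> J"
    from J[OF this] show "(\<Sum>r<q. \<phi> r * w k r) = 0"
    proof
      assume "k \<in> K \<and> k \<noteq> x"
      then obtain c where "c \<in> C" "k = \<kappa> c" "c \<noteq> c0" using \<kappa> c0 by auto
      then show ?thesis using \<phi>\<kappa>[of c] by simp
    next
      assume "\<forall>c\<in>C. w k c = 0"
      then show ?thesis using \<phi>C by (intro sum.neutral) auto
    qed
  qed
  then show False using \<phi>\<kappa>[OF c0(1)] c0 by simp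
qed

text \<open>Pack \<open>L\<close> against the right end of \<open>{..<k}\<close> in increasing order: the largest element goes to \<open>k - 1\<close>,
  and the others lie below it.\<close>

lemma obtain_right_shift:
  fixes L :: "nat set"
  assumes "finite L" "L \<subseteq> {..<k}"
  shows "\<exists>\<kappa>. bij_betw \<kappa> L {k - card L..<k} \<and> (\<forall>l\<in>L. l \<le> \<kappa> l)"
  using assms
proof (induction "card L" arbitrary: L k)
  case 0
  then show ?case by auto
next
  case (Suc d)
  define x where "x = Max L"
  have ne: "L \<noteq> {}" using Suc by auto
  have x: "x \<in> L" unfolding x_def using Suc ne by auto
  have less: "l < x" if "l \<in> L - {x}" for l
    using that Suc Max_ge[of L l] unfolding x_def by (simp add: le_neq_implies_less)
  have xk: "x < k" using x Suc by auto
  have cd: "card (L - {x}) = d" using Suc x by simp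
  have "L - {x} \<subseteq> {..<k - 1}" using less xk by force
  with Suc(1)[of "L - {x}" "k - 1"] Suc cd obtain \<kappa> where
    \<kappa>: "bij_betw \<kappa> (L - {x}) {k - 1 - d..<k - 1}" "\<forall>l\<in>L - {x}. l \<le> \<kappa> l" by auto
  have cdk: "card L \<le> k" using card_mono[OF _ Suc(4)] by simp
  have "bij_betw (\<lambda>l. if l = x then k - 1 else \<kappa> l) (insert x (L - {x})) (insert (k - 1) {k - 1 - d..<k - 1})"
  proof -
    have "bij_betw (\<lambda>l. if l = x then k - 1 else \<kappa> l) (L - {x}) {k - 1 - d..<k - 1}"
      using \<kappa>(1) by (subst bij_betw_cong[of _ _ \<kappa>]) auto
    from notIn_Un_bij_betw[OF _ _ this, of x] show ?thesis by simp
  qed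
  moreover have "insert x (L - {x}) = L" using x by auto
  moreover have "insert (k - 1) {k - 1 - d..<k - 1} = {k - card L..<k}"
    using Suc(2) cdk xk by auto
  ultimately show ?case using \<kappa>(2) xk
    by (intro exI[of _ "\<lambda>l. if l = x then k - 1 else \<kappa> l"]) auto
qed

section \<open>The orbit and its generic points\<close>

text \<open>The combinatorics of a preclan with $v_\gamma = e$, with columns numbered from \<open>0\<close>: \<open>Lf\<close> are the
  left-ends, \<open>T\<close> the right-ends and minus nodes, \<open>mu\<close> sends a left-end to its right-end, and \<open>eta\<close>
  numbers \<open>T\<close>. The remaining indices below \<open>p\<close> are the \<open>+\<close> nodes, the remaining ones from \<open>p\<close> on
  are uncolored.\<close>

locale pattern =
  fixes p n q :: nat and Lf T :: "nat set" and mu eta :: "nat \<Rightarrow> nat"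
  assumes pn: "p \<le> n" and Lf: "Lf \<subseteq> {..<p}" and T: "T \<subseteq> {p..<n}"
    and mu: "inj_on mu Lf" "mu ` Lf \<subseteq> T" and eta: "bij_betw eta T {..<q}"
begin

text \<open>The row of the entry \<open>1\<close> in a nonzero column of \<open>base_mat\<close>; a left-end shares it with its right-end.\<close>

definition piv :: "nat \<Rightarrow> nat" where
  "piv k = (if k < p then eta (mu k) else eta k)"

lemma finT: "finite T" and finLf: "finite Lf"
  using T Lf by (auto intro: finite_subset)

lemma cardT: "card T = q"
  using bij_betw_same_card[OF eta] by simp

lemma card_Lf: "card Lf \<le> q" "card Lf \<le> p"
  using card_image[OF mu(1)] card_mono[OF finT mu(2)] cardT card_mono[OF _ Lf] by auto

lemma piv_T: "t \<in> T \<Longrightarrow> piv t = eta t" using T by (auto simp: piv_def)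
lemma piv_Lf: "l \<in> Lf \<Longrightarrow> piv l = eta (mu l)" using Lf by (auto simp: piv_def)

lemma eta_less: "t \<in> T \<Longrightarrow> eta t < q" using eta by (auto simp: bij_betw_def)

lemma eta_inj: "t \<in> T \<Longrightarrow> t' \<in> T \<Longrightarrow> eta t = eta t' \<longleftrightarrow> t = t'"
  using eta by (auto simp: bij_betw_def inj_on_def)

lemma mu_T: "l \<in> Lf \<Longrightarrow> mu l \<in> T" using mu by auto

lemma piv_less: "k \<in> Lf \<union> T \<Longrightarrow> piv k < q"
  using eta_less mu_T piv_T piv_Lf by auto

lemma piv_inj_Lf: "l \<in> Lf \<Longrightarrow> l' \<in> Lf \<Longrightarrow> piv l = piv l' \<longleftrightarrow> l = l'"
  using mu_T eta_inj mu(1) by (auto simp: piv_Lf inj_on_def)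

text \<open>The linear span of the group $\bar B$, whose elements are the invertible matrices of this shape.
  Linearity is what makes lines available.\<close>

definition block_tri :: "complex mat set" where
  "block_tri = {b \<in> carrier_mat n n. \<forall>i<n. \<forall>j<n. b $$ (i, j) \<noteq> 0 \<longrightarrow> i \<le> j \<and> (i < p \<longleftrightarrow> j < p)}"

text \<open>Column \<open>k\<close> of \<open>base_mat * b\<close>. It is written as a sum of entries because polynomial functions are
  defined on matrices of arbitrary size.\<close>

definition orbit_col :: "complex mat \<Rightarrow> nat \<Rightarrow> nat \<Rightarrow> complex" where
  "orbit_col b k r = (\<Sum>l | l \<in> Lf \<union> T \<and> piv l = r. b $$ (l, k))"

lemma orbit_col_support:
  assumes "b \<in> block_tri" "k < n" "orbit_col b k r \<noteq> 0"
  shows "\<exists>l\<in>Lf \<union> T. piv l = r \<and> l \<le> k \<and> (l < p \<longleftrightarrow> k < p)"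
proof -
  obtain l where l: "l \<in> Lf \<union> T" "piv l = r" "b $$ (l, k) \<noteq> 0"
    using assms(3) unfolding orbit_col_def by (metis (mono_tags, lifting) mem_Collect_eq sum.neutral)
  then have "l < n" using Lf T pn by auto
  then show ?thesis using l assms unfolding block_tri_def by blast
qed

lemma orbit_col_support_left:
  assumes "b \<in> block_tri" "k < p" "orbit_col b k r \<noteq> 0"
  obtains l where "l \<in> Lf" "piv l = r" "l \<le> k"
  using orbit_col_support[OF assms(1) _ assms(3)] assms(2) pn T by force

lemma orbit_col_support_right:
  assumes "b \<in> block_tri" "p \<le> k" "k < n" "orbit_col b k r \<noteq> 0"
  obtains t where "t \<in> T" "eta t = r" "t \<le> k"
  using orbit_col_support[OF assms(1) _ assms(4)] assms(2,3) Lf piv_T by force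

lemma orbit_col_poly: "k < n \<Longrightarrow> (\<lambda>b. orbit_col b k r) \<in> poly_funs n n"
  unfolding orbit_col_def using Lf T pn by (intro poly_funs_sum poly_funs.entry) auto

lemma block_tri_line: "A \<in> block_tri \<Longrightarrow> B \<in> block_tri \<Longrightarrow> line_mat A B t \<in> block_tri"
  unfolding block_tri_def line_mat_def by fastforce

lemma block_tri_carrier: "block_tri \<subseteq> carrier_mat n n"
  unfolding block_tri_def by auto

text \<open>The property holds on a nonempty Zariski open subset of \<open>block_tri\<close>.\<close>

definition generic :: "(complex mat \<Rightarrow> bool) \<Rightarrow> bool" where
  "generic P \<longleftrightarrow> (\<exists>h\<in>poly_funs n n. (\<exists>b\<in>block_tri. h b \<noteq> 0) \<and> (\<forall>b\<in>block_tri. h b \<noteq> 0 \<longrightarrow> P b))"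

lemma genericI: "h \<in> poly_funs n n \<Longrightarrow> b \<in> block_tri \<Longrightarrow> h b \<noteq> 0 \<Longrightarrow> (\<And>b. b \<in> block_tri \<Longrightarrow> h b \<noteq> 0 \<Longrightarrow> P b) \<Longrightarrow> generic P"
  unfolding generic_def by blast

lemma generic_conj:
  assumes "generic P" "generic P'"
  shows "generic (\<lambda>b. P b \<and> P' b)"
proof -
  obtain h b where h: "h \<in> poly_funs n n" "b \<in> block_tri" "h b \<noteq> 0" "\<And>b. b \<in> block_tri \<Longrightarrow> h b \<noteq> 0 \<Longrightarrow> P b"
    using assms(1) unfolding generic_def by blast
  obtain h' b' where h': "h' \<in> poly_funs n n" "b' \<in> block_tri" "h' b' \<noteq> 0" "\<And>b. b \<in> block_tri \<Longrightarrow> h' b \<noteq> 0 \<Longrightarrow> P' b"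
    using assms(2) unfolding generic_def by blast
  obtain c where "c \<in> block_tri" "h c * h' c \<noteq> 0"
    using poly_funs_common_nonzero[OF h(1) h'(1) block_tri_carrier block_tri_line h(2,3) h'(2,3)] by blast
  then show ?thesis
    by (intro genericI[of "\<lambda>b. h b * h' b" c]) (use h h' in \<open>auto intro: poly_funs.mult\<close>)
qed

lemma generic_ball:
  assumes "finite S" "\<And>s. s \<in> S \<Longrightarrow> generic (P s)"
  shows "generic (\<lambda>b. \<forall>s\<in>S. P s b)"
  using assms
proof (induction S)
  case empty
  have "0\<^sub>m n n \<in> block_tri" unfolding block_tri_def by auto
  then show ?case by (intro genericI[of "\<lambda>b. 1"]) (auto intro: poly_funs.const)
next
  case (insert s S)
  then have "generic (\<lambda>b. P s b \<and> (\<forall>s\<in>S. P s b))" by (intro generic_conj) auto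
  then show ?case by simp
qed

text \<open>The \<open>0/1\<close> matrix \<open>b0\<close> moves the unit vector in column \<open>l\<close> to column \<open>\<kappa> l\<close>, which is a permitted
  column operation because \<open>\<kappa>\<close> moves to the right within a block. At \<open>b0\<close> the determinant is that
  of the identity matrix.\<close>

lemma generic_completes_units:
  assumes L: "L \<subseteq> Lf \<union> T" "inj_on piv L" and \<kappa>: "bij_betw \<kappa> L K" "K \<subseteq> {..<n}"
    and le: "\<And>l. l \<in> L \<Longrightarrow> l \<le> \<kappa> l" and bl: "\<And>l. l \<in> L \<Longrightarrow> l < p \<longleftrightarrow> \<kappa> l < p"
  shows "generic (\<lambda>b. completes_units q (piv ` L) K (orbit_col b))"
proof -
  define ix where "ix = the_inv_into L piv"
  have ix: "ix (piv l) = l" if "l \<in> L" for l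
    unfolding ix_def using the_inv_into_f_f[OF L(2) that] .
  define \<kappa>' where "\<kappa>' c = \<kappa> (ix c)" for c
  have im: "\<kappa>' ` piv ` L = K"
    using \<kappa>(1) ix by (force simp: \<kappa>'_def bij_betw_def image_image)
  have C: "piv ` L \<subseteq> {..<q}" using L piv_less by blast
  define b0 where "b0 = mat n n (\<lambda>(i, j). if \<exists>l\<in>L. i = l \<and> j = \<kappa> l then 1 else 0 :: complex)"
  have b0: "b0 \<in> block_tri" using le bl by (auto simp: block_tri_def b0_def split: if_splits)
  have Wb0: "orbit_col b0 (\<kappa> l) r = unit_fun (piv l) r" if l: "l \<in> L" for l r
  proof -
    have "orbit_col b0 (\<kappa> l) r = (\<Sum>l' | l' \<in> Lf \<union> T \<and> piv l' = r. if l' = l then 1 else 0)"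
      unfolding orbit_col_def
    proof (rule sum.cong[OF refl])
      fix l' assume "l' \<in> {l'. l' \<in> Lf \<union> T \<and> piv l' = r}"
      then have "l' < n" using Lf T pn by auto
      moreover have "\<kappa> l < n" using \<kappa> l by (auto simp: bij_betw_def)
      moreover have "(\<exists>l''\<in>L. l' = l'' \<and> \<kappa> l = \<kappa> l'') \<longleftrightarrow> l' = l"
        using \<kappa>(1) l by (auto simp: bij_betw_def inj_on_def)
      ultimately show "b0 $$ (l', \<kappa> l) = (if l' = l then 1 else 0)" by (simp add: b0_def)
    qed
    also have "\<dots> = unit_fun (piv l) r"
      using finT finLf L(1) l by (auto simp: unit_fun_def)
    finally show ?thesis .
  qed
  have "replace_units q (piv ` L) \<kappa>' (orbit_col b0) = 1\<^sub>m q"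
    by (intro eq_matI) (auto simp: replace_units_def \<kappa>'_def ix Wb0 unit_fun_def)
  then have "det (replace_units q (piv ` L) \<kappa>' (orbit_col b0)) \<noteq> 0" by simp
  moreover have "(\<lambda>b. det (replace_units q (piv ` L) \<kappa>' (orbit_col b))) \<in> poly_funs n n"
    unfolding replace_units_def
  proof (rule poly_funs_det)
    fix r c assume "r < q" "c < q"
    show "(\<lambda>b. if c \<in> piv ` L then orbit_col b (\<kappa>' c) r else unit_fun c r) \<in> poly_funs n n"
    proof (cases "c \<in> piv ` L")
      case True
      then have "\<kappa>' c < n" using im \<kappa>(2) by auto
      then show ?thesis using True orbit_col_poly by simp
    qed (simp add: poly_funs.const)
  qed
  ultimately show ?thesis
    by (intro genericI[OF _ b0]) (use im C in \<open>auto simp: completes_units_def\<close>)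
qed

definition Minus_cols :: "nat set" where "Minus_cols = T - mu ` Lf"

text \<open>The conditions that determine the bounded affine permutation. The first two say that the last
  columns of an initial segment of a block span all unit vectors that the segment can reach;
  they settle the values at \<open>+\<close> nodes and uncolored nodes. The third one gives the values
  $f(p+m+i) = n+i$ with \<open>i\<close> at most the number of matchings, and the fourth one the values that
  belong to minus nodes. The last one separates a left-end from the columns before its
  right-end.\<close>

definition general_position :: "complex mat \<Rightarrow> bool" where
  "general_position b \<longleftrightarrow>
    (\<forall>i\<in>{..p}. completes_units q (piv ` {l \<in> Lf. l < i}) {i - card {l \<in> Lf. l < i}..<i} (orbit_col b)) \<and>
    (\<forall>k\<in>{p..n}. completes_units q (piv ` {t \<in> T. t < k}) {k - card {t \<in> T. t < k}..<k} (orbit_col b)) \<and>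
    (\<forall>i\<in>{..card Lf}. completes_units q {..<q} ({p - i..<p} \<union> {n - (q - i)..<n}) (orbit_col b)) \<and>
    (\<forall>k\<in>{p..n}. completes_units q (piv ` {t \<in> Minus_cols. k \<le> t}) {n - card {t \<in> Minus_cols. k \<le> t}..<n} (orbit_col b)) \<and>
    (\<forall>l\<in>Lf. completes_units q (piv ` {l}) {l} (orbit_col b))"

lemma inj_on_piv_T: "S \<subseteq> T \<Longrightarrow> inj_on piv S"
  unfolding inj_on_def using piv_T eta_inj by (metis subsetD)

lemma inj_on_piv_Lf: "S \<subseteq> Lf \<Longrightarrow> inj_on piv S"
  unfolding inj_on_def using piv_inj_Lf by blast

lemma generic_right_shift_Lf:
  assumes "L \<subseteq> Lf" "L \<subseteq> {..<i}" "i \<le> p"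
  shows "generic (\<lambda>b. completes_units q (piv ` L) {i - card L..<i} (orbit_col b))"
proof -
  have "finite L" using assms(1) finLf by (rule finite_subset)
  then obtain \<kappa> where \<kappa>: "bij_betw \<kappa> L {i - card L..<i}" "\<forall>l\<in>L. l \<le> \<kappa> l"
    using obtain_right_shift[OF _ assms(2)] by blast
  have "\<kappa> l < p" if "l \<in> L" for l
    using bij_betwE[OF \<kappa>(1)] that assms(3) by fastforce
  then show ?thesis
    using assms \<kappa> pn by (intro generic_completes_units[of L \<kappa>] inj_on_piv_Lf) auto
qed

lemma generic_right_shift_T:
  assumes "L \<subseteq> T" "L \<subseteq> {..<i}" "i \<le> n"
  shows "generic (\<lambda>b. completes_units q (piv ` L) {i - card L..<i} (orbit_col b))"
proof -
  have "finite L" using assms(1) finT by (rule finite_subset)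
  then obtain \<kappa> where \<kappa>: "bij_betw \<kappa> L {i - card L..<i}" "\<forall>l\<in>L. l \<le> \<kappa> l"
    using obtain_right_shift[OF _ assms(2)] by blast
  have "p \<le> l" "p \<le> \<kappa> l" if "l \<in> L" for l
    using T assms(1) \<kappa>(2) that by fastforce+
  then show ?thesis
    using assms \<kappa> by (intro generic_completes_units[of L \<kappa>] inj_on_piv_T) force+
qed

text \<open>Any \<open>i\<close> left-ends can be packed into the last \<open>i\<close> of the first \<open>p\<close> columns, and the \<open>q - i\<close>
  elements of \<open>T\<close> other than their right-ends into the last columns; together they provide
  every unit vector exactly once.\<close>

lemma generic_last_columns:
  assumes "i \<le> card Lf"
  shows "generic (\<lambda>b. completes_units q {..<q} ({p - i..<p} \<union> {n - (q - i)..<n}) (orbit_col b))"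
proof -
  \<comment> \<open>\<open>S\<close> supplies \<open>i\<close> unit vectors from the first block, \<open>T'\<close> the others from the second.\<close>
  obtain S where S: "S \<subseteq> Lf" "card S = i" using obtain_subset_with_card_n[OF assms] by blast
  define T' where "T' = T - mu ` S"
  have fin: "finite S" "finite T'" using S finLf finT finite_subset by (auto simp: T'_def)
  have inS: "inj_on mu S" using mu(1) S(1) by (rule inj_on_subset)
  have cT': "card T' = q - i"
    unfolding T'_def using mu S card_image[OF inS] cardT finT fin by (subst card_Diff_subset) auto
  obtain \<kappa>1 where \<kappa>1: "bij_betw \<kappa>1 S {p - i..<p}" "\<forall>l\<in>S. l \<le> \<kappa>1 l"
    using obtain_right_shift[OF fin(1), of p] S Lf by auto
  obtain \<kappa>2 where \<kappa>2: "bij_betw \<kappa>2 T' {n - (q - i)..<n}" "\<forall>l\<in>T'. l \<le> \<kappa>2 l"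
  proof -
    have "T' \<subseteq> {..<n}" using T by (auto simp: T'_def)
    then show thesis using that obtain_right_shift[OF fin(2)] unfolding cT'[symmetric] by blast
  qed
  define \<kappa> where "\<kappa> l = (if l < p then \<kappa>1 l else \<kappa>2 l)" for l
  have Sp: "l < p" if "l \<in> S" for l using that S Lf by auto
  have Tp: "p \<le> l" "l \<in> T" if "l \<in> T'" for l using that T by (auto simp: T'_def)
  have b1: "bij_betw \<kappa> S {p - i..<p}"
    using \<kappa>1 Sp by (subst bij_betw_cong[of _ _ \<kappa>1]) (auto simp: \<kappa>_def)
  have b2: "bij_betw \<kappa> T' {n - (q - i)..<n}"
    using \<kappa>2 leD[OF Tp(1)] by (subst bij_betw_cong[of _ _ \<kappa>2]) (auto simp: \<kappa>_def)
  have \<kappa>p: "\<kappa> l < p" if "l \<in> S" for l using bij_betwE[OF b1] that by auto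
  have \<kappa>T: "p \<le> \<kappa> l" if "l \<in> T'" for l
    using \<kappa>2(2) Tp[OF that] that by (force simp: \<kappa>_def)
  have "{p - i..<p} \<inter> {n - (q - i)..<n} = {}"
  proof (rule ccontr)
    assume "{p - i..<p} \<inter> {n - (q - i)..<n} \<noteq> {}"
    then obtain k where k: "k < p" "k \<in> {n - (q - i)..<n}" by auto
    then have "k \<in> \<kappa> ` T'" by (simp only: bij_betw_imp_surj_on[OF b2])
    then obtain l where "l \<in> T'" "\<kappa> l = k" by blast
    then show False using \<kappa>T k by force
  qed
  then have bij: "bij_betw \<kappa> (S \<union> T') ({p - i..<p} \<union> {n - (q - i)..<n})"
    by (rule bij_betw_combine[OF b1 b2])
  have inj: "inj_on piv (S \<union> T')"
  proof (rule inj_onI)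
    have ST: "piv l \<noteq> piv t" if "l \<in> S" "t \<in> T'" for l t
    proof -
      have "l \<in> Lf" "mu l \<noteq> t" "t \<in> T" using that S by (auto simp: T'_def)
      then show ?thesis using mu_T eta_inj by (simp add: piv_Lf piv_T)
    qed
    fix x y assume "x \<in> S \<union> T'" "y \<in> S \<union> T'" "piv x = piv y"
    then show "x = y"
      using ST[of x y] ST[of y x] inj_on_piv_Lf[OF S(1)] inj_on_piv_T[of T'] Tp
      by (auto simp: inj_on_def)
  qed
  have img: "piv ` (S \<union> T') = {..<q}"
  proof -
    have "piv ` (S \<union> T') = eta ` (mu ` S \<union> T')"
      unfolding image_Un image_image using S Tp
      by (intro arg_cong2[of _ _ _ _ "(\<union>)"] image_cong) (auto simp: piv_Lf piv_T)
    also have "mu ` S \<union> T' = T" using S mu by (auto simp: T'_def)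
    finally show ?thesis using eta by (simp add: bij_betw_def)
  qed
  have "generic (\<lambda>b. completes_units q (piv ` (S \<union> T')) ({p - i..<p} \<union> {n - (q - i)..<n}) (orbit_col b))"
  proof (rule generic_completes_units[OF _ inj bij])
    show "S \<union> T' \<subseteq> Lf \<union> T" using S Tp by auto
    show "{p - i..<p} \<union> {n - (q - i)..<n} \<subseteq> {..<n}" using pn by auto
    show "l \<le> \<kappa> l" if "l \<in> S \<union> T'" for l
      using that \<kappa>1(2) \<kappa>2(2) Sp Tp by (force simp: \<kappa>_def)
    show "l < p \<longleftrightarrow> \<kappa> l < p" if "l \<in> S \<union> T'" for l
      using that Sp Tp \<kappa>p \<kappa>T by fastforce
  qed
  then show ?thesis unfolding img .
qed

lemma generic_general_position: "generic general_position"
  unfolding general_position_def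
proof (intro generic_conj generic_ball generic_last_columns)
  show "generic (\<lambda>b. completes_units q (piv ` {l \<in> Lf. l < i}) {i - card {l \<in> Lf. l < i}..<i} (orbit_col b))"
    if "i \<in> {..p}" for i
    using that by (intro generic_right_shift_Lf) auto
  show "generic (\<lambda>b. completes_units q (piv ` {t \<in> T. t < k}) {k - card {t \<in> T. t < k}..<k} (orbit_col b))"
    if "k \<in> {p..n}" for k
    using that by (intro generic_right_shift_T) auto
  show "generic (\<lambda>b. completes_units q (piv ` {t \<in> Minus_cols. k \<le> t}) {n - card {t \<in> Minus_cols. k \<le> t}..<n} (orbit_col b))" for k
    using T by (intro generic_right_shift_T) (auto simp: Minus_cols_def)
  show "generic (\<lambda>b. completes_units q (piv ` {l}) {l} (orbit_col b))" if "l \<in> Lf" for l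
    using that Lf pn by (intro generic_completes_units[of _ "\<lambda>l. l"]) (auto simp: bij_betw_def)
qed (use finLf in auto)

end

section \<open>The bounded affine permutation at a generic point\<close>

text \<open>The \<open>0\<close>-based index, before the reversal by \<open>u0\<close>, of the column in position \<open>i\<close> of the cyclic
  sequence.\<close>

definition colix :: "nat \<Rightarrow> nat \<Rightarrow> int \<Rightarrow> nat" where
  "colix n p i = flip p (nat ((i - 1) mod int n))"

lemma colix_nat: "0 < i \<Longrightarrow> i \<le> n \<Longrightarrow> colix n p (int i) = flip p (i - 1)"
  by (simp add: colix_def nat_mod_distrib flip: of_nat_diff) (simp add: of_nat_diff nat_diff_distrib)

lemma colix_less: "n > 0 \<Longrightarrow> p \<le> n \<Longrightarrow> colix n p i < n"
  unfolding colix_def by (simp add: nat_less_iff)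

lemma colix_shift: "colix n p (i + int n) = colix n p i"
proof -
  have "i + int n - 1 = (i - 1) + int n" by simp
  then have "(i + int n - 1) mod int n = (i - 1) mod int n" by (simp only: mod_add_self2)
  then show ?thesis by (simp add: colix_def)
qed

text \<open>An interval ending below \<open>p\<close> is a segment of the first block, one starting above \<open>p\<close> a segment of the
  second block, and one across the border is a union of two initial segments. In each case
  truncated subtraction and \<open>max\<close> give the right answer.\<close>

lemma colix_interval:
  assumes "x \<le> y" "y \<le> n" "p \<le> n"
  shows "colix n p ` {int x + 1..int y} = {p - y..<p - x} \<union> {max p x..<y}" (is "?L = ?R")
proof -
  have "{int x + 1..int y} = int ` {x + 1..y}"
    by (metis image_int_atLeastAtMost of_nat_1 of_nat_add)
  then have "?L = (\<lambda>i. flip p (i - 1)) ` {x + 1..y}"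
    unfolding image_image using assms by (auto simp: image_image colix_nat intro!: image_cong)
  also have "\<dots> = ?R"
  proof (intro Set.set_eqI iffI)
    fix k assume "k \<in> (\<lambda>i. flip p (i - 1)) ` {x + 1..y}"
    then show "k \<in> ?R" by (auto simp: flip_def split: if_splits)
  next
    fix k assume "k \<in> ?R"
    then have "k = flip p ((if k < p then p - k else k + 1) - 1)" "(if k < p then p - k else k + 1) \<in> {x + 1..y}"
      by (auto simp: flip_def)
    then show "k \<in> (\<lambda>i. flip p (i - 1)) ` {x + 1..y}" by (rule image_eqI)
  qed
  finally show ?thesis .
qed

lemma colix_interval_wrap:
  assumes "x \<le> n" "y \<le> n" "p \<le> n"
  shows "colix n p ` {int x + 1..int (n + y)} = {p - n..<p - x} \<union> {max p x..<n} \<union> ({p - y..<p} \<union> {p..<y})"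
proof -
  have "{int x + 1..int (n + y)} = {int x + 1..int n} \<union> {int 0 + 1 + int n..int y + int n}"
    using assms by auto
  moreover have "{int 0 + 1 + int n..int y + int n} = (\<lambda>i. i + int n) ` {int 0 + 1..int y}"
    by (simp add: image_add_atLeastAtMost add.commute)
  ultimately have "colix n p ` {int x + 1..int (n + y)} = colix n p ` {int x + 1..int n} \<union> colix n p ` {int 0 + 1..int y}"
    by (simp only: image_Un image_image colix_shift)
  also have "\<dots> = {p - n..<p - x} \<union> {max p x..<n} \<union> ({p - y..<p - 0} \<union> {max p 0..<y})"
    using assms by (subst (1 2) colix_interval) auto
  finally show ?thesis by simp
qed

lemma per_col_mem_iff:
  assumes n: "n > 0" "p \<le> n" and A: "A \<in> carrier_mat q n"
    and w: "\<And>k r. k < n \<Longrightarrow> r < q \<Longrightarrow> w k r = A $$ (r, flip p k)" and I: "finite I"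
  shows "per_col n A x \<in> vspan q (per_col n A ` I) \<longleftrightarrow> col_comb q w (colix n p ` I) (w (colix n p x))"
proof -
  define v where "v k = vec q (w k)" for k
  have pc: "per_col n A i = v (colix n p i)" for i
  proof (rule eq_vecI)
    fix r assume "r < dim_vec (v (colix n p i))"
    then have r: "r < q" by (simp add: v_def)
    have "nat ((i - 1) mod int n) < n" using n(1) by (simp add: nat_less_iff)
    then show "per_col n A i $ r = v (colix n p i) $ r"
      using A r n w[of "colix n p i" r] colix_less[OF n] by (simp add: per_col_def v_def colix_def)
  qed (use A in \<open>simp add: per_col_def v_def\<close>)
  have "per_col n A ` I = v ` colix n p ` I" by (simp add: image_image pc)
  moreover have "v (colix n p x) \<in> vspan q (v ` colix n p ` I) \<longleftrightarrow> col_comb q w (colix n p ` I) (w (colix n p x))"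
    using I by (subst vspan_image_iff) (auto simp: v_def col_comb_def)
  ultimately show ?thesis by (simp add: pc)
qed

lemma f_mat_nat_iff:
  assumes n: "n > 0" "p \<le> n" and A: "A \<in> carrier_mat q n"
    and w: "\<And>k r. k < n \<Longrightarrow> r < q \<Longrightarrow> w k r = A $$ (r, flip p k)"
  shows "f_mat q n A (int x) = int y \<longleftrightarrow> x \<le> y \<and>
    col_comb q w (colix n p ` {int x + 1..int y}) (w (colix n p (int x))) \<and>
    (x < y \<longrightarrow> \<not> col_comb q w (colix n p ` {int x + 1..int (y - 1)}) (w (colix n p (int x))))"
proof -
  have "int y - 1 = int (y - 1)" if "x < y" using that by simp
  then show ?thesis
    unfolding f_mat_eq_iff[OF n(1) A]
    by (simp add: per_col_mem_iff[OF n A w])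
qed

context pattern
begin

definition orbit_mat :: "complex mat \<Rightarrow> complex mat" where
  "orbit_mat b = mat q n (\<lambda>(r, c). orbit_col b (flip p c) r)"

lemma orbit_mat_carrier: "orbit_mat b \<in> carrier_mat q n"
  by (simp add: orbit_mat_def)

lemma f_mat_orbit_mat_iff:
  assumes "n > 0"
  shows "f_mat q n (orbit_mat b) (int x) = int y \<longleftrightarrow> x \<le> y \<and>
    col_comb q (orbit_col b) (colix n p ` {int x + 1..int y}) (orbit_col b (colix n p (int x))) \<and>
    (x < y \<longrightarrow> \<not> col_comb q (orbit_col b) (colix n p ` {int x + 1..int (y - 1)}) (orbit_col b (colix n p (int x))))"
  using pn by (intro f_mat_nat_iff[OF assms pn orbit_mat_carrier]) (simp add: orbit_mat_def)

text \<open>The values $f_\gamma(1),\dots,f_\gamma(n)$ in terms of the pattern: at left-ends, \<open>+\<close> nodes, uncolored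
  nodes, and the last \<open>q\<close> positions, split by the number of matchings. The \<open>i\<close>-th element of a set
  is described by the number of elements up to it.\<close>

definition is_window :: "nat \<Rightarrow> (nat \<Rightarrow> nat) \<Rightarrow> bool" where
  "is_window m F \<longleftrightarrow> n = p + m + q \<and>
    (\<forall>x\<in>{1..p}. p - x \<in> Lf \<longrightarrow> F x = mu (p - x) + 1) \<and>
    (\<forall>x\<in>{1..p}. p - x \<notin> Lf \<longrightarrow> F x = x + card {l \<in> Lf. l < p - x}) \<and>
    (\<forall>x\<in>{p + 1..p + m}. \<exists>u\<in>{p..<n} - T. F x = u + 1 \<and> card {v \<in> {p..<n} - T. v \<le> u} = x - p) \<and>
    (\<forall>i\<in>{1..card Lf}. F (p + m + i) = n + i) \<and>
    (\<forall>x\<in>{p + m + card Lf + 1..n}. \<exists>t\<in>Minus_cols. F x = n + t + 1 \<and>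
      card {v \<in> Minus_cols. v \<le> t} = x - (p + m + card Lf))"

lemma general_position_left: "general_position b \<Longrightarrow> i \<le> p \<Longrightarrow>
    completes_units q (piv ` {l \<in> Lf. l < i}) {i - card {l \<in> Lf. l < i}..<i} (orbit_col b)"
  and general_position_right: "general_position b \<Longrightarrow> p \<le> k \<Longrightarrow> k \<le> n \<Longrightarrow>
    completes_units q (piv ` {t \<in> T. t < k}) {k - card {t \<in> T. t < k}..<k} (orbit_col b)"
  and general_position_middle: "general_position b \<Longrightarrow> i \<le> card Lf \<Longrightarrow>
    completes_units q {..<q} ({p - i..<p} \<union> {n - (q - i)..<n}) (orbit_col b)"
  and general_position_minus: "general_position b \<Longrightarrow> p \<le> k \<Longrightarrow> k \<le> n \<Longrightarrow>
    completes_units q (piv ` {t \<in> Minus_cols. k \<le> t}) {n - card {t \<in> Minus_cols. k \<le> t}..<n} (orbit_col b)"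
  and general_position_single: "general_position b \<Longrightarrow> l \<in> Lf \<Longrightarrow> completes_units q (piv ` {l}) {l} (orbit_col b)"
  unfolding general_position_def by auto

lemma orbit_col_left_zero:
  assumes "b \<in> block_tri" "k < p" "\<And>l. l \<in> Lf \<Longrightarrow> l \<le> k \<Longrightarrow> piv l \<noteq> r"
  shows "orbit_col b k r = 0"
  using orbit_col_support_left[OF assms(1,2), of r] assms(3) by blast

lemma orbit_col_right_zero:
  assumes "b \<in> block_tri" "p \<le> k" "k < n" "\<And>t. t \<in> T \<Longrightarrow> t \<le> k \<Longrightarrow> eta t \<noteq> r"
  shows "orbit_col b k r = 0"
  using orbit_col_support_right[OF assms(1-3), of r] assms(4) by blast

text \<open>For general \<open>b\<close>, the first \<open>i\<close> columns span the unit vectors of the left-ends among them, and as many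
  of these columns, counted from the right, suffice.\<close>

lemma col_comb_left:
  assumes G: "general_position b" "b \<in> block_tri" and i: "i \<le> p"
    and u: "\<And>r. r < q \<Longrightarrow> u r \<noteq> 0 \<Longrightarrow> r \<in> piv ` {l \<in> Lf. l < i}"
  shows "col_comb q (orbit_col b) {i - card {l \<in> Lf. l < i}..<i} u"
proof (rule completes_units_comb[OF general_position_left[OF G(1) i], where D = "piv ` {l \<in> Lf. l < i}"])
  fix k r assume "k \<in> {i - card {l \<in> Lf. l < i}..<i}" "r \<notin> piv ` {l \<in> Lf. l < i}"
  then show "orbit_col b k r = 0" using i by (intro orbit_col_left_zero G(2)) auto
qed (use u in auto)

lemma col_comb_right:
  assumes G: "general_position b" "b \<in> block_tri" and k: "p \<le> k" "k \<le> n"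
    and u: "\<And>r. r < q \<Longrightarrow> u r \<noteq> 0 \<Longrightarrow> r \<in> piv ` {t \<in> T. t < k}"
  shows "col_comb q (orbit_col b) {k - card {t \<in> T. t < k}..<k} u"
proof (rule completes_units_comb[OF general_position_right[OF G(1) k], where D = "piv ` {t \<in> T. t < k}"])
  fix j r assume j: "j \<in> {k - card {t \<in> T. t < k}..<k}" and r: "r \<notin> piv ` {t \<in> T. t < k}"
  have "card {t \<in> T. t < k} \<le> card {p..<k}" using T by (intro card_mono) auto
  then have "p \<le> j" using j k by auto
  moreover have "eta t \<noteq> r" if "t \<in> T" "t \<le> j" for t
  proof -
    have "piv t \<in> piv ` {t \<in> T. t < k}" using that j by (intro imageI) auto
    then show ?thesis using r piv_T[OF that(1)] by auto
  qed
  ultimately show "orbit_col b j r = 0" using j k by (intro orbit_col_right_zero G(2)) auto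
qed (use u in auto)

text \<open>Column \<open>k\<close> involves unit vectors of earlier left-ends, which the earlier columns of the first block
  span, and its own unit vector, which the second block provides exactly from its right-end on.\<close>

lemma f_mat_left_end:
  assumes n: "n > 0" and G: "general_position b" "b \<in> block_tri" and x: "1 \<le> x" "x \<le> p" "p - x \<in> Lf"
  shows "f_mat q n (orbit_mat b) (int x) = int (mu (p - x) + 1)"
proof -
  define k where "k = p - x"
  define y where "y = mu k + 1"
  have k: "k \<in> Lf" "k < p" using x by (auto simp: k_def)
  have muk: "mu k \<in> T" "p \<le> mu k" "mu k < n" using mu_T[OF k(1)] T by auto
  have ix: "colix n p (int x) = k" using x pn by (simp add: colix_nat flip_def k_def)
  have J: "colix n p ` {int x + 1..int y} = {0..<k} \<union> {p..<y}"
    using x muk pn by (subst colix_interval) (auto simp: y_def k_def)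
  have J': "colix n p ` {int x + 1..int (y - 1)} = {0..<k} \<union> {p..<mu k}"
    using x muk pn by (subst colix_interval) (auto simp: y_def k_def)
  have "col_comb q (orbit_col b) ({0..<k} \<union> {p..<y}) (orbit_col b k)"
  proof (rule col_comb_units)
    fix c assume "c < q" "orbit_col b k c \<noteq> 0"
    then obtain l where l: "l \<in> Lf" "piv l = c" "l \<le> k" using orbit_col_support_left G k by metis
    show "col_comb q (orbit_col b) ({0..<k} \<union> {p..<y}) (unit_fun c)"
    proof (cases "l = k")
      case True
      then have "c = piv (mu k)" using l piv_Lf piv_T muk by simp
      then have C: "col_comb q (orbit_col b) {y - card {t \<in> T. t < y}..<y} (unit_fun c)"
        using muk by (intro col_comb_right G) (auto simp: unit_fun_def y_def split: if_splits)
      have "card {t \<in> T. t < y} \<le> card {p..<y}" using T by (intro card_mono) auto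
      then have "{y - card {t \<in> T. t < y}..<y} \<subseteq> {0..<k} \<union> {p..<y}" using muk by (auto simp: y_def)
      then show ?thesis by (rule col_comb_mono[OF C]) simp
    next
      case False
      then have "col_comb q (orbit_col b) {k - card {l \<in> Lf. l < k}..<k} (unit_fun c)"
        using k l by (intro col_comb_left G) (auto simp: unit_fun_def split: if_splits)
      then show ?thesis by (rule col_comb_mono) auto
    qed
  qed
  moreover have "\<not> col_comb q (orbit_col b) ({0..<k} \<union> {p..<mu k}) (orbit_col b k)"
  proof (rule completes_units_not_comb[OF general_position_single[OF G(1) k(1)]])
    fix j assume j: "j \<in> {0..<k} \<union> {p..<mu k}"
    have "orbit_col b j (piv k) = 0"
    proof (cases "j < p")
      case True
      have "j < k" using j True by auto
      then show ?thesis using True k piv_inj_Lf by (intro orbit_col_left_zero G(2)) auto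
    next
      case False
      then have "j < mu k" using j k by auto
      then show ?thesis using False k muk piv_Lf eta_inj by (intro orbit_col_right_zero G(2)) auto
    qed
    then show "(j \<in> {k} \<and> j \<noteq> k) \<or> (\<forall>c\<in>piv ` {k}. orbit_col b j c = 0)" by simp
  qed simp
  ultimately have "f_mat q n (orbit_mat b) (int x) = int y"
    unfolding f_mat_orbit_mat_iff[OF n] J J' ix using x muk by (auto simp: y_def)
  then show ?thesis by (simp add: y_def k_def)
qed

text \<open>With \<open>\<rho>\<close> left-ends before \<open>k\<close>, the columns up to \<open>k\<close> span a space of dimension \<open>\<rho>\<close>, and both the
  \<open>\<rho>\<close> columns ending at \<open>k - 1\<close> and the \<open>\<rho>\<close> columns ending at \<open>k\<close> form a basis of it.\<close>

lemma f_mat_plus: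
  assumes n: "n > 0" and G: "general_position b" "b \<in> block_tri" and x: "1 \<le> x" "x \<le> p" "p - x \<notin> Lf"
  shows "f_mat q n (orbit_mat b) (int x) = int (x + card {l \<in> Lf. l < p - x})"
proof -
  define k where "k = p - x"
  define \<rho> where "\<rho> = card {l \<in> Lf. l < k}"
  define y where "y = x + \<rho>"
  have k: "k \<notin> Lf" "k < p" using x by (auto simp: k_def)
  have "\<rho> \<le> card {0..<k}" unfolding \<rho>_def by (intro card_mono) auto
  then have \<rho>: "\<rho> \<le> k" by simp
  have ix: "colix n p (int x) = k" using x pn by (simp add: colix_nat flip_def k_def)
  have J: "colix n p ` {int x + 1..int y} = {k - \<rho>..<k}"
    using x \<rho> pn by (subst colix_interval) (auto simp: y_def k_def)
  have J': "colix n p ` {int x + 1..int (y - 1)} = {k + 1 - \<rho>..<k}" if "x < y"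
    using x \<rho> pn that by (subst colix_interval) (auto simp: y_def k_def)
  have "col_comb q (orbit_col b) {k - \<rho>..<k} (orbit_col b k)"
    unfolding \<rho>_def
  proof (rule col_comb_left[OF G])
    fix c assume "c < q" "orbit_col b k c \<noteq> 0"
    then obtain l where l: "l \<in> Lf" "piv l = c" "l \<le> k" using orbit_col_support_left G k by metis
    then show "c \<in> piv ` {l \<in> Lf. l < k}" using k by (auto simp: le_less)
  qed (use k in auto)
  moreover have "\<not> col_comb q (orbit_col b) {k + 1 - \<rho>..<k} (orbit_col b k)" if "x < y"
  proof (rule completes_units_not_comb)
    have "{l \<in> Lf. l < k + 1} = {l \<in> Lf. l < k}" using k by (auto simp: less_Suc_eq)
    then show "completes_units q (piv ` {l \<in> Lf. l < k + 1}) {k + 1 - \<rho>..<k + 1} (orbit_col b)"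
      using general_position_left[OF G(1), of "k + 1"] k by (simp add: \<rho>_def)
  qed (use that in \<open>auto simp: y_def\<close>)
  ultimately have "f_mat q n (orbit_mat b) (int x) = int y"
    unfolding f_mat_orbit_mat_iff[OF n] ix using x J J' by (auto simp: y_def)
  then show ?thesis by (simp add: y_def k_def \<rho>_def)
qed

lemma card_T_split:
  assumes "p \<le> k" "k \<le> n"
  shows "card {t \<in> T. t < k} + card {v \<in> {p..<n} - T. v < k} = k - p"
proof -
  have "card {t \<in> T. t < k} + card {v \<in> {p..<n} - T. v < k} = card ({t \<in> T. t < k} \<union> {v \<in> {p..<n} - T. v < k})"
    using finT by (intro card_Un_disjoint[symmetric]) auto
  also have "{t \<in> T. t < k} \<union> {v \<in> {p..<n} - T. v < k} = {p..<k}" using assms T by auto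
  finally show ?thesis by simp
qed

text \<open>The columns from \<open>p\<close> to \<open>y - 1\<close> have rank \<open>y - x\<close>, where the number of uncolored nodes among them is
  \<open>x - p\<close>. Hence the \<open>y - x\<close> columns after column \<open>x - 1\<close> span all of them; one column less, and they
  are independent of column \<open>x - 1\<close>, since the rank has not changed at the uncolored node.\<close>

lemma f_mat_uncolored:
  assumes n: "n > 0" and G: "general_position b" "b \<in> block_tri" and x: "p < x" "x \<le> n"
    and u: "u \<in> {p..<n} - T" "card {v \<in> {p..<n} - T. v \<le> u} = x - p"
  shows "f_mat q n (orbit_mat b) (int x) = int (u + 1)"
proof -
  define y where "y = u + 1"
  have "{v \<in> {p..<n} - T. v < y} = {v \<in> {p..<n} - T. v \<le> u}" by (auto simp: y_def)
  then have \<rho>: "card {t \<in> T. t < y} + (x - p) = y - p"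
    using card_T_split[of y] u by (simp add: y_def)
  have \<rho>': "{t \<in> T. t < u} = {t \<in> T. t < y}" using u by (auto simp: y_def less_Suc_eq)
  have xy: "x \<le> y" using \<rho> x u by (auto simp: y_def)
  have cy: "card {t \<in> T. t < y} = y - x" using \<rho> x xy by simp
  have ix: "colix n p (int x) = x - 1" using x pn by (simp add: colix_nat flip_def)
  have J: "colix n p ` {int x + 1..int y} = {x..<y}"
    using x xy u pn by (subst colix_interval) (auto simp: y_def)
  have J': "colix n p ` {int x + 1..int (y - 1)} = {x..<u}" if "x < y"
    using x u pn that by (subst colix_interval) (auto simp: y_def)
  have "col_comb q (orbit_col b) {y - card {t \<in> T. t < y}..<y} (orbit_col b (x - 1))"
  proof (rule col_comb_right[OF G])
    fix c assume "c < q" "orbit_col b (x - 1) c \<noteq> 0"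
    then obtain t where t: "t \<in> T" "eta t = c" "t \<le> x - 1"
      using orbit_col_support_right[OF G(2), of "x - 1" c] x by force
    then show "c \<in> piv ` {t \<in> T. t < y}" using x xy piv_T by force
  qed (use u in \<open>auto simp: y_def\<close>)
  then have "col_comb q (orbit_col b) {x..<y} (orbit_col b (x - 1))" using xy by (simp add: cy)
  moreover have "\<not> col_comb q (orbit_col b) {x..<u} (orbit_col b (x - 1))" if "x < y"
  proof (rule completes_units_not_comb)
    have "u - card {t \<in> T. t < u} = x - 1" unfolding \<rho>' cy using that by (simp add: y_def)
    then show "completes_units q (piv ` {t \<in> T. t < u}) {x - 1..<u} (orbit_col b)"
      using general_position_right[OF G(1), of u] u by simp
  qed (use that x in \<open>auto simp: y_def\<close>)
  ultimately have "f_mat q n (orbit_mat b) (int x) = int y"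
    unfolding f_mat_orbit_mat_iff[OF n] ix using xy J J' by (auto simp: y_def)
  then show ?thesis by (simp add: y_def)
qed

lemma qn: "q \<le> n - p"
  using card_mono[OF _ T] cardT by simp

text \<open>The last \<open>q - i\<close> columns and the next \<open>i\<close> columns, those at the right end of the first block before
  its reversal, form a basis. So do the last \<open>q - i + 1\<close> columns and the next \<open>i - 1\<close>.\<close>

lemma f_mat_middle:
  assumes n: "n > 0" and G: "general_position b" "b \<in> block_tri" and i: "1 \<le> i" "i \<le> card Lf"
  shows "f_mat q n (orbit_mat b) (int (n - q + i)) = int (n + i)"
proof -
  define x where "x = n - q + i"
  have iq: "i \<le> q" "i \<le> p" using i card_Lf by auto
  have x: "p < x" "x \<le> n" using i iq qn pn by (auto simp: x_def)
  have ix: "colix n p (int x) = x - 1" using x pn by (simp add: colix_nat flip_def)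
  have nx: "n - (q - i) = x" "n - (q - (i - 1)) = x - 1" using i iq qn pn by (auto simp: x_def)
  have J: "colix n p ` {int x + 1..int (n + i)} = {p - i..<p} \<union> {x..<n}"
    using x iq pn by (subst colix_interval_wrap) auto
  have J': "colix n p ` {int x + 1..int (n + i - 1)} = {p - (i - 1)..<p} \<union> {x..<n}"
  proof -
    have "n + i - 1 = n + (i - 1)" using i by simp
    then show ?thesis using x iq pn by (simp only:) (subst colix_interval_wrap, auto)
  qed
  have "col_comb q (orbit_col b) ({p - i..<p} \<union> {x..<n}) (orbit_col b (x - 1))"
    using general_position_middle[OF G(1) i(2)] unfolding nx by (rule completes_units_comb[where D = "{..<q}"]) auto
  moreover have "\<not> col_comb q (orbit_col b) ({p - (i - 1)..<p} \<union> {x..<n}) (orbit_col b (x - 1))"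
  proof (rule completes_units_not_comb)
    show "completes_units q {..<q} ({p - (i - 1)..<p} \<union> {x - 1..<n}) (orbit_col b)"
      using general_position_middle[OF G(1), of "i - 1"] i unfolding nx by simp
  qed (use x in auto)
  ultimately show ?thesis
    unfolding x_def[symmetric] f_mat_orbit_mat_iff[OF n] ix J J' using x by simp
qed

text \<open>All columns of the first block span the unit vectors of the right-ends, and the columns from \<open>p\<close> to
  \<open>t\<close> add those of the minus nodes up to \<open>t\<close>. The columns after \<open>x - 1\<close> are as many
  as the minus nodes beyond \<open>t\<close> and form a basis of a complement. When \<open>t\<close> is left out, one more
  dimension is missing, and column \<open>x - 1\<close> supplies it.\<close>

lemma f_mat_minus:
  assumes n: "n > 0" and G: "general_position b" "b \<in> block_tri" and x: "p < x" "x \<le> n"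
    and t: "t \<in> Minus_cols" "card {v \<in> Minus_cols. v \<le> t} + (n - q + card Lf) = x"
  shows "f_mat q n (orbit_mat b) (int x) = int (n + t + 1)"
proof -
  have tT: "t \<in> T" "p \<le> t" "t < n" using t T by (auto simp: Minus_cols_def)
  have finM: "finite Minus_cols" using finT by (simp add: Minus_cols_def)
  have cM: "card Minus_cols = q - card Lf"
    unfolding Minus_cols_def using mu card_image[OF mu(1)] cardT finLf by (subst card_Diff_subset) auto
  have split: "card {v \<in> Minus_cols. v \<le> t} + card {v \<in> Minus_cols. t + 1 \<le> v} = q - card Lf"
  proof -
    have "card {v \<in> Minus_cols. v \<le> t} + card {v \<in> Minus_cols. t + 1 \<le> v} = card ({v \<in> Minus_cols. v \<le> t} \<union> {v \<in> Minus_cols. t + 1 \<le> v})"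
      using finM by (intro card_Un_disjoint[symmetric]) auto
    also have "{v \<in> Minus_cols. v \<le> t} \<union> {v \<in> Minus_cols. t + 1 \<le> v} = Minus_cols" by auto
    finally show ?thesis using cM by simp
  qed
  have c1: "n - card {v \<in> Minus_cols. t + 1 \<le> v} = x" using split t(2) qn pn card_Lf by linarith
  have "{v \<in> Minus_cols. t \<le> v} = insert t {v \<in> Minus_cols. t + 1 \<le> v}" using t by auto
  then have "card {v \<in> Minus_cols. t \<le> v} = Suc (card {v \<in> Minus_cols. t + 1 \<le> v})" using finM by simp
  then have c2: "n - card {v \<in> Minus_cols. t \<le> v} = x - 1" using c1 x by simp
  have ix: "colix n p (int x) = x - 1" using x pn by (simp add: colix_nat flip_def)
  have J: "colix n p ` {int x + 1..int (n + t + 1)} = {x..<n} \<union> ({0..<p} \<union> {p..<t + 1})"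
    unfolding add.assoc using x tT pn by (subst colix_interval_wrap) auto
  have J': "colix n p ` {int x + 1..int (n + t + 1 - 1)} = {x..<n} \<union> ({0..<p} \<union> {p..<t})"
    unfolding add_diff_cancel_right' using x tT pn by (subst colix_interval_wrap) auto
  have "col_comb q (orbit_col b) ({x..<n} \<union> ({0..<p} \<union> {p..<t + 1})) (orbit_col b (x - 1))"
  proof (rule completes_units_comb[where D = "{..<q}"])
    show "completes_units q (piv ` {v \<in> Minus_cols. t + 1 \<le> v}) {x..<n} (orbit_col b)"
      using general_position_minus[OF G(1), of "t + 1"] tT unfolding c1 by simp
    fix c assume c: "c < q" "c \<notin> piv ` {v \<in> Minus_cols. t + 1 \<le> v}"
    then obtain s where s: "s \<in> T" "eta s = c" using bij_betw_imp_surj_on[OF eta] by (metis imageE lessThan_iff)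
    show "col_comb q (orbit_col b) ({x..<n} \<union> ({0..<p} \<union> {p..<t + 1})) (unit_fun c)"
    proof (cases "s \<in> Minus_cols")
      case True
      then have "s < t + 1" using c(2) s piv_T by force
      then have C: "col_comb q (orbit_col b) {t + 1 - card {v \<in> T. v < t + 1}..<t + 1} (unit_fun c)"
        using s tT piv_T by (intro col_comb_right G) (auto simp: unit_fun_def split: if_splits)
      have "card {v \<in> T. v < t + 1} \<le> card {p..<t + 1}" using T by (intro card_mono) auto
      then have "{t + 1 - card {v \<in> T. v < t + 1}..<t + 1} \<subseteq> {x..<n} \<union> ({0..<p} \<union> {p..<t + 1})"
        using tT by auto
      then show ?thesis by (rule col_comb_mono[OF C]) simp
    next
      case False
      then obtain l where "l \<in> Lf" "mu l = s" using s by (auto simp: Minus_cols_def)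
      then have "col_comb q (orbit_col b) {p - card {l \<in> Lf. l < p}..<p} (unit_fun c)"
        using s piv_Lf Lf by (intro col_comb_left G) (auto simp: unit_fun_def split: if_splits)
      then show ?thesis by (rule col_comb_mono) auto
    qed
  qed (use piv_T eta_less in \<open>auto simp: Minus_cols_def\<close>)
  moreover have "\<not> col_comb q (orbit_col b) ({x..<n} \<union> ({0..<p} \<union> {p..<t})) (orbit_col b (x - 1))"
  proof (rule completes_units_not_comb)
    show "completes_units q (piv ` {v \<in> Minus_cols. t \<le> v}) {x - 1..<n} (orbit_col b)"
      using general_position_minus[OF G(1), of t] tT unfolding c2 by simp
    fix k assume k: "k \<in> {x..<n} \<union> ({0..<p} \<union> {p..<t})"
    show "(k \<in> {x - 1..<n} \<and> k \<noteq> x - 1) \<or> (\<forall>c\<in>piv ` {v \<in> Minus_cols. t \<le> v}. orbit_col b k c = 0)"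
    proof (cases "x \<le> k")
      case True
      then show ?thesis using k tT x by auto
    next
      case False
      have "orbit_col b k (piv v) = 0" if v: "v \<in> Minus_cols" "t \<le> v" for v
      proof (cases "k < p")
        case True
        show ?thesis
        proof (rule orbit_col_left_zero[OF G(2) True])
          fix l assume l: "l \<in> Lf"
          then have "mu l \<noteq> v" "v \<in> T" using v by (auto simp: Minus_cols_def)
          then show "piv l \<noteq> piv v" using l mu_T eta_inj by (simp add: piv_Lf piv_T)
        qed
      next
        case False
        then have "p \<le> k" "k < t" using k \<open>\<not> x \<le> k\<close> by auto
        moreover have "v \<in> T" using v by (auto simp: Minus_cols_def)
        ultimately show ?thesis
          using v tT eta_inj by (intro orbit_col_right_zero G(2)) (auto simp: piv_T)
      qed
      then show ?thesis by auto
    qed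
  qed (use x in auto)
  ultimately show ?thesis
    unfolding f_mat_orbit_mat_iff[OF n] ix J J' using x by simp
qed

lemma f_mat_general_position:
  assumes n: "n > 0" and G: "general_position b" "b \<in> block_tri" and F: "is_window m F" and x: "x \<in> {1..n}"
  shows "f_mat q n (orbit_mat b) (int x) = int (F x)"
proof -
  have npm: "n = p + m + q" using F by (simp add: is_window_def)
  consider "x \<le> p" "p - x \<in> Lf" | "x \<le> p" "p - x \<notin> Lf" | "p < x" "x \<le> p + m"
    | "p + m < x" "x \<le> p + m + card Lf" | "p + m + card Lf < x" by linarith
  then show ?thesis
  proof cases
    case 1
    then show ?thesis using F x f_mat_left_end[OF n G] by (auto simp: is_window_def)
  next
    case 2
    then show ?thesis using F x f_mat_plus[OF n G] by (auto simp: is_window_def)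
  next
    case 3
    then obtain u where "u \<in> {p..<n} - T" "F x = u + 1" "card {v \<in> {p..<n} - T. v \<le> u} = x - p"
      using F unfolding is_window_def by (metis Suc_eq_plus1 Suc_leI atLeastAtMost_iff)
    then show ?thesis using f_mat_uncolored[OF n G, of x u] 3 x by auto
  next
    case 4
    define i where "i = x - (p + m)"
    have "1 \<le> i" "i \<le> card Lf" "x = p + m + i" "x = n - q + i" using 4 npm by (auto simp: i_def)
    moreover have "F (p + m + i) = n + i" using F calculation by (auto simp: is_window_def)
    ultimately show ?thesis using f_mat_middle[OF n G, of i] by simp
  next
    case 5
    then have "x \<in> {p + m + card Lf + 1..n}" using x by auto
    then obtain t where "t \<in> Minus_cols" "F x = n + t + 1" "card {v \<in> Minus_cols. v \<le> t} = x - (p + m + card Lf)"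
      using F unfolding is_window_def by blast
    then show ?thesis using f_mat_minus[OF n G, of x t] 5 x npm by auto
  qed
qed

text \<open>In general position the last \<open>q\<close> columns already form a basis.\<close>

lemma orbit_mat_full_rank:
  assumes G: "general_position b"
  shows "orbit_mat b \<in> full_rank_mats q n"
proof -
  obtain \<kappa> where \<kappa>: "\<kappa> ` {..<q} = {n - q..<n}" "det (replace_units q {..<q} \<kappa> (orbit_col b)) \<noteq> 0"
    using general_position_middle[OF G, of 0] unfolding completes_units_def by auto
  have "replace_units q {..<q} \<kappa> (orbit_col b) \<in> full_rank_mats q q"
    using det_nonzero_iff_full_rank[of "replace_units q {..<q} \<kappa> (orbit_col b)" q] \<kappa>(2) by (simp add: replace_units_def)
  then have ind: "c r = 0" if "\<forall>j<q. (\<Sum>r<q. c r * orbit_col b (\<kappa> j) r) = 0" "r < q" for c r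
  proof -
    have "\<forall>j<q. (\<Sum>r<q. c r * replace_units q {..<q} \<kappa> (orbit_col b) $$ (r, j)) = 0"
      using that(1) by (simp add: replace_units_def)
    then show ?thesis
      using \<open>replace_units q {..<q} \<kappa> (orbit_col b) \<in> full_rank_mats q q\<close> that(2) unfolding full_rank_mats_iff by blast
  qed
  have "c r = 0" if c: "\<forall>j<n. (\<Sum>r<q. c r * orbit_mat b $$ (r, j)) = 0" and r: "r < q" for c r
  proof (rule ind[OF _ r], intro allI impI)
    fix j assume "j < q"
    then have "\<kappa> j \<in> {n - q..<n}" unfolding \<kappa>(1)[symmetric] by simp
    then have "\<kappa> j < n" by simp
    then have "(\<Sum>r<q. c r * orbit_mat b $$ (r, flip p (\<kappa> j))) = 0" "flip p (\<kappa> j) < n" using c pn by auto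
    then show "(\<Sum>r<q. c r * orbit_col b (\<kappa> j) r) = 0" by (simp add: orbit_mat_def)
  qed
  then show ?thesis unfolding full_rank_mats_iff using orbit_mat_carrier by blast
qed

end

section \<open>Matrices in the cell lie in the orbit\<close>

lemma sum_restrict_mult:
  fixes a f :: "nat \<Rightarrow> complex"
  assumes "finite J" "S \<subseteq> J"
  shows "(\<Sum>l\<in>J. (if l \<in> S then a l else 0) * f l) = (\<Sum>l\<in>S. a l * f l)"
  by (rule sum.mono_neutral_cong_right[OF assms]) auto

lemma sum_unit_minus:
  fixes a f :: "nat \<Rightarrow> complex"
  assumes "k < n" "S \<subseteq> {..<n}"
  shows "(\<Sum>l<n. ((if l = k then 1 else 0) - (if l \<in> S then a l else 0)) * f l) = f k - (\<Sum>l\<in>S. a l * f l)"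
  using assms sum_restrict_mult[of "{..<n}" S a f]
  by (simp add: left_diff_distrib sum_subtractf sum_delta_mult)

text \<open>If \<open>u\<close> enters the span only with the last vector, that vector has a nonzero coefficient.\<close>

lemma col_comb_insert_obtain:
  assumes "col_comb q w (insert j J) u" "\<not> col_comb q w J u" "finite J" "j \<notin> J"
  obtains a where "a j \<noteq> 0" "\<And>r. r < q \<Longrightarrow> u r = (\<Sum>k\<in>insert j J. a k * w k r)"
proof -
  obtain a where a: "\<And>r. r < q \<Longrightarrow> u r = (\<Sum>k\<in>insert j J. a k * w k r)"
    using assms(1) unfolding col_comb_def by blast
  moreover have "a j \<noteq> 0"
  proof
    assume "a j = 0"
    then have "\<forall>r<q. u r = (\<Sum>k\<in>J. a k * w k r)" using a assms(3,4) by simp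
    then show False using assms(2) unfolding col_comb_def by blast
  qed
  ultimately show thesis using that by blast
qed

lemma card_below_inj:
  fixes S :: "nat set"
  assumes "finite S" "u \<in> S" "k \<in> S" "card {v \<in> S. v \<le> u} = card {v \<in> S. v \<le> k}"
  shows "u = k"
proof -
  have less: "card {v \<in> S. v \<le> x} < card {v \<in> S. v \<le> y}" if "x < y" "y \<in> S" for x y
  proof (rule psubset_card_mono)
    have "y \<in> {v \<in> S. v \<le> y}" "y \<notin> {v \<in> S. v \<le> x}" using that by auto
    moreover have "{v \<in> S. v \<le> x} \<subseteq> {v \<in> S. v \<le> y}" using that by auto
    ultimately show "{v \<in> S. v \<le> x} \<subset> {v \<in> S. v \<le> y}" by blast
  qed (use assms(1) in auto)
  show ?thesis using less[of u k] less[of k u] assms by (cases u k rule: linorder_cases) auto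
qed

context pattern
begin

lemma block_tri_det:
  assumes b: "b \<in> block_tri"
  shows "det b \<noteq> 0 \<longleftrightarrow> (\<forall>i<n. b $$ (i, i) \<noteq> 0)"
proof -
  have bc: "b \<in> carrier_mat n n" using b block_tri_carrier by auto
  have "upper_triangular b"
  proof (rule upper_triangularI)
    fix i j assume "j < i" "i < dim_row b"
    then have "i < n" "j < n" "\<not> i \<le> j" using bc by auto
    then show "b $$ (i, j) = 0" using b unfolding block_tri_def by blast
  qed
  from det_upper_triangular[OF this bc] show ?thesis
    using bc by (auto simp: prod_list_zero_iff diag_mat_def)
qed

text \<open>Suppose column \<open>j\<close> of the inverse has entries outside the block triangular shape. In the product
  of the two matrices, the lowest of them is multiplied by a nonzero diagonal entry of \<open>b\<close> and all
  other terms vanish.\<close>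

lemma block_tri_inverse:
  assumes b: "b \<in> block_tri" "det b \<noteq> 0" and c: "c \<in> carrier_mat n n" "b * c = 1\<^sub>m n"
  shows "c \<in> block_tri"
proof -
  have bc: "b \<in> carrier_mat n n" using b block_tri_carrier by auto
  have "i \<le> j \<and> (i < p \<longleftrightarrow> j < p)" if ij: "i < n" "j < n" "c $$ (i, j) \<noteq> 0" for i j
  proof (rule ccontr)
    define S where "S = {i. i < n \<and> c $$ (i, j) \<noteq> 0 \<and> \<not> (i \<le> j \<and> (i < p \<longleftrightarrow> j < p))}"
    assume "\<not> (i \<le> j \<and> (i < p \<longleftrightarrow> j < p))"
    then have ne: "i \<in> S" "finite S" using ij by (auto simp: S_def)
    define k where "k = Max S"
    have k: "k \<in> S" unfolding k_def using ne by (intro Max_in) auto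
    have kn: "k < n" using k by (simp add: S_def)
    have "(\<Sum>l<n. b $$ (k, l) * c $$ (l, j)) = b $$ (k, k) * c $$ (k, j)"
    proof -
      have "b $$ (k, l) * c $$ (l, j) = 0" if l: "l < n" "l \<noteq> k" for l
      proof (rule ccontr)
        assume "b $$ (k, l) * c $$ (l, j) \<noteq> 0"
        then have nz: "b $$ (k, l) \<noteq> 0" "c $$ (l, j) \<noteq> 0" by auto
        then have kl: "k \<le> l" "k < p \<longleftrightarrow> l < p" using b kn l unfolding block_tri_def by auto
        then have "l \<notin> S" using Max_ge[OF ne(2), of l] l unfolding k_def by auto
        then have "l \<le> j \<and> (l < p \<longleftrightarrow> j < p)" using nz l by (auto simp: S_def)
        then show False using kl k by (auto simp: S_def)
      qed
      then have "(\<Sum>l<n. b $$ (k, l) * c $$ (l, j)) = (\<Sum>l<n. if l = k then b $$ (k, l) * c $$ (l, j) else 0)"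
        by (intro sum.cong) auto
      then show ?thesis using kn by simp
    qed
    moreover have "(\<Sum>l<n. b $$ (k, l) * c $$ (l, j)) = (b * c) $$ (k, j)"
      using bc c(1) kn ij by (simp add: scalar_prod_def atLeast0LessThan)
    moreover have "(b * c) $$ (k, j) = 0" unfolding c(2) using kn ij k by (auto simp: S_def)
    ultimately show False using block_tri_det[OF b(1)] b(2) kn k by (auto simp: S_def)
  qed
  then show ?thesis using c unfolding block_tri_def by blast
qed

definition base_mat :: "complex mat" where
  "base_mat = mat q n (\<lambda>(r, k). if k \<in> Lf \<union> T \<and> piv k = r then 1 else 0)"

lemma base_mat_mult:
  assumes "b \<in> carrier_mat n n" "r < q" "k < n"
  shows "(base_mat * b) $$ (r, k) = orbit_col b k r"
proof -
  have "(base_mat * b) $$ (r, k) = (\<Sum>l<n. (if l \<in> {l. l \<in> Lf \<union> T \<and> piv l = r} then 1 else 0) * b $$ (l, k))"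
    using assms by (auto simp: base_mat_def scalar_prod_def atLeast0LessThan intro!: sum.cong)
  also have "\<dots> = orbit_col b k r"
    unfolding orbit_col_def using Lf T pn by (subst sum_restrict_mult) auto
  finally show ?thesis .
qed

text \<open>The coefficients of a column operation that replaces column \<open>k\<close> by a nonzero multiple of it plus a
  combination of earlier columns of the same block.\<close>

definition col_op :: "nat \<Rightarrow> (nat \<Rightarrow> complex) \<Rightarrow> bool" where
  "col_op k \<alpha> \<longleftrightarrow> \<alpha> k \<noteq> 0 \<and> (\<forall>l. \<alpha> l \<noteq> 0 \<longrightarrow> l \<le> k \<and> (l < p \<longleftrightarrow> k < p))"

context
  fixes A :: "complex mat" and w :: "nat \<Rightarrow> nat \<Rightarrow> complex" and m :: nat and F :: "nat \<Rightarrow> nat"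
  assumes n0: "n > 0" and A: "A \<in> full_rank_mats q n"
    and w_def: "w = (\<lambda>k r. A $$ (r, flip p k))"
    and win: "is_window m F"
    and fA: "\<And>x. 1 \<le> x \<Longrightarrow> x \<le> p + m \<Longrightarrow> f_mat q n A (int x) = int (F x)"
begin

lemma A_carrier: "A \<in> carrier_mat q n"
  using A by (simp add: full_rank_mats_def)

lemma f_mat_A_iff:
  "f_mat q n A (int x) = int y \<longleftrightarrow> x \<le> y \<and>
    col_comb q w (colix n p ` {int x + 1..int y}) (w (colix n p (int x))) \<and>
    (x < y \<longrightarrow> \<not> col_comb q w (colix n p ` {int x + 1..int (y - 1)}) (w (colix n p (int x))))"
  by (rule f_mat_nat_iff[OF n0 pn A_carrier]) (simp add: w_def)

text \<open>The relation that expresses the value of \<open>f\<close> is split at the border of the blocks: the part in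
  the first block reduces column \<open>k\<close>, the part in the second block, whose coefficient at the
  right-end is nonzero, reduces the right-end to the same vector.\<close>

lemma left_end_col_op:
  assumes k: "k \<in> Lf"
  shows "\<exists>\<alpha> \<gamma>. col_op k \<alpha> \<and> col_op (mu k) \<gamma> \<and> (\<forall>r<q. (\<Sum>l<n. \<alpha> l * w l r) = (\<Sum>l<n. \<gamma> l * w l r))"
proof -
  define x where "x = p - k"
  have kp: "k < p" using k Lf by auto
  have x: "1 \<le> x" "x \<le> p" "p - x = k" using kp by (auto simp: x_def)
  have muk: "p \<le> mu k" "mu k < n" using mu_T[OF k] T by auto
  have "f_mat q n A (int x) = int (mu k + 1)" using fA[of x] win x k by (auto simp: is_window_def)
  moreover have "colix n p (int x) = k" using x kp pn by (simp add: colix_nat flip_def)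
  moreover have "colix n p ` {int x + 1..int (mu k + 1)} = insert (mu k) ({0..<k} \<union> {p..<mu k})"
    using x muk pn by (subst colix_interval) auto
  moreover have "colix n p ` {int x + 1..int (mu k + 1 - 1)} = {0..<k} \<union> {p..<mu k}"
    using x muk pn by (subst colix_interval) auto
  ultimately have "col_comb q w (insert (mu k) ({0..<k} \<union> {p..<mu k})) (w k)"
    "\<not> col_comb q w ({0..<k} \<union> {p..<mu k}) (w k)"
    unfolding f_mat_A_iff using x muk by auto
  then obtain a where a: "a (mu k) \<noteq> 0"
    "\<And>r. r < q \<Longrightarrow> w k r = (\<Sum>l\<in>insert (mu k) ({0..<k} \<union> {p..<mu k}). a l * w l r)"
    using kp muk by (elim col_comb_insert_obtain) auto
  define \<alpha> where "\<alpha> l = (if l = k then 1 else 0) - (if l \<in> {0..<k} then a l else 0)" for l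
  define \<gamma> where "\<gamma> l = (if l \<in> {p..<Suc (mu k)} then a l else 0)" for l
  have "col_op k \<alpha>" using kp by (auto simp: col_op_def \<alpha>_def split: if_splits)
  moreover have "col_op (mu k) \<gamma>" using muk a(1) by (auto simp: col_op_def \<gamma>_def split: if_splits)
  moreover have "(\<Sum>l<n. \<alpha> l * w l r) = (\<Sum>l<n. \<gamma> l * w l r)" if r: "r < q" for r
  proof -
    have "insert (mu k) ({0..<k} \<union> {p..<mu k}) = {0..<k} \<union> {p..<Suc (mu k)}" using muk by auto
    then have "w k r = (\<Sum>l\<in>{0..<k}. a l * w l r) + (\<Sum>l\<in>{p..<Suc (mu k)}. a l * w l r)"
      unfolding a(2)[OF r] using kp by (subst sum.union_disjoint[symmetric]) auto
    moreover have "(\<Sum>l<n. \<alpha> l * w l r) = w k r - (\<Sum>l\<in>{0..<k}. a l * w l r)"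
      unfolding \<alpha>_def using kp pn by (intro sum_unit_minus) auto
    moreover have "(\<Sum>l<n. \<gamma> l * w l r) = (\<Sum>l\<in>{p..<Suc (mu k)}. a l * w l r)"
      unfolding \<gamma>_def using muk by (intro sum_restrict_mult) auto
    ultimately show ?thesis by simp
  qed
  ultimately show ?thesis by blast
qed

lemma plus_col_op:
  assumes k: "k < p" "k \<notin> Lf"
  shows "\<exists>\<alpha>. col_op k \<alpha> \<and> (\<forall>r<q. (\<Sum>l<n. \<alpha> l * w l r) = 0)"
proof -
  define x where "x = p - k"
  define \<rho> where "\<rho> = card {l \<in> Lf. l < k}"
  have x: "1 \<le> x" "x \<le> p" "p - x = k" using k by (auto simp: x_def)
  have "\<rho> \<le> card {0..<k}" unfolding \<rho>_def by (intro card_mono) auto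
  then have \<rho>: "\<rho> \<le> k" by simp
  have "f_mat q n A (int x) = int (x + \<rho>)" using fA[of x] win x k by (auto simp: is_window_def \<rho>_def)
  moreover have "colix n p (int x) = k" using x k pn by (simp add: colix_nat flip_def)
  moreover have "colix n p ` {int x + 1..int (x + \<rho>)} = {k - \<rho>..<k}"
    using x \<rho> pn by (subst colix_interval) auto
  ultimately have "col_comb q w {k - \<rho>..<k} (w k)" unfolding f_mat_A_iff by auto
  then obtain a where a: "\<And>r. r < q \<Longrightarrow> w k r = (\<Sum>l\<in>{k - \<rho>..<k}. a l * w l r)"
    unfolding col_comb_def by blast
  define \<alpha> where "\<alpha> l = (if l = k then 1 else 0) - (if l \<in> {k - \<rho>..<k} then a l else 0)" for l
  have "col_op k \<alpha>" using k by (auto simp: col_op_def \<alpha>_def split: if_splits)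
  moreover have "(\<Sum>l<n. \<alpha> l * w l r) = 0" if r: "r < q" for r
    unfolding \<alpha>_def using k pn a[OF r] by (subst sum_unit_minus) auto
  ultimately show ?thesis by blast
qed

text \<open>The value of \<open>f\<close> expresses column \<open>x - 1\<close> through later columns up to \<open>k\<close> with a nonzero coefficient
  at \<open>k\<close>. Solving the relation for column \<open>k\<close> gives the operation that clears it. In the
  boundary case \<open>x - 1 = k\<close> the column already vanishes.\<close>

lemma uncolored_col_op:
  assumes k: "k \<in> {p..<n} - T"
  shows "\<exists>\<alpha>. col_op k \<alpha> \<and> (\<forall>r<q. (\<Sum>l<n. \<alpha> l * w l r) = 0)"
proof -
  let ?U = "{p..<n} - T"
  \<comment> \<open>\<open>k\<close> is the uncolored column number \<open>x - p\<close>, so \<open>x\<close> is the position with value \<open>k + 1\<close>.\<close>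
  define x where "x = p + card {v \<in> ?U. v \<le> k}"
  have npm: "n = p + m + q" using win by (simp add: is_window_def)
  have "card ?U = m" using T finT cardT npm by (subst card_Diff_subset) auto
  moreover have "card {v \<in> ?U. v \<le> k} \<le> card ?U" by (rule card_mono) auto
  ultimately have "card {v \<in> ?U. v \<le> k} \<le> m" by simp
  moreover have "card {v \<in> ?U. v \<le> k} > 0" using k by (auto simp: card_gt_0_iff)
  ultimately have x: "p + 1 \<le> x" "x \<le> p + m" by (auto simp: x_def)
  then obtain u where u: "u \<in> ?U" "F x = u + 1" "card {v \<in> ?U. v \<le> u} = x - p"
    using win unfolding is_window_def by (metis atLeastAtMost_iff)
  have "u = k" by (rule card_below_inj[of ?U]) (use u k in \<open>auto simp: x_def\<close>)
  then have f: "f_mat q n A (int x) = int (k + 1)" using fA[of x] u x by simp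
  have xk: "x \<le> k + 1" using f unfolding f_mat_A_iff by simp
  have ix: "colix n p (int x) = x - 1" using x pn npm by (simp add: colix_nat flip_def)
  have J: "colix n p ` {int x + 1..int (k + 1)} = {x..<k + 1}"
    using x xk k pn by (subst colix_interval) auto
  have J': "colix n p ` {int x + 1..int (k + 1 - 1)} = {x..<k}" if "x \<le> k"
    using x that k pn by (subst colix_interval) auto
  have c: "col_comb q w {x..<k + 1} (w (x - 1))" "x \<le> k \<Longrightarrow> \<not> col_comb q w {x..<k} (w (x - 1))"
    using f J' unfolding f_mat_A_iff ix J by auto
  show ?thesis
  proof (cases "x \<le> k")
    case False
    then have "x - 1 = k" using xk by simp
    then have "w k r = 0" if "r < q" for r using c(1) that False by (auto simp: col_comb_def)
    then have "(\<Sum>l<n. (if l = k then 1 else 0) * w l r) = 0" if "r < q" for r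
      using that sum_delta_mult[of "{..<n}" k "\<lambda>l. w l r"] by simp
    moreover have "col_op k (\<lambda>l. if l = k then 1 else 0)" by (auto simp: col_op_def)
    ultimately show ?thesis by blast
  next
    case True
    have ins: "{x..<k + 1} = insert k {x..<k}" using True by auto
    obtain a where a: "a k \<noteq> 0" "\<And>r. r < q \<Longrightarrow> w (x - 1) r = (\<Sum>l\<in>{x..<k + 1}. a l * w l r)"
      using c(1) c(2)[OF True] unfolding ins by (elim col_comb_insert_obtain) auto
    define \<alpha> where "\<alpha> l = (if l = x - 1 then 1 else 0) - (if l \<in> {x..<k + 1} then a l else 0)" for l
    have "col_op k \<alpha>" using x True a(1) k by (auto simp: col_op_def \<alpha>_def split: if_splits)
    moreover have "(\<Sum>l<n. \<alpha> l * w l r) = 0" if r: "r < q" for r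
      unfolding \<alpha>_def using k True a(2)[OF r] by (subst sum_unit_minus) auto
    ultimately show ?thesis by blast
  qed
qed

text \<open>The column operations \<open>\<beta>\<close> form an invertible block triangular matrix \<open>B\<close>, and the operated columns
  \<open>V\<close> satisfy the same coincidences as those of \<open>base_mat\<close>. Therefore the matrix, with its
  first \<open>p\<close> columns read backwards, is \<open>g * base_mat * B\<inverse>\<close>, where the columns of \<open>g\<close> are the vectors \<open>V t\<close> with \<open>t \<in> T\<close>. Full rank
  of the product forces \<open>g\<close> to be invertible.\<close>

lemma row_span_in_orbit:
  "\<exists>b\<in>block_tri. det b \<noteq> 0 \<and> row_span n A = row_span n (orbit_mat b)"
proof -
  let ?M = "\<lambda>\<alpha> r. \<Sum>l<n. \<alpha> l * w l r"
  have "\<forall>k\<in>Lf. \<exists>\<alpha> \<gamma>. col_op k \<alpha> \<and> col_op (mu k) \<gamma> \<and> (\<forall>r<q. ?M \<alpha> r = ?M \<gamma> r)"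
    using left_end_col_op by blast
  then obtain \<alpha> where "\<forall>k\<in>Lf. \<exists>\<gamma>. col_op k (\<alpha> k) \<and> col_op (mu k) \<gamma> \<and> (\<forall>r<q. ?M (\<alpha> k) r = ?M \<gamma> r)"
    by (rule bchoice[THEN exE])
  then obtain \<gamma> where \<alpha>\<gamma>: "\<forall>k\<in>Lf. col_op k (\<alpha> k) \<and> col_op (mu k) (\<gamma> k) \<and> (\<forall>r<q. ?M (\<alpha> k) r = ?M (\<gamma> k) r)"
    by (rule bchoice[THEN exE])
  have "\<forall>k\<in>{..<n} - (Lf \<union> T). \<exists>\<alpha>. col_op k \<alpha> \<and> (\<forall>r<q. ?M \<alpha> r = 0)"
  proof
    fix k assume "k \<in> {..<n} - (Lf \<union> T)"
    then show "\<exists>\<alpha>. col_op k \<alpha> \<and> (\<forall>r<q. ?M \<alpha> r = 0)"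
      using plus_col_op[of k] uncolored_col_op[of k] by (cases "k < p") auto
  qed
  then obtain \<zeta> where \<zeta>: "\<forall>k\<in>{..<n} - (Lf \<union> T). col_op k (\<zeta> k) \<and> (\<forall>r<q. ?M (\<zeta> k) r = 0)"
    by (rule bchoice[THEN exE])
  \<comment> \<open>A right-end is treated with the coefficients chosen together with those of its left-end.\<close>
  define \<beta> where "\<beta> k = (if k \<in> Lf then \<alpha> k else if k \<in> mu ` Lf then \<gamma> (the_inv_into Lf mu k)
      else if k \<in> T then (\<lambda>l. if l = k then 1 else 0) else \<zeta> k)" for k
  have LT: "l \<notin> Lf" if "l \<in> T" for l using that Lf T by force
  have \<beta>mu: "\<beta> (mu k) = \<gamma> k" if "k \<in> Lf" for k
    using that LT[OF mu_T[OF that]] the_inv_into_f_f[OF mu(1) that] by (simp add: \<beta>_def)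
  have \<beta>op: "col_op k (\<beta> k)" if kn: "k < n" for k
  proof (cases "k \<in> mu ` Lf")
    case True
    then obtain l where l: "l \<in> Lf" "k = mu l" by blast
    then show ?thesis using bspec[OF \<alpha>\<gamma> l(1)] \<beta>mu[OF l(1)] by simp
  next
    case False
    consider "k \<in> Lf" | "k \<notin> Lf" "k \<in> T" | "k \<in> {..<n} - (Lf \<union> T)" using kn by auto
    then show ?thesis
    proof cases
      case 1
      then show ?thesis using bspec[OF \<alpha>\<gamma> 1] by (simp add: \<beta>_def)
    next
      case 2
      then show ?thesis using False by (auto simp: \<beta>_def col_op_def)
    next
      case 3
      then show ?thesis using bspec[OF \<zeta> 3] False by (simp add: \<beta>_def)
    qed
  qed
  define V where "V k r = ?M (\<beta> k) r" for k r
  have V0: "V k r = 0" if "k < n" "k \<notin> Lf \<union> T" "r < q" for k r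
  proof -
    have "k \<notin> mu ` Lf" using that mu by auto
    then show ?thesis using bspec[OF \<zeta>, of k] that by (simp add: V_def \<beta>_def)
  qed
  have VL: "V k r = V (mu k) r" if "k \<in> Lf" "r < q" for k r
    using bspec[OF \<alpha>\<gamma> that(1)] that by (simp add: V_def \<beta>mu) (simp add: \<beta>_def)
  define B where "B = mat n n (\<lambda>(l, k). \<beta> k l)"
  have B: "B \<in> block_tri"
  proof -
    have "i \<le> j \<and> (i < p \<longleftrightarrow> j < p)" if "i < n" "j < n" "B $$ (i, j) \<noteq> 0" for i j
    proof -
      have "\<beta> j i \<noteq> 0" using that by (simp add: B_def)
      then show ?thesis using \<beta>op[OF that(2)] unfolding col_op_def by blast
    qed
    then show ?thesis unfolding block_tri_def by (auto simp: B_def)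
  qed
  have Bc: "B \<in> carrier_mat n n" by (simp add: B_def)
  have dB: "det B \<noteq> 0" unfolding block_tri_det[OF B]
  proof (intro allI impI)
    fix i assume i: "i < n"
    then show "B $$ (i, i) \<noteq> 0" using \<beta>op[OF i] unfolding B_def col_op_def by simp
  qed
  obtain c where c: "c \<in> carrier_mat n n" "B * c = 1\<^sub>m n" "det c \<noteq> 0"
    using det_nonzero_obtain_inverse[OF Bc dB] by blast
  have cBT: "c \<in> block_tri" by (rule block_tri_inverse[OF B dB c(1,2)])
  define A' where "A' = mat q n (\<lambda>(r, k). w k r)"
  define g where "g = mat q q (\<lambda>(r, s). V (the_inv_into T eta s) r)"
  have gc: "g \<in> carrier_mat q q" by (simp add: g_def)
  have inv_eta: "the_inv_into T eta (eta t) = t" if "t \<in> T" for t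
    using eta that by (intro the_inv_into_f_f) (auto simp: bij_betw_def)
  have mc: "base_mat \<in> carrier_mat q n" by (simp add: base_mat_def)
  have "A' * B = g * base_mat"
  proof (rule eq_matI)
    fix r k assume "r < dim_row (g * base_mat)" "k < dim_col (g * base_mat)"
    then have r: "r < q" and k: "k < n" by (auto simp: g_def base_mat_def)
    have "(A' * B) $$ (r, k) = V k r"
      using r k by (auto simp: A'_def B_def scalar_prod_def atLeast0LessThan V_def ac_simps intro!: sum.cong)
    also have "V k r = (if k \<in> Lf \<union> T then g $$ (r, piv k) else 0)"
      using r k V0 VL piv_less[of k] piv_T[of k] piv_Lf[of k] inv_eta mu_T[of k] eta_less
      by (auto simp: g_def)
    also have "\<dots> = (\<Sum>s<q. if s = piv k then (if k \<in> Lf \<union> T then g $$ (r, s) else 0) else 0)"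
      using piv_less[of k] by auto
    also have "\<dots> = (\<Sum>s<q. g $$ (r, s) * (if k \<in> Lf \<union> T \<and> piv k = s then 1 else 0))"
      by (rule sum.cong) auto
    also have "\<dots> = (g * base_mat) $$ (r, k)"
      using r k gc by (simp add: base_mat_def scalar_prod_def atLeast0LessThan)
    finally show "(A' * B) $$ (r, k) = (g * base_mat) $$ (r, k)" .
  qed (auto simp: A'_def B_def g_def base_mat_def)
  then have "(A' * B) * c = (g * base_mat) * c" by simp
  moreover have A'c: "A' \<in> carrier_mat q n" by (simp add: A'_def)
  ultimately have A': "A' = g * (base_mat * c)"
    using Bc c gc mc by (simp add: assoc_mult_mat[of _ q n _ n _ n] assoc_mult_mat[of _ q q _ n _ n])
  have AN: "A = g * orbit_mat c"
  proof (rule eq_matI)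
    fix r j assume "r < dim_row (g * orbit_mat c)" "j < dim_col (g * orbit_mat c)"
    then have r: "r < q" and j: "j < n" by (auto simp: g_def orbit_mat_def)
    have fj: "flip p j < n" using j pn by simp
    have "A $$ (r, j) = A' $$ (r, flip p j)" using r fj by (simp add: A'_def w_def)
    also have "\<dots> = (\<Sum>s<q. g $$ (r, s) * (base_mat * c) $$ (s, flip p j))"
      unfolding A' using r fj gc mc c by (simp add: scalar_prod_def atLeast0LessThan)
    also have "\<dots> = (\<Sum>s<q. g $$ (r, s) * orbit_col c (flip p j) s)"
      using fj c by (intro sum.cong) (auto simp: base_mat_mult)
    also have "\<dots> = (g * orbit_mat c) $$ (r, j)"
      using r j gc by (simp add: scalar_prod_def atLeast0LessThan orbit_mat_def)
    finally show "A $$ (r, j) = (g * orbit_mat c) $$ (r, j)" .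
  qed (use A_carrier in \<open>auto simp: g_def orbit_mat_def\<close>)
  have "g \<in> full_rank_mats q q"
    unfolding full_rank_mats_iff
  proof (intro conjI gc allI impI)
    fix d r assume d: "\<forall>j<q. (\<Sum>r<q. d r * g $$ (r, j)) = 0" and r: "r < q"
    have "(\<Sum>r<q. d r * A $$ (r, j)) = 0" if j: "j < n" for j
    proof -
      have "(\<Sum>r<q. d r * A $$ (r, j)) = (\<Sum>r<q. \<Sum>s<q. d r * (g $$ (r, s) * orbit_mat c $$ (s, j)))"
        unfolding AN using j gc orbit_mat_carrier[of c]
        by (intro sum.cong) (auto simp: scalar_prod_def atLeast0LessThan sum_distrib_left)
      also have "\<dots> = (\<Sum>s<q. \<Sum>r<q. d r * (g $$ (r, s) * orbit_mat c $$ (s, j)))" by (rule sum.swap)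
      also have "\<dots> = (\<Sum>s<q. (\<Sum>r<q. d r * g $$ (r, s)) * orbit_mat c $$ (s, j))"
        by (simp add: sum_distrib_right mult.assoc)
      also have "\<dots> = 0" using d by simp
      finally show ?thesis .
    qed
    then show "d r = 0" using A r unfolding full_rank_mats_iff by blast
  qed
  then have "det g \<noteq> 0" using det_nonzero_iff_full_rank[OF gc] by simp
  then have "row_span n A = row_span n (orbit_mat c)"
    unfolding AN by (rule row_span_mult[OF gc _ orbit_mat_carrier])
  then show ?thesis using cBT c by blast
qed

end

end

section \<open>The column pattern of a preclan\<close>

lemma nth_elem_label:
  assumes S: "finite S" and k: "1 \<le> k" "k \<le> card S"
  shows "nth_elem S k \<in> S" "card {a \<in> S. a \<le> nth_elem S k} = k"
proof -
  define xs where "xs = sorted_list_of_set S"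
  have xs: "set xs = S" "length xs = card S" "sorted_wrt (<) xs" "distinct xs"
    using S by (auto simp: xs_def)
  have e: "nth_elem S k = xs ! (k - 1)" by (simp add: nth_elem_def xs_def)
  show "nth_elem S k \<in> S" using k xs(1,2) nth_mem[of "k - 1" xs] by (simp add: e)
  have mono: "xs ! i < xs ! j" if "i < j" "j < length xs" for i j
    using sorted_wrt_nth_less[OF xs(3) that] .
  have "{a \<in> S. a \<le> xs ! (k - 1)} = (!) xs ` {..<k}"
  proof (intro Set.set_eqI iffI)
    fix a assume a: "a \<in> {a \<in> S. a \<le> xs ! (k - 1)}"
    then obtain i where i: "i < length xs" "a = xs ! i" using xs(1) by (auto simp: in_set_conv_nth)
    have "i \<le> k - 1"
    proof (rule ccontr)
      assume "\<not> i \<le> k - 1"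
      then have "xs ! (k - 1) < xs ! i" using mono[of "k - 1" i] i by simp
      then show False using a i by simp
    qed
    then show "a \<in> (!) xs ` {..<k}" using i k by auto
  next
    fix a assume "a \<in> (!) xs ` {..<k}"
    then obtain i where i: "i < k" "a = xs ! i" by auto
    have "xs ! i \<le> xs ! (k - 1)"
    proof (cases "i = k - 1")
      case False
      then have "i < k - 1" "k - 1 < length xs" using i k xs(2) by auto
      then show ?thesis by (intro less_imp_le mono)
    qed simp
    then show "a \<in> {a \<in> S. a \<le> xs ! (k - 1)}" using i k xs by auto
  qed
  moreover have "inj_on ((!) xs) {..<k}" using k xs by (intro inj_on_nth) auto
  ultimately show "card {a \<in> S. a \<le> nth_elem S k} = k" unfolding e by (simp add: card_image)
qed

lemma label_in_bij:
  assumes S: "finite S"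
  shows "bij_betw (label_in S) S {1..card S}"
proof -
  have "inj_on (label_in S) S"
    unfolding label_in_def by (rule inj_onI) (use card_below_inj[OF S] in auto)
  moreover have "label_in S ` S \<subseteq> {1..card S}"
    unfolding label_in_def using S by (auto simp: Suc_le_eq card_gt_0_iff intro!: card_mono)
  moreover from calculation have "label_in S ` S = {1..card S}"
    by (intro card_subset_eq) (simp_all add: card_image)
  ultimately show ?thesis unfolding bij_betw_def by blast
qed

lemma f_gamma_periodic:
  assumes "n = p + m + q" "n > 0"
  shows "f_gamma p m q \<gamma> (x + int n) = f_gamma p m q \<gamma> x + int n"
proof -
  have "x + int n - 1 = (x - 1) + int n" by simp
  then have "(x + int n - 1) mod int n = (x - 1) mod int n"
      "(x + int n - 1) div int n = (x - 1) div int n + 1"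
    using assms(2) by (simp_all only: mod_add_self2) simp
  then show ?thesis
    using assms(2) unfolding f_gamma_def Let_def assms(1)[symmetric] by (simp add: algebra_simps)
qed

lemma f_gamma_window:
  assumes "n = p + m + q" "1 \<le> x" "x \<le> n"
  shows "f_gamma p m q \<gamma> (int x) = int (f_window p m q \<gamma> x)"
proof -
  have "(int x - 1) mod int n = int x - 1" "(int x - 1) div int n = 0" using assms by auto
  then show ?thesis
    using assms(2,3) unfolding f_gamma_def Let_def assms(1)[symmetric] by (simp add: nat_add_distrib)
qed

lemma periodic_eqI:
  fixes f g :: "int \<Rightarrow> int"
  assumes n: "n > 0" and f: "\<And>x. f (x + int n) = f x + int n" and g: "\<And>x. g (x + int n) = g x + int n"
    and eq: "\<And>x. 1 \<le> x \<Longrightarrow> x \<le> n \<Longrightarrow> f (int x) = g (int x)"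
  shows "f = g"
proof
  have mult: "h (x + int n * int k) = h x + int n * int k" if "\<And>x. h (x + int n) = h x + int n" for h :: "int \<Rightarrow> int" and x k
  proof (induction k)
    case (Suc k)
    have "h (x + int n * int (Suc k)) = h ((x + int n * int k) + int n)" by (simp add: algebra_simps)
    also have "\<dots> = h x + int n * int k + int n" unfolding that Suc.IH ..
    finally show ?case by (simp add: algebra_simps)
  qed simp
  have shift: "f x = g x \<longleftrightarrow> f (x + int n * int k) = g (x + int n * int k)" for x k
    using mult[of f, OF f] mult[of g, OF g] by simp
  fix x
  define d where "d = (x - 1) div int n"
  define y where "y = nat ((x - 1) mod int n + 1)"
  have y: "1 \<le> y" "y \<le> n" "int y = x - int n * d"
  proof -
    have "0 \<le> (x - 1) mod int n" "(x - 1) mod int n < int n" using n by simp_all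
    moreover have "int n * d + (x - 1) mod int n = x - 1" unfolding d_def by (rule mult_div_mod_eq)
    ultimately show "1 \<le> y" "y \<le> n" "int y = x - int n * d" by (auto simp: y_def)
  qed
  show "f x = g x"
  proof (cases "0 \<le> d")
    case True
    then have "x = int y + int n * int (nat d)" using y by simp
    then show ?thesis using shift[of "int y" "nat d"] eq[OF y(1,2)] by simp
  next
    case False
    then have "int y = x + int n * int (nat (- d))" using y by simp
    then show ?thesis using shift[of x "nat (- d)"] eq[OF y(1,2)] by simp
  qed
qed

locale identity_preclan =
  fixes p m q n :: nat and \<gamma> :: preclan
  assumes n: "n = p + m + q" and pre: "is_preclan p m q \<gamma>" and v: "v_perm p m q \<gamma> = id"
begin

abbreviation "L \<equiv> left_ends \<gamma>"
abbreviation "R \<equiv> right_ends \<gamma>"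
abbreviation "Pl \<equiv> nodes_of_color n \<gamma> Plus_node"
abbreviation "Mn \<equiv> nodes_of_color n \<gamma> Minus_node"
abbreviation "Uc \<equiv> nodes_of_color n \<gamma> Uncolored_node"

lemma match_bounds: "(i, j) \<in> matching \<gamma> \<Longrightarrow> 1 \<le> i \<and> i < j \<and> j \<le> n"
  using pre unfolding is_preclan_def Let_def n by blast

lemma match_disjoint:
  "(i, j) \<in> matching \<gamma> \<Longrightarrow> (i', j') \<in> matching \<gamma> \<Longrightarrow> i = i' \<or> i = j' \<or> j = i' \<or> j = j' \<Longrightarrow> i = i' \<and> j = j'"
  using pre unfolding is_preclan_def Let_def by fastforce

lemma cards:
  "card Pl + card (matching \<gamma>) = p" "card Mn + card (matching \<gamma>) = q" "card Uc = m"
  using pre unfolding is_preclan_def Let_def n by auto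

lemma mate_eq: "(i, j) \<in> matching \<gamma> \<Longrightarrow> mate \<gamma> i = j"
  unfolding mate_def using match_disjoint by (intro the_equality) blast+

lemma L_iff: "i \<in> L \<longleftrightarrow> (\<exists>j. (i, j) \<in> matching \<gamma>)"
  and R_iff: "j \<in> R \<longleftrightarrow> (\<exists>i. (i, j) \<in> matching \<gamma>)"
  by (force simp: left_ends_def right_ends_def)+

lemma mate_matching: "i \<in> L \<Longrightarrow> (i, mate \<gamma> i) \<in> matching \<gamma>"
  using L_iff mate_eq by auto

lemma LR_disjoint: "L \<inter> R = {}"
proof (rule ccontr)
  assume "L \<inter> R \<noteq> {}"
  then obtain i j k where ij: "(i, j) \<in> matching \<gamma>" and ki: "(k, i) \<in> matching \<gamma>"
    using L_iff R_iff by blast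
  then have "i = k" using match_disjoint[OF ij ki] by simp
  then show False using match_bounds[OF ki] by simp
qed

lemma subsets: "L \<subseteq> {1..n}" "R \<subseteq> {1..n}" "Pl \<subseteq> {1..n}" "Mn \<subseteq> {1..n}" "Uc \<subseteq> {1..n}"
  using match_bounds by (auto simp: L_iff R_iff nodes_of_color_def) force+

lemma finite_sets: "finite L" "finite R" "finite Pl" "finite Mn" "finite Uc"
  using subsets by (auto intro: finite_subset)

lemma node_cases:
  assumes "i \<in> {1..n}"
  shows "i \<in> L \<or> i \<in> R \<or> i \<in> Pl \<or> i \<in> Mn \<or> i \<in> Uc"
  using assms by (cases "color \<gamma> i") (auto simp: nodes_of_color_def)

lemma node_disjoint: "Pl \<inter> (L \<union> R \<union> Mn \<union> Uc) = {}" "Mn \<inter> (L \<union> R \<union> Uc) = {}" "Uc \<inter> (L \<union> R) = {}"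
  by (auto simp: nodes_of_color_def)

lemma card_L: "card L = card (matching \<gamma>)" and card_R: "card R = card (matching \<gamma>)"
proof -
  have "inj_on fst (matching \<gamma>)" "inj_on snd (matching \<gamma>)"
    by (rule inj_onI; use match_disjoint in \<open>metis prod.collapse\<close>)+
  then show "card L = card (matching \<gamma>)" "card R = card (matching \<gamma>)"
    unfolding left_ends_def right_ends_def by (simp_all add: card_image)
qed

text \<open>The labels of \<open>+\<close>'s and left-ends do not exceed \<open>p\<close>, so the identity permutation only labels nodes
  up to \<open>p\<close> in this way; there are \<open>p\<close> such nodes.\<close>

lemma plus_or_left_eq: "Pl \<union> L = {1..p}"
proof -
  let ?S = "Pl \<union> L"
  have cS: "card ?S = p"
    using node_disjoint finite_sets card_L cards by (subst card_Un_disjoint) auto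
  have vi: "i = (if i \<in> ?S then label_in ?S i else p + label_in ({1..n} - ?S) i)" if "i \<in> {1..n}" for i
    using fun_cong[OF v, of i] that unfolding v_perm_def Let_def n[symmetric] plus_or_left_def by auto
  have "?S \<subseteq> {1..p}"
  proof
    fix i assume i: "i \<in> ?S"
    then have "i = label_in ?S i" using vi[of i] subsets by auto
    also have "\<dots> \<le> p" unfolding label_in_def cS[symmetric] using finite_sets by (intro card_mono) auto
    finally show "i \<in> {1..p}" using i subsets by auto
  qed
  then show ?thesis using cS by (intro card_subset_eq) auto
qed

lemma right_part: "R \<union> Mn \<union> Uc = {p + 1..n}"
proof -
  have "R \<union> Mn \<union> Uc = {1..n} - (Pl \<union> L)"
  proof
    have "R \<inter> Pl = {}" "R \<inter> L = {}" "Mn \<inter> Pl = {}" "Mn \<inter> L = {}" "Uc \<inter> Pl = {}" "Uc \<inter> L = {}"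
      using node_disjoint LR_disjoint by auto
    then have "(R \<union> Mn \<union> Uc) \<inter> (Pl \<union> L) = {}" by blast
    moreover have "R \<union> Mn \<union> Uc \<subseteq> {1..n}" using subsets by simp
    ultimately show "R \<union> Mn \<union> Uc \<subseteq> {1..n} - (Pl \<union> L)" by blast
    show "{1..n} - (Pl \<union> L) \<subseteq> R \<union> Mn \<union> Uc"
    proof
      fix i assume "i \<in> {1..n} - (Pl \<union> L)"
      then show "i \<in> R \<union> Mn \<union> Uc" using node_cases[of i] by auto
    qed
  qed
  also have "\<dots> = {p + 1..n}" unfolding plus_or_left_eq by auto
  finally show ?thesis .
qed

definition "RM = R \<union> Mn"

lemma finite_RM: "finite RM" and card_RM: "card RM = q"
proof -
  show "finite RM" using finite_sets by (simp add: RM_def)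
  show "card RM = q" unfolding RM_def
    using node_disjoint finite_sets card_R cards by (subst card_Un_disjoint) auto
qed

text \<open>From here on nodes are shifted to \<open>0\<close>-based column indices.\<close>

definition "Lf = {k. Suc k \<in> L}"
definition "T = {k. Suc k \<in> RM}"
definition "mu k = mate \<gamma> (Suc k) - 1"
definition "eta k = label_in RM (Suc k) - 1"

lemma Suc_mu: "k \<in> Lf \<Longrightarrow> Suc (mu k) = mate \<gamma> (Suc k) \<and> (Suc k, Suc (mu k)) \<in> matching \<gamma>"
  using mate_matching[of "Suc k"] match_bounds[of "Suc k" "mate \<gamma> (Suc k)"] by (auto simp: Lf_def mu_def)

lemma L_image: "L = Suc ` Lf" and RM_image: "RM = Suc ` T"
proof -
  have "0 \<notin> L" "0 \<notin> RM" using subsets by (auto simp: RM_def)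
  then show "L = Suc ` Lf" "RM = Suc ` T"
    unfolding Lf_def T_def by (auto simp: image_iff) (metis not0_implies_Suc)+
qed

lemma label_RM: "bij_betw (label_in RM) RM {1..q}"
  using label_in_bij[OF finite_RM] card_RM by simp

lemma Suc_eta: "k \<in> T \<Longrightarrow> Suc (eta k) = label_in RM (Suc k)"
  using bij_betwE[OF label_RM] by (fastforce simp: T_def eta_def)

lemma mu_image: "Suc ` mu ` Lf = R"
proof (intro Set.set_eqI iffI)
  fix j assume "j \<in> Suc ` mu ` Lf"
  then show "j \<in> R" using Suc_mu R_iff by blast
next
  fix j assume "j \<in> R"
  then obtain i where ij: "(i, j) \<in> matching \<gamma>" using R_iff by blast
  then obtain k where k: "i = Suc k" using match_bounds[OF ij] by (cases i) auto
  then have "k \<in> Lf" using ij L_iff by (auto simp: Lf_def)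
  then have "j = Suc (mu k)" using Suc_mu mate_eq[OF ij] k by simp
  then show "j \<in> Suc ` mu ` Lf" using \<open>k \<in> Lf\<close> by blast
qed

sublocale pattern p n q Lf T mu eta
proof
  show "p \<le> n" using n by simp
  show "Lf \<subseteq> {..<p}"
  proof
    fix k assume "k \<in> Lf"
    then have "Suc k \<in> Pl \<union> L" by (simp add: Lf_def)
    then show "k \<in> {..<p}" unfolding plus_or_left_eq by simp
  qed
  show "T \<subseteq> {p..<n}"
  proof
    fix k assume "k \<in> T"
    then have "Suc k \<in> R \<union> Mn \<union> Uc" by (simp add: T_def RM_def)
    then show "k \<in> {p..<n}" unfolding right_part by simp
  qed
  show "inj_on mu Lf"
  proof (rule inj_onI)
    fix k l assume "k \<in> Lf" "l \<in> Lf" "mu k = mu l"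
    then show "k = l" using Suc_mu[of k] Suc_mu[of l] match_disjoint[of "Suc k" _ "Suc l"] by auto
  qed
  have "Suc ` mu ` Lf \<subseteq> Suc ` T" unfolding mu_image RM_image[symmetric] by (simp add: RM_def)
  then show "mu ` Lf \<subseteq> T" by (simp add: inj_image_subset_iff)
  have "eta ` T = {..<q}"
  proof -
    have "Suc ` eta ` T = label_in RM ` Suc ` T"
      unfolding image_image using Suc_eta by (intro image_cong) auto
    also have "\<dots> = {1..q}" using label_RM unfolding RM_image[symmetric] bij_betw_def by simp
    also have "\<dots> = Suc ` {..<q}" by (simp add: image_Suc_lessThan)
    finally show ?thesis by (simp add: inj_image_eq_iff)
  qed
  moreover have "inj_on eta T"
  proof (rule inj_onI)
    fix k l assume kl: "k \<in> T" "l \<in> T" "eta k = eta l"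
    then have "label_in RM (Suc k) = label_in RM (Suc l)" using Suc_eta by metis
    then show "k = l" using label_RM kl by (auto simp: bij_betw_def inj_on_def T_def)
  qed
  ultimately show "bij_betw eta T {..<q}" by (simp add: bij_betw_def)
qed

lemma Minus_cols_image: "Suc ` Minus_cols = Mn"
proof -
  have "Suc ` Minus_cols = RM - R"
    unfolding Minus_cols_def RM_image mu_image[symmetric] by (simp add: image_set_diff)
  then show ?thesis using node_disjoint by (auto simp: RM_def)
qed

lemma Un_image: "Suc ` ({p..<n} - T) = Uc"
proof -
  have "Suc ` {p..<n} = {p + 1..n}" by (simp add: image_Suc_atLeastLessThan atLeastLessThanSuc_atLeastAtMost)
  then have "Suc ` ({p..<n} - T) = {p + 1..n} - RM"
    by (simp add: image_set_diff RM_image)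
  then show ?thesis using right_part[symmetric] node_disjoint by (auto simp: RM_def)
qed

lemma card_Suc_image: "card {v \<in> S. v \<le> k} = card {a \<in> Suc ` S. a \<le> Suc k}"
proof -
  have "{a \<in> Suc ` S. a \<le> Suc k} = Suc ` {v \<in> S. v \<le> k}" by auto
  then show ?thesis by (simp add: card_image)
qed

lemma f_window_is_window: "is_window m (f_window p m q \<gamma>)"
  unfolding is_window_def
proof (intro conjI ballI impI n)
  fix x assume x: "x \<in> {1..p}"
  have i: "p + 1 - x = Suc (p - x)" using x by auto
  {
    assume "p - x \<in> Lf"
    then show "f_window p m q \<gamma> x = mu (p - x) + 1"
      using x Suc_mu[of "p - x"] unfolding f_window_def Let_def i by (simp add: Lf_def)
  next
    assume l: "p - x \<notin> Lf"
    have "{(a, b). (a, b) \<in> matching \<gamma> \<and> a < Suc (p - x) \<and> Suc (p - x) < b} =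
        {(a, b). (a, b) \<in> matching \<gamma> \<and> a < Suc (p - x)}"
    proof -
      have "Suc (p - x) < b" if "(a, b) \<in> matching \<gamma>" for a b
      proof -
        have "b \<in> {p + 1..n}" using that right_part R_iff by blast
        then show ?thesis using x by auto
      qed
      then show ?thesis by auto
    qed
    moreover have "card {(a, b). (a, b) \<in> matching \<gamma> \<and> a < Suc (p - x)} = card {l \<in> Lf. l < p - x}"
    proof -
      have "Suc ` {l \<in> Lf. l < p - x} = fst ` {(a, b). (a, b) \<in> matching \<gamma> \<and> a < Suc (p - x)}"
      proof -
        have "Suc ` {l \<in> Lf. l < p - x} = {a \<in> Suc ` Lf. a < Suc (p - x)}" by auto
        also have "\<dots> = {a \<in> L. a < Suc (p - x)}" by (simp only: L_image)
        also have "\<dots> = fst ` {(a, b). (a, b) \<in> matching \<gamma> \<and> a < Suc (p - x)}"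
          unfolding left_ends_def by force
        finally show ?thesis .
      qed
      moreover have "inj_on fst {(a, b). (a, b) \<in> matching \<gamma> \<and> a < Suc (p - x)}"
        using match_disjoint by (auto simp: inj_on_def)
      ultimately show ?thesis by (metis (no_types, lifting) card_image inj_Suc inj_on_subset subset_UNIV)
    qed
    moreover have "p + 1 - Suc (p - x) = x" using x by simp
    ultimately show "f_window p m q \<gamma> x = x + card {l \<in> Lf. l < p - x}"
      using x l unfolding f_window_def Let_def i by (simp add: Lf_def)
  }
next
  fix x assume x: "x \<in> {p + 1..p + m}"
  define u where "u = nth_elem Uc (x - p)"
  have u: "u \<in> Uc" "card {a \<in> Uc. a \<le> u} = x - p"
    unfolding u_def by (rule nth_elem_label; use finite_sets cards x in auto)+
  have f: "f_window p m q \<gamma> x = u" using x by (simp add: f_window_def Let_def u_def n)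
  obtain k where k: "k \<in> {p..<n} - T" "u = Suc k" using u(1) unfolding Un_image[symmetric] by blast
  then have "card {v \<in> {p..<n} - T. v \<le> k} = x - p"
    using u(2) unfolding card_Suc_image[of "{p..<n} - T" k] Un_image by simp
  then show "\<exists>u\<in>{p..<n} - T. f_window p m q \<gamma> x = u + 1 \<and> card {v \<in> {p..<n} - T. v \<le> u} = x - p"
    using f k by auto
next
  have cL: "card Lf = card (matching \<gamma>)" using card_L unfolding L_image by (simp add: card_image)
  {
    fix i assume "i \<in> {1..card Lf}"
    then show "f_window p m q \<gamma> (p + m + i) = n + i"
      unfolding cL f_window_def Let_def n by simp
  next
    fix x assume x: "x \<in> {p + m + card Lf + 1..n}"
    define k where "k = x - (p + m + card Lf)"
    define u where "u = nth_elem Mn k"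
    have u: "u \<in> Mn" "card {a \<in> Mn. a \<le> u} = k"
      unfolding u_def by (rule nth_elem_label; use finite_sets cards x n cL in \<open>auto simp: k_def\<close>)+
    have f: "f_window p m q \<gamma> x = n + u"
      using x unfolding f_window_def Let_def u_def k_def n cL by simp
    obtain t where t: "t \<in> Minus_cols" "u = Suc t" using u(1) unfolding Minus_cols_image[symmetric] by blast
    then have "card {v \<in> Minus_cols. v \<le> t} = k"
      using u(2) unfolding card_Suc_image[of Minus_cols t] Minus_cols_image by simp
    then show "\<exists>t\<in>Minus_cols. f_window p m q \<gamma> x = n + t + 1 \<and> card {v \<in> Minus_cols. v \<le> t} = x - (p + m + card Lf)"
      using f t unfolding k_def by auto
  }
qed

abbreviation "\<sigma> \<equiv> sigma_perm p m q \<gamma>"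

lemma \<sigma>_left: "1 \<le> i \<Longrightarrow> i \<le> p \<Longrightarrow> \<sigma> i = i"
proof -
  assume i: "1 \<le> i" "i \<le> p"
  have "{a \<in> {1..p}. a \<le> i} = {1..i}" using i by auto
  then show ?thesis
    using i n unfolding sigma_perm_def Let_def n[symmetric] plus_or_left_def plus_or_left_eq
    by (simp add: label_in_def)
qed

lemma \<sigma>_uncolored: "i \<in> Uc \<Longrightarrow> \<sigma> i = p + label_in Uc i"
proof -
  assume i: "i \<in> Uc"
  then have "i \<in> {p + 1..n}" using right_part by blast
  then show ?thesis using i
    unfolding sigma_perm_def Let_def n[symmetric] plus_or_left_def plus_or_left_eq by simp
qed

lemma \<sigma>_right: "i \<in> RM \<Longrightarrow> \<sigma> i = p + m + label_in RM i"
proof -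
  assume i: "i \<in> RM"
  then have "i \<in> {p + 1..n}" "i \<notin> Uc" using right_part node_disjoint by (auto simp: RM_def)
  then show ?thesis using i
    unfolding sigma_perm_def Let_def n[symmetric] plus_or_left_def plus_or_left_eq
    by (simp add: RM_def Un_commute)
qed

lemma label_Un: "bij_betw (label_in Uc) Uc {1..m}"
  using label_in_bij[OF finite_sets(5)] cards by simp

lemma \<sigma>_surj: "\<sigma> ` {1..n} = {1..n}"
proof -
  have "{1..n} = {1..p} \<union> {p + 1..n}" using n by auto
  also have "{p + 1..n} = Uc \<union> RM" unfolding right_part[symmetric] RM_def by blast
  finally have "{1..n} = {1..p} \<union> (Uc \<union> RM)" .
  then have "\<sigma> ` {1..n} = \<sigma> ` {1..p} \<union> (\<sigma> ` Uc \<union> \<sigma> ` RM)" by (simp only: image_Un)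
  also have "\<sigma> ` {1..p} = {1..p}" using \<sigma>_left by (force simp: image_iff)
  also have "\<sigma> ` Uc = (\<lambda>x. p + x) ` label_in Uc ` Uc"
    unfolding image_image using \<sigma>_uncolored by (intro image_cong) auto
  also have "\<dots> = {p + 1..p + m}" using label_Un unfolding bij_betw_def by (simp add: image_add_atLeastAtMost)
  also have "\<sigma> ` RM = (\<lambda>x. p + m + x) ` label_in RM ` RM"
    unfolding image_image using \<sigma>_right by (intro image_cong) auto
  also have "\<dots> = {p + m + 1..p + m + q}" using label_RM unfolding bij_betw_def by (simp add: image_add_atLeastAtMost)
  also have "{1..p} \<union> ({p + 1..p + m} \<union> {p + m + 1..p + m + q}) = {1..n}" using n by auto
  finally show ?thesis .
qed

lemma \<sigma>_range: "i \<in> {1..n} \<Longrightarrow> \<sigma> i \<in> {1..n}"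
  using \<sigma>_surj by blast

lemma mate_range: "i \<in> L \<Longrightarrow> mate \<gamma> i \<in> {1..n}"
  using mate_matching match_bounds by fastforce

lemma gamma_dot_carrier: "gamma_dot p m q \<gamma> \<in> carrier_mat n n"
  unfolding gamma_dot_def Let_def n[symmetric] by (intro carrier_matI) (simp_all del: upt_Suc)

lemma gamma_dot_index:
  assumes "r < n" "c < n"
  shows "gamma_dot p m q \<gamma> $$ (r, c) =
    (if r = \<sigma> (Suc c) - 1 then 1 else 0) + (if Suc c \<in> L \<and> r = \<sigma> (mate \<gamma> (Suc c)) - 1 then 1 else 0)"
proof -
  have "\<sigma> (Suc c) \<in> {1..n}" using assms(2) by (intro \<sigma>_range) simp
  then have "\<sigma> (Suc c) - 1 < n" using assms(2) by auto
  moreover have "\<sigma> (mate \<gamma> (Suc c)) - 1 < n" if "Suc c \<in> L"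
    using \<sigma>_range[OF mate_range[OF that]] assms(2) by auto
  ultimately show ?thesis
    using assms unfolding gamma_dot_def Let_def n[symmetric]
    by (simp add: mat_of_cols_index nth_append del: upt_Suc)
qed

text \<open>A linear relation among the rows vanishes on each column. At a node that is not a left-end this
  kills the coefficient of its label, and then the equation at a left-end leaves only its own
  coefficient. Every row has a label.\<close>

lemma gamma_dot_GL: "gamma_dot p m q \<gamma> \<in> carrier (GL n)"
proof -
  let ?G = "gamma_dot p m q \<gamma>"
  have "?G \<in> full_rank_mats n n"
    unfolding full_rank_mats_iff
  proof (intro conjI gamma_dot_carrier allI impI)
    fix c r assume c: "\<forall>j<n. (\<Sum>r<n. c r * ?G $$ (r, j)) = 0" and r: "r < n"
    have eq: "c (\<sigma> i - 1) + (if i \<in> L then c (\<sigma> (mate \<gamma> i) - 1) else 0) = 0" if i: "i \<in> {1..n}" for i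
    proof -
      define j where "j = i - 1"
      have j: "i = Suc j" "j < n" using i by (auto simp: j_def)
      have \<sigma>i: "\<sigma> i - 1 < n" using \<sigma>_range[OF i] by auto
      have \<sigma>m: "\<sigma> (mate \<gamma> i) - 1 < n" if "i \<in> L"
        using \<sigma>_range[OF mate_range[OF that]] by auto
      have "(\<Sum>r<n. c r * ?G $$ (r, j)) = (\<Sum>r<n. (if r = \<sigma> i - 1 then 1 else 0) * c r)
          + (\<Sum>r<n. (if i \<in> L \<and> r = \<sigma> (mate \<gamma> i) - 1 then 1 else 0) * c r)"
        unfolding sum.distrib[symmetric] using j by (intro sum.cong) (auto simp: gamma_dot_index distrib_left)
      also have "(\<Sum>r<n. (if r = \<sigma> i - 1 then 1 else 0) * c r) = c (\<sigma> i - 1)"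
        using sum_delta_mult[of "{..<n}" "\<sigma> i - 1" c] \<sigma>i by simp
      also have "(\<Sum>r<n. (if i \<in> L \<and> r = \<sigma> (mate \<gamma> i) - 1 then 1 else 0) * c r) =
          (if i \<in> L then c (\<sigma> (mate \<gamma> i) - 1) else 0)"
        using sum_delta_mult[of "{..<n}" "\<sigma> (mate \<gamma> i) - 1" c] \<sigma>m by auto
      finally show ?thesis using c j by simp
    qed
    have "c (\<sigma> i - 1) = 0" if i: "i \<in> {1..n}" for i
    proof (cases "i \<in> L")
      case True
      then have "mate \<gamma> i \<in> R" using mate_matching R_iff by blast
      then have "mate \<gamma> i \<notin> L" "mate \<gamma> i \<in> {1..n}" using LR_disjoint subsets by auto
      then show ?thesis using eq[of "mate \<gamma> i"] eq[OF i] True by simp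
    qed (use eq[OF i] in simp)
    moreover have "Suc r \<in> \<sigma> ` {1..n}" unfolding \<sigma>_surj using r by simp
    then obtain i where "i \<in> {1..n}" "\<sigma> i = Suc r" by force
    ultimately show "c r = 0" by (metis diff_Suc_1)
  qed
  then show ?thesis using det_nonzero_iff_full_rank[OF gamma_dot_carrier] gamma_dot_carrier
    by (simp add: GL_carrier)
qed

lemma gamma_dot_bottom:
  assumes r: "r < q" and k: "k < n"
  shows "gamma_dot p m q \<gamma> $$ (p + m + r, k) = base_mat $$ (r, k)"
proof -
  have g: "gamma_dot p m q \<gamma> $$ (p + m + r, k) = (if p + m + r = \<sigma> (Suc k) - 1 then 1 else 0)
      + (if Suc k \<in> L \<and> p + m + r = \<sigma> (mate \<gamma> (Suc k)) - 1 then 1 else 0)"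
    using r k n by (intro gamma_dot_index) auto
  have b: "base_mat $$ (r, k) = (if k \<in> Lf \<union> T \<and> piv k = r then 1 else 0)"
    using r k by (simp add: base_mat_def)
  have \<sigma>T: "p + m + r = \<sigma> (Suc t) - 1 \<longleftrightarrow> eta t = r" if "t \<in> T" for t
    using that Suc_eta[OF that] \<sigma>_right[of "Suc t"] by (auto simp: T_def)
  consider "k < p" "k \<in> Lf" | "k < p" "k \<notin> Lf" | "p \<le> k" "k \<in> T" | "p \<le> k" "k \<notin> T" by linarith
  then show ?thesis
  proof cases
    case 1
    then show ?thesis
      unfolding g b using \<sigma>_left[of "Suc k"] \<sigma>T[OF mu_T[of k]] Suc_mu[of k] piv_Lf[of k] by (auto simp: Lf_def)
  next
    case 2
    then have "k \<notin> T" using T by auto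
    then show ?thesis unfolding g b using 2 \<sigma>_left[of "Suc k"] by (auto simp: Lf_def)
  next
    case 3
    then have "k \<notin> Lf" using Lf by auto
    then show ?thesis unfolding g b using 3 \<sigma>T[of k] piv_T[of k] by (auto simp: Lf_def)
  next
    case 4
    then have nl: "k \<notin> Lf" using Lf by auto
    have "Suc k \<in> Uc" unfolding Un_image[symmetric] using 4 k by auto
    then have "\<sigma> (Suc k) = p + label_in Uc (Suc k)" "label_in Uc (Suc k) \<le> m" "1 \<le> label_in Uc (Suc k)"
      using \<sigma>_uncolored bij_betwE[OF label_Un] by auto
    then show ?thesis unfolding g b using 4 nl by (auto simp: Lf_def)
  qed
qed

lemma bottom_mat_gamma_dot:
  assumes b: "b \<in> carrier_mat n n"
  shows "bottom_mat p m q (gamma_dot p m q \<gamma> * b) = orbit_mat b"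
proof (rule eq_matI)
  fix r c assume "r < dim_row (orbit_mat b)" "c < dim_col (orbit_mat b)"
  then have r: "r < q" and c: "c < n" by (auto simp: orbit_mat_def)
  have fc: "flip p c < n" using c pn by simp
  have "bottom_mat p m q (gamma_dot p m q \<gamma> * b) $$ (r, c) =
      (\<Sum>k<n. gamma_dot p m q \<gamma> $$ (p + m + r, k) * b $$ (k, flip p c))"
    using r c fc n b gamma_dot_carrier
    by (simp add: bottom_mat_def scalar_prod_def atLeast0LessThan)
  also have "\<dots> = (\<Sum>k<n. base_mat $$ (r, k) * b $$ (k, flip p c))"
    using gamma_dot_bottom[OF r] by simp
  also have "\<dots> = (base_mat * b) $$ (r, flip p c)"
    using r fc b by (simp add: base_mat_def scalar_prod_def atLeast0LessThan)
  also have "\<dots> = orbit_mat b $$ (r, c)"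
    using base_mat_mult[OF b r fc] r c by (simp add: orbit_mat_def)
  finally show "bottom_mat p m q (gamma_dot p m q \<gamma> * b) $$ (r, c) = orbit_mat b $$ (r, c)" .
qed (simp_all add: bottom_mat_def orbit_mat_def n[symmetric])

lemma Bbar_grp_eq: "Bbar_grp p m q = {b \<in> block_tri. det b \<noteq> 0}"
proof (intro Set.set_eqI iffI)
  fix x assume "x \<in> Bbar_grp p m q"
  then obtain b b' where x: "x = four_block_mat b (0\<^sub>m p (m + q)) (0\<^sub>m (m + q) p) b'"
    and b: "b \<in> carrier_mat p p" "det b \<noteq> 0" "upper_triangular b"
    and b': "b' \<in> carrier_mat (m + q) (m + q)" "det b' \<noteq> 0" "upper_triangular b'"
    unfolding Bbar_grp_def B_grp_def GL_carrier by blast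
  have "det x = det b * det b'" unfolding x
    using b b' by (intro det_four_block_mat_lower_left_zero) auto
  moreover have "x \<in> block_tri"
  proof -
    have "x \<in> carrier_mat n n" using b b' n unfolding x by auto
    moreover have "i \<le> j \<and> (i < p \<longleftrightarrow> j < p)" if ij: "i < n" "j < n" "x $$ (i, j) \<noteq> 0" for i j
    proof -
      have e: "x $$ (i, j) = (if i < p then if j < p then b $$ (i, j) else 0
          else if j < p then 0 else b' $$ (i - p, j - p))"
        using ij(1,2) b b' n unfolding x by auto
      show ?thesis
      proof (rule ccontr)
        assume neg: "\<not> (i \<le> j \<and> (i < p \<longleftrightarrow> j < p))"
        have "b $$ (i, j) = 0" if "j < i" "i < p" using upper_triangularD[OF b(3)] that b by simp
        moreover have "b' $$ (i - p, j - p) = 0" if "j < i" "\<not> j < p"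
          using upper_triangularD[OF b'(3), of "j - p" "i - p"] that b' ij n by simp
        ultimately show False using ij(3) neg unfolding e by (auto split: if_splits)
      qed
    qed
    ultimately show ?thesis unfolding block_tri_def by blast
  qed
  ultimately show "x \<in> {b \<in> block_tri. det b \<noteq> 0}" using b b' by simp
next
  fix x assume x: "x \<in> {b \<in> block_tri. det b \<noteq> 0}"
  then have xc: "x \<in> carrier_mat n n" using block_tri_carrier by auto
  have x0: "x $$ (i, j) = 0" if "i < n" "j < n" "\<not> (i \<le> j \<and> (i < p \<longleftrightarrow> j < p))" for i j
    using x that unfolding block_tri_def by blast
  define b where "b = mat p p (\<lambda>ij. x $$ ij)"
  define b' where "b' = mat (m + q) (m + q) (\<lambda>(i, j). x $$ (p + i, p + j))"
  have bc: "b \<in> carrier_mat p p" "b' \<in> carrier_mat (m + q) (m + q)" by (auto simp: b_def b'_def)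
  have xe: "x = four_block_mat b (0\<^sub>m p (m + q)) (0\<^sub>m (m + q) p) b'"
    using xc x0 n by (intro eq_matI) (auto simp: b_def b'_def)
  have "det (four_block_mat b (0\<^sub>m p (m + q)) (0\<^sub>m (m + q) p) b') = det b * det b'"
    using bc by (intro det_four_block_mat_lower_left_zero) auto
  then have "det b \<noteq> 0" "det b' \<noteq> 0" using x xe by auto
  moreover have "upper_triangular b"
    using x0 n by (intro upper_triangularI) (auto simp: b_def)
  moreover have "upper_triangular b'"
    using x0 n by (intro upper_triangularI) (auto simp: b'_def)
  ultimately have "b \<in> B_grp p" "b' \<in> B_grp (m + q)" using bc by (auto simp: B_grp_def GL_carrier)
  then show "x \<in> Bbar_grp p m q" unfolding Bbar_grp_def using xe by blast
qed

section \<open>Equality of the closures\<close>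

definition orbit :: "complex vec set set" where
  "orbit = (\<lambda>b. row_span n (orbit_mat b)) ` {b \<in> block_tri. det b \<noteq> 0}"

lemma gamma_dot_mult_GL: "b \<in> block_tri \<Longrightarrow> det b \<noteq> 0 \<Longrightarrow> gamma_dot p m q \<gamma> * b \<in> carrier (GL n)"
  using gamma_dot_GL block_tri_carrier by (auto simp: GL_carrier det_mult)

lemma orbit_mat_full_rank_det: "b \<in> block_tri \<Longrightarrow> det b \<noteq> 0 \<Longrightarrow> orbit_mat b \<in> full_rank_mats q n"
proof -
  assume b: "b \<in> block_tri" "det b \<noteq> 0"
  then have "b \<in> carrier_mat n n" using block_tri_carrier by blast
  then show ?thesis
    using bottom_mat_full_rank[OF n gamma_dot_mult_GL[OF b]] by (simp add: bottom_mat_gamma_dot)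
qed

lemma double_coset_subset_GL:
  "(Q_grp p m q #>\<^bsub>GL n\<^esub> gamma_dot p m q \<gamma>) <#>\<^bsub>GL n\<^esub> Bbar_grp p m q \<subseteq> carrier (GL n)"
proof
  fix g assume "g \<in> (Q_grp p m q #>\<^bsub>GL n\<^esub> gamma_dot p m q \<gamma>) <#>\<^bsub>GL n\<^esub> Bbar_grp p m q"
  then obtain h b where "g = h * b" "h \<in> carrier (GL n)" "b \<in> block_tri" "det b \<noteq> 0"
    unfolding set_mult_def GL_mult Bbar_grp_eq Q_coset_eq[OF n gamma_dot_GL] by blast
  then show "g \<in> carrier (GL n)" using block_tri_carrier by (auto simp: GL_carrier det_mult)
qed

lemma double_coset_image:
  "(\<lambda>g. row_span n (bottom_mat p m q g)) `
    ((Q_grp p m q #>\<^bsub>GL n\<^esub> gamma_dot p m q \<gamma>) <#>\<^bsub>GL n\<^esub> Bbar_grp p m q) = orbit"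
proof (intro Set.set_eqI iffI)
  let ?G = "gamma_dot p m q \<gamma>"
  {
    fix V assume "V \<in> (\<lambda>g. row_span n (bottom_mat p m q g)) `
      ((Q_grp p m q #>\<^bsub>GL n\<^esub> ?G) <#>\<^bsub>GL n\<^esub> Bbar_grp p m q)"
    then obtain x b where x: "x \<in> Q_grp p m q" and b: "b \<in> block_tri" "det b \<noteq> 0"
      and V: "V = row_span n (bottom_mat p m q (x * ?G * b))"
      unfolding set_mult_def r_coset_def GL_mult Bbar_grp_eq by blast
    have "x \<in> carrier_mat n n" using x n by (auto simp: Q_grp_iff GL_carrier)
    then have "x * ?G * b = x * (?G * b)"
      using gamma_dot_carrier b(1) block_tri_carrier by (intro assoc_mult_mat) auto
    moreover have "x * (?G * b) \<in> Q_grp p m q #>\<^bsub>GL n\<^esub> (?G * b)"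
      using x unfolding r_coset_def GL_mult by blast
    ultimately have "V = row_span n (bottom_mat p m q (?G * b))"
      unfolding V Q_coset_eq[OF n gamma_dot_mult_GL[OF b]] by simp
    then show "V \<in> orbit" using b block_tri_carrier bottom_mat_gamma_dot unfolding orbit_def by auto
  next
    fix V assume "V \<in> orbit"
    then obtain b where b: "b \<in> block_tri" "det b \<noteq> 0" "V = row_span n (orbit_mat b)"
      unfolding orbit_def by blast
    have "?G \<in> Q_grp p m q #>\<^bsub>GL n\<^esub> ?G" unfolding Q_coset_eq[OF n gamma_dot_GL] using gamma_dot_GL by simp
    then have "?G * b \<in> (Q_grp p m q #>\<^bsub>GL n\<^esub> ?G) <#>\<^bsub>GL n\<^esub> Bbar_grp p m q"
      using b unfolding set_mult_def GL_mult Bbar_grp_eq by blast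
    moreover have "V = row_span n (bottom_mat p m q (?G * b))"
      using b block_tri_carrier bottom_mat_gamma_dot by auto
    ultimately show "V \<in> (\<lambda>g. row_span n (bottom_mat p m q g)) `
      ((Q_grp p m q #>\<^bsub>GL n\<^esub> ?G) <#>\<^bsub>GL n\<^esub> Bbar_grp p m q)" by blast
  }
qed

lemma f_subspace_full_rank: "A \<in> full_rank_mats q n \<Longrightarrow> f_subspace q n (row_span n A) = f_mat q n A"
  using n by (intro f_subspace_row_span) auto

text \<open>For \<open>n = 0\<close> there is only one matrix.\<close>

lemma positroid_cell_subset_orbit:
  assumes A: "A \<in> full_rank_mats q n" and f: "f_mat q n A = f_gamma p m q \<gamma>"
  shows "row_span n A \<in> orbit"
proof (cases "n = 0")
  case True
  have "1\<^sub>m n \<in> block_tri" by (auto simp: block_tri_def)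
  moreover have "A = orbit_mat (1\<^sub>m n)"
  proof -
    have "A = B" if "B \<in> carrier_mat q n" for B
      using that A True by (intro eq_matI) (auto simp: full_rank_mats_def)
    then show ?thesis using orbit_mat_carrier .
  qed
  ultimately show ?thesis unfolding orbit_def by auto
next
  case False
  have "\<exists>b\<in>block_tri. det b \<noteq> 0 \<and> row_span n A = row_span n (orbit_mat b)"
  proof (rule row_span_in_orbit[OF _ A refl f_window_is_window])
    fix x assume x: "1 \<le> x" "x \<le> p + m"
    then have "x \<le> n" using n by simp
    then show "f_mat q n A (int x) = int (f_window p m q \<gamma> x)"
      unfolding f using f_gamma_window[OF n x(1)] by simp
  qed (use False in auto)
  then show ?thesis unfolding orbit_def by blast
qed

lemma f_mat_eq_f_gamma:
  assumes "b \<in> block_tri" "general_position b"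
  shows "f_mat q n (orbit_mat b) = f_gamma p m q \<gamma>"
proof (cases "n = 0")
  case True
  then show ?thesis using f_mat_0[of "orbit_mat b" n] n orbit_mat_carrier[of b]
    by (auto simp: f_gamma_def fun_eq_iff)
next
  case False
  then have n0: "n > 0" by simp
  show ?thesis
  proof (rule periodic_eqI[OF n0])
    fix x assume "1 \<le> x" "x \<le> n"
    then show "f_mat q n (orbit_mat b) (int x) = f_gamma p m q \<gamma> (int x)"
      using f_mat_general_position[OF n0 assms(2,1) f_window_is_window, of x] f_gamma_window[OF n, of x] by simp
  qed (simp_all add: f_mat_periodic[OF n0 orbit_mat_carrier] f_gamma_periodic[OF n n0])
qed

lemma topspace_Gr: "topspace (Gr_topology q n) = row_span n ` full_rank_mats q n"
proof -
  have "topspace (subtopology (zariski_mat q n) (full_rank_mats q n)) = full_rank_mats q n"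
    by (auto simp: topspace_zariski_mat full_rank_mats_def)
  then show ?thesis
    using quotient_map_quotient_topology[of "subtopology (zariski_mat q n) (full_rank_mats q n)" "row_span n"]
    unfolding Gr_topology_def quotient_map_def by simp
qed

text \<open>A basic neighbourhood of a point of the orbit is given by a polynomial function, whose pullback to
  \<open>block_tri\<close> is nonzero at \<open>b0\<close>. Hence a generic \<open>b\<close> lies in the neighbourhood and in the cell
  simultaneously.\<close>

lemma orbit_subset_closure:
  "orbit \<subseteq> Gr_topology q n closure_of {V \<in> Gr q n. f_subspace q n V = f_gamma p m q \<gamma>}"
proof
  fix V assume "V \<in> orbit"
  then obtain b0 where b0: "b0 \<in> block_tri" "det b0 \<noteq> 0" and V: "V = row_span n (orbit_mat b0)"
    unfolding orbit_def by blast
  have fr: "orbit_mat b0 \<in> full_rank_mats q n" by (rule orbit_mat_full_rank_det[OF b0])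
  have tY: "topspace (subtopology (zariski_mat q n) (full_rank_mats q n)) = full_rank_mats q n"
    by (auto simp: topspace_zariski_mat full_rank_mats_def)
  show "V \<in> Gr_topology q n closure_of {V \<in> Gr q n. f_subspace q n V = f_gamma p m q \<gamma>}"
    unfolding in_closure_of
  proof (intro conjI allI impI)
    show "V \<in> topspace (Gr_topology q n)" unfolding topspace_Gr V using fr by blast
    fix U assume U: "V \<in> U \<and> openin (Gr_topology q n) U"
    then have "openin (subtopology (zariski_mat q n) (full_rank_mats q n))
        {A \<in> full_rank_mats q n. row_span n A \<in> U}"
      unfolding Gr_topology_def openin_quotient_topology tY by blast
    then obtain \<F> where \<F>: "\<F> \<subseteq> poly_funs q n"
      "{A \<in> full_rank_mats q n. row_span n A \<in> U} = {A \<in> full_rank_mats q n. \<exists>f\<in>\<F>. f A \<noteq> 0}"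
      using openin_zariski_sub[of "full_rank_mats q n" q n] by (auto simp: full_rank_mats_def)
    then obtain f where f: "f \<in> \<F>" "f (orbit_mat b0) \<noteq> 0" using U V fr by blast
    have "(\<lambda>b. f (orbit_mat b)) \<in> poly_funs n n"
    proof (rule poly_funs_compose)
      show "f \<in> poly_funs q n" using f \<F> by blast
      fix i j assume "i < q" "j < n"
      then show "(\<lambda>b. orbit_mat b $$ (i, j)) \<in> poly_funs n n"
        using pn orbit_col_poly[of "flip p j" i] by (simp add: orbit_mat_def)
    qed
    then have "generic (\<lambda>b. f (orbit_mat b) \<noteq> 0)" using b0(1) f(2) by (rule genericI)
    from generic_conj[OF this generic_general_position] obtain b
      where b: "b \<in> block_tri" "f (orbit_mat b) \<noteq> 0" "general_position b" unfolding generic_def by blast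
    have frb: "orbit_mat b \<in> full_rank_mats q n" by (rule orbit_mat_full_rank[OF b(3)])
    show "\<exists>V. V \<in> {V \<in> Gr q n. f_subspace q n V = f_gamma p m q \<gamma>} \<and> V \<in> U"
    proof (intro exI conjI CollectI)
      show "row_span n (orbit_mat b) \<in> Gr q n" using frb by (simp add: full_rank_mats_def)
      show "f_subspace q n (row_span n (orbit_mat b)) = f_gamma p m q \<gamma>"
        unfolding f_subspace_full_rank[OF frb] by (rule f_mat_eq_f_gamma[OF b(1,3)])
      show "row_span n (orbit_mat b) \<in> U" using \<F>(2) frb f(1) b(2) by blast
    qed
  qed
qed

lemma closure_orbit: "Gr_topology q n closure_of orbit = positroid_variety q n (f_gamma p m q \<gamma>)"
proof
  let ?\<Pi> = "{V \<in> Gr q n. f_subspace q n V = f_gamma p m q \<gamma>}"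
  show "Gr_topology q n closure_of orbit \<subseteq> positroid_variety q n (f_gamma p m q \<gamma>)"
    unfolding positroid_variety_def by (rule closure_of_minimal[OF orbit_subset_closure closedin_closure_of])
  have "topspace (Gr_topology q n) \<inter> ?\<Pi> \<subseteq> orbit"
    unfolding topspace_Gr using positroid_cell_subset_orbit f_subspace_full_rank by auto
  then show "positroid_variety q n (f_gamma p m q \<gamma>) \<subseteq> Gr_topology q n closure_of orbit"
    unfolding positroid_variety_def by (subst closure_of_restrict) (rule closure_of_mono)
qed

end

theorem theorem6p3:
  fixes p m q n :: nat and \<gamma> :: preclan
  assumes "n = p + m + q"
    and "is_preclan p m q \<gamma>"
    and "v_perm p m q \<gamma> = id"
  shows "coset_to_Gr n q `
      (\<lambda>C. C #>\<^bsub>GL n\<^esub> u0 p m q) `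
        (coset_topology p m q closure_of
          (\<lambda>g. Q_grp p m q #>\<^bsub>GL n\<^esub> g) `
            ((Q_grp p m q #>\<^bsub>GL n\<^esub> gamma_dot p m q \<gamma>) <#>\<^bsub>GL n\<^esub> Bbar_grp p m q))
    = positroid_variety q n (f_gamma p m q \<gamma>)"
proof -
  interpret identity_preclan p m q n \<gamma> by unfold_locales (fact assms)+
  let ?\<Phi> = "\<lambda>C. coset_to_Gr n q (C #>\<^bsub>GL n\<^esub> u0 p m q)"
  let ?\<pi> = "\<lambda>g. Q_grp p m q #>\<^bsub>GL n\<^esub> g"
  let ?D = "(Q_grp p m q #>\<^bsub>GL n\<^esub> gamma_dot p m q \<gamma>) <#>\<^bsub>GL n\<^esub> Bbar_grp p m q"
  have "topspace (subtopology (zariski_mat n n) (carrier (GL n))) = carrier (GL n)"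
    by (auto simp: topspace_zariski_mat GL_carrier)
  then have "topspace (coset_topology p m q) = ?\<pi> ` carrier (GL n)"
    using quotient_map_quotient_topology[of "subtopology (zariski_mat n n) (carrier (GL n))" ?\<pi>]
    unfolding coset_topology_def Let_def quotient_map_def n[symmetric] by simp
  then have "?\<pi> ` ?D \<subseteq> topspace (coset_topology p m q)" using double_coset_subset_GL by auto
  then have "?\<Phi> ` (coset_topology p m q closure_of ?\<pi> ` ?D) = Gr_topology q n closure_of (?\<Phi> ` ?\<pi> ` ?D)"
    by (rule homeomorphic_map_closure_of[OF homeomorphic_map_coset_Gr[OF n], symmetric])
  also have "?\<Phi> ` ?\<pi> ` ?D = (\<lambda>g. row_span n (bottom_mat p m q g)) ` ?D"
    unfolding image_image using double_coset_subset_GL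
    by (intro image_cong refl coset_to_Gr_coset[OF n]) blast
  finally show ?thesis unfolding double_coset_image closure_orbit by (simp add: image_image)
qed

end
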